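(* Let $p>1$, let $(M,g)$ be a complete Riemannian manifold and let $\Omega\subset M$ be an open set. Let $\alpha\in\mathbb{R}$ and let $\rho\in W^{1,p}_{loc}(\Omega)$ be a nonnegative function such that (i) $-(p-1-\alpha)\Delta_p\rho\ge0$ on $\Omega$ in weak sense; (ii) $\frac{|\nabla\rho|^p}{\rho^{p-\alpha}}\in L^1_{loc}(\Omega)$ and $\rho^\alpha\in L^1_{loc}(\Omega)$. Then $$\left(\frac{|p-1-\alpha|}{p}\right)^p\int_\Omega\rho^\alpha\frac{|u|^p}{\rho^p}|\nabla\rho|^p\,dv_g\le\int_\Omega\rho^\alpha|\nabla u|^p\,dv_g\qquad\text{for every }u\in C_0^\infty(\Omega).$$
   Context: $dv_g$, $\nabla$, $\mathrm{div}$ are the volume form, gradient and divergence of $g$; $\Delta_p u=\mathrm{div}(|\nabla u|^{p-2}\nabla u)$. $C_0^k(\Omega)$ denotes compactly supported $C^k$ functions in $\Omega$. For a constant $c\in\mathbb{R}$, "$-c\,\Delta_p\rho\ge0$ on $\Omega$ in weak sense" means $c\int_\Omega|\nabla\rho|^{p-2}(\nabla\rho\cdot\nabla\varphi)\,dv_g\ge0$ for every nonnegative $\varphi\in C_0^1(\Omega)$. *)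

theory Defs
  imports "HOL-Analysis.Analysis"
begin

section \<open>Functions of class $C^k$ on open subsets of a Euclidean space\<close>

primrec Ck_on :: "nat \<Rightarrow> 'a::euclidean_space set \<Rightarrow> ('a \<Rightarrow> 'b::real_normed_vector) \<Rightarrow> bool" where
  "Ck_on 0 S f \<longleftrightarrow> continuous_on S f"
| "Ck_on (Suc k) S f \<longleftrightarrow>
     (\<forall>x\<in>S. f differentiable (at x)) \<and>
     (\<forall>v. Ck_on k S (\<lambda>x. frechet_derivative f (at x) v))"

definition smooth_on :: "'a::euclidean_space set \<Rightarrow> ('a \<Rightarrow> 'b::real_normed_vector) \<Rightarrow> bool" where
  "smooth_on S f \<longleftrightarrow> (\<forall>k. Ck_on k S f)"

section \<open>Riemannian manifolds\<close>

text \<open>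
  The underlying set of a manifold is a whole type \<open>'m\<close>, carrying its topology by type class; the
  dimension is the cardinality of \<open>'n\<close>. A chart is a pair of its domain and its coordinate map; the
  values of the coordinate map outside the domain are irrelevant.
  The set of charts is some smooth atlas, not necessarily the maximal one; none of the notions
  below depends on which atlas of the smooth structure is used.

  A tangent vector at a point is represented by the family of its coordinate vectors in all charts
  around that point (and by 0 in every other chart, to make the representation unique).
\<close>

type_synonym ('m, 'n) chart = "'m set \<times> ('m \<Rightarrow> real ^ 'n)"

type_synonym ('m, 'n) tvec = "('m, 'n) chart \<Rightarrow> real ^ 'n"

record ('m, 'n::finite) rmanifold =
  charts :: "('m, 'n) chart set"
  metric :: "'m \<Rightarrow> ('m, 'n) tvec \<Rightarrow> ('m, 'n) tvec \<Rightarrow> real"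

definition chart_inv :: "('m, 'n::finite) chart \<Rightarrow> real ^ 'n \<Rightarrow> 'm" where
  "chart_inv c = inv_into (fst c) (snd c)"

definition charts_at :: "('m, 'n::finite) rmanifold \<Rightarrow> 'm \<Rightarrow> ('m, 'n) chart set" where
  "charts_at M x = {c \<in> charts M. x \<in> fst c}"

definition transition :: "('m, 'n::finite) chart \<Rightarrow> ('m, 'n) chart \<Rightarrow> real ^ 'n \<Rightarrow> real ^ 'n" where
  "transition c c' = snd c' \<circ> chart_inv c"

definition smooth_atlas ::
    "('m::{t2_space, second_countable_topology}, 'n::finite) chart set \<Rightarrow> bool" where
  "smooth_atlas A \<longleftrightarrow>
     (\<Union>c\<in>A. fst c) = UNIV \<and>
     (\<forall>c\<in>A. open (fst c) \<and> open (snd c ` fst c) \<and>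
             homeomorphism (fst c) (snd c ` fst c) (snd c) (chart_inv c)) \<and>
     (\<forall>c\<in>A. \<forall>c'\<in>A. smooth_on (snd c ` (fst c \<inter> fst c')) (transition c c'))"

definition tangent_space :: "('m, 'n::finite) rmanifold \<Rightarrow> 'm \<Rightarrow> ('m, 'n) tvec set" where
  "tangent_space M x =
     {v. (\<forall>c\<in>charts_at M x. \<forall>c'\<in>charts_at M x.
            v c' = frechet_derivative (transition c c') (at (snd c x)) (v c)) \<and>
         (\<forall>c. c \<notin> charts_at M x \<longrightarrow> v c = 0)}"

text \<open>The coordinate vector field \<open>\<partial>\<^sub>i\<close> of the chart \<open>c\<close> at the point \<open>x\<close>.\<close>

definition coord_vec ::
    "('m, 'n::finite) rmanifold \<Rightarrow> ('m, 'n) chart \<Rightarrow> 'n \<Rightarrow> 'm \<Rightarrow> ('m, 'n) tvec" where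
  "coord_vec M c i x =
     (\<lambda>c'. if c' \<in> charts_at M x
           then frechet_derivative (transition c c') (at (snd c x)) (axis i 1) else 0)"

text \<open>The matrix \<open>g\<^sub>i\<^sub>j\<close> of the metric in the chart \<open>c\<close>, as a function of the coordinates.\<close>

definition metric_coeff ::
    "('m, 'n::finite) rmanifold \<Rightarrow> ('m, 'n) chart \<Rightarrow> real ^ 'n \<Rightarrow> real ^ 'n ^ 'n" where
  "metric_coeff M c y =
     (let x = chart_inv c y in \<chi> i j. metric M x (coord_vec M c i x) (coord_vec M c j x))"

definition riemannian_manifold ::
    "('m::{t2_space, second_countable_topology}, 'n::finite) rmanifold \<Rightarrow> bool" where
  "riemannian_manifold M \<longleftrightarrow>
     smooth_atlas (charts M) \<and>
     (\<forall>x. \<forall>u\<in>tangent_space M x. \<forall>v\<in>tangent_space M x.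
        metric M x u v = metric M x v u \<and>
        (\<forall>w\<in>tangent_space M x. \<forall>a b.
           metric M x (\<lambda>c. a *\<^sub>R u c + b *\<^sub>R v c) w = a * metric M x u w + b * metric M x v w) \<and>
        (u \<noteq> (\<lambda>_. 0) \<longrightarrow> metric M x u u > 0)) \<and>
     (\<forall>c\<in>charts M. \<forall>i j. smooth_on (snd c ` fst c) (\<lambda>y. metric_coeff M c y $ i $ j))"

definition tnorm :: "('m, 'n::finite) rmanifold \<Rightarrow> 'm \<Rightarrow> ('m, 'n) tvec \<Rightarrow> real" where
  "tnorm M x v = sqrt (metric M x v v)"

section \<open>Riemannian distance and completeness\<close>

definition piecewise_C1_curve ::
    "('m::topological_space, 'n::finite) rmanifold \<Rightarrow> (real \<Rightarrow> 'm) \<Rightarrow> bool" where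
  "piecewise_C1_curve M \<gamma> \<longleftrightarrow>
     continuous_on {0..1} \<gamma> \<and>
     (\<exists>F. finite F \<and>
        (\<forall>c\<in>charts M. (snd c \<circ> \<gamma>) C1_differentiable_on (({0..1} - F) \<inter> \<gamma> -` fst c)))"

definition velocity :: "('m, 'n::finite) rmanifold \<Rightarrow> (real \<Rightarrow> 'm) \<Rightarrow> real \<Rightarrow> ('m, 'n) tvec" where
  "velocity M \<gamma> t =
     (\<lambda>c. if c \<in> charts_at M (\<gamma> t) then vector_derivative (snd c \<circ> \<gamma>) (at t) else 0)"

definition curve_length :: "('m, 'n::finite) rmanifold \<Rightarrow> (real \<Rightarrow> 'm) \<Rightarrow> ennreal" where
  "curve_length M \<gamma> = (\<integral>\<^sup>+t\<in>{0..1}. ennreal (tnorm M (\<gamma> t) (velocity M \<gamma> t)) \<partial>lborel)"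

text \<open>The distance between points of different connected components is \<open>\<infinity>\<close>.\<close>

definition rdist :: "('m::topological_space, 'n::finite) rmanifold \<Rightarrow> 'm \<Rightarrow> 'm \<Rightarrow> ennreal" where
  "rdist M x y =
     (INF \<gamma>\<in>{\<gamma>. piecewise_C1_curve M \<gamma> \<and> \<gamma> 0 = x \<and> \<gamma> 1 = y}. curve_length M \<gamma>)"

definition rcomplete :: "('m::topological_space, 'n::finite) rmanifold \<Rightarrow> bool" where
  "rcomplete M \<longleftrightarrow>
     (\<forall>X :: nat \<Rightarrow> 'm.
        (\<forall>e>0. \<exists>N. \<forall>m\<ge>N. \<forall>n\<ge>N. rdist M (X m) (X n) < e) \<longrightarrow>
        (\<exists>x. (\<lambda>n. rdist M (X n) x) \<longlonglongrightarrow> 0))"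

definition complete_riemannian_manifold ::
    "('m::{t2_space, second_countable_topology}, 'n::finite) rmanifold \<Rightarrow> bool" where
  "complete_riemannian_manifold M \<longleftrightarrow> riemannian_manifold M \<and> rcomplete M"

section \<open>The Riemannian volume\<close>

text \<open>
  The Riemannian volume is the (unique) measure on the Lebesgue sets of the manifold that is
  $\sqrt{\det g_{ij}}\,dy$ in every chart.
\<close>

definition riemannian_volume ::
    "('m::topological_space, 'n::finite) rmanifold \<Rightarrow> 'm measure \<Rightarrow> bool" where
  "riemannian_volume M vol \<longleftrightarrow>
     sets vol = {B. \<forall>c\<in>charts M. snd c ` (B \<inter> fst c) \<in> sets lebesgue} \<and>
     (\<forall>c\<in>charts M. \<forall>B\<in>sets vol. B \<subseteq> fst c \<longrightarrow>
        emeasure vol B = (\<integral>\<^sup>+y\<in>snd c ` B. ennreal (sqrt (det (metric_coeff M c y))) \<partial>lebesgue))"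

section \<open>Differentiable functions and their gradients\<close>

text \<open>
  A compactly supported function on an open set \<open>\<Omega>\<close> is identified with its extension by zero to
  the whole manifold.
\<close>

definition compactly_supported_in :: "'a::topological_space set \<Rightarrow> ('a \<Rightarrow> real) \<Rightarrow> bool" where
  "compactly_supported_in \<Omega> u \<longleftrightarrow> compact (closure {x. u x \<noteq> 0}) \<and> closure {x. u x \<noteq> 0} \<subseteq> \<Omega>"

definition C0k :: "('m::topological_space, 'n::finite) rmanifold \<Rightarrow> nat \<Rightarrow> 'm set \<Rightarrow> ('m \<Rightarrow> real) set"
  where "C0k M k \<Omega> =
    {u. (\<forall>c\<in>charts M. Ck_on k (snd c ` fst c) (u \<circ> chart_inv c)) \<and> compactly_supported_in \<Omega> u}"

definition C0inf :: "('m::topological_space, 'n::finite) rmanifold \<Rightarrow> 'm set \<Rightarrow> ('m \<Rightarrow> real) set"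
  where "C0inf M \<Omega> = (\<Inter>k. C0k M k \<Omega>)"

text \<open>The gradient: $g(\nabla u, v) = du(v)$ for all tangent vectors \<open>v\<close>.\<close>

definition grad :: "('m, 'n::finite) rmanifold \<Rightarrow> ('m \<Rightarrow> real) \<Rightarrow> 'm \<Rightarrow> ('m, 'n) tvec" where
  "grad M u x =
     (THE X. X \<in> tangent_space M x \<and>
        (\<forall>c\<in>charts_at M x. \<forall>v\<in>tangent_space M x.
           metric M x X v = frechet_derivative (u \<circ> chart_inv c) (at (snd c x)) (v c)))"

section \<open>Local integrability and Sobolev functions\<close>

definition Lp_loc ::
    "'a::topological_space measure \<Rightarrow> real \<Rightarrow> 'a set \<Rightarrow> ('a \<Rightarrow> 'b::real_normed_vector) \<Rightarrow> bool" where
  "Lp_loc \<mu> p \<Omega> f \<longleftrightarrow>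
     f \<in> borel_measurable (restrict_space \<mu> \<Omega>) \<and>
     (\<forall>K. compact K \<and> K \<subseteq> \<Omega> \<longrightarrow> (\<integral>\<^sup>+x\<in>K. ennreal (norm (f x) powr p) \<partial>\<mu>) < \<infinity>)"

text \<open>\<open>L\<^sup>1\<^sub>l\<^sub>o\<^sub>c\<close> for functions with values in $[0,\infty]$.\<close>

definition L1_loc_nonneg ::
    "'a::topological_space measure \<Rightarrow> 'a set \<Rightarrow> ('a \<Rightarrow> ennreal) \<Rightarrow> bool" where
  "L1_loc_nonneg \<mu> \<Omega> f \<longleftrightarrow>
     f \<in> borel_measurable (restrict_space \<mu> \<Omega>) \<and>
     (\<forall>K. compact K \<and> K \<subseteq> \<Omega> \<longrightarrow> (\<integral>\<^sup>+x\<in>K. f x \<partial>\<mu>) < \<infinity>)"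

text \<open>\<open>G\<close> is the vector of weak partial derivatives of \<open>f\<close> on the open set \<open>W\<close>.\<close>

definition weak_partials :: "(real ^ 'n::finite) set \<Rightarrow> (real ^ 'n \<Rightarrow> real) \<Rightarrow> (real ^ 'n \<Rightarrow> real ^ 'n) \<Rightarrow> bool"
  where "weak_partials W f G \<longleftrightarrow>
    Lp_loc lebesgue 1 W f \<and> Lp_loc lebesgue 1 W G \<and>
    (\<forall>\<phi>. smooth_on UNIV \<phi> \<and> compactly_supported_in W \<phi> \<longrightarrow>
       (\<forall>i. (LINT y:W|lebesgue. f y * frechet_derivative \<phi> (at y) (axis i 1)) =
            - (LINT y:W|lebesgue. G y $ i * \<phi> y)))"

text \<open>
  \<open>X\<close> is a weak gradient of \<open>\<rho>\<close> on \<open>\<Omega>\<close>: in every chart, the weak partial derivative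
  $\partial_i\rho$ is $g(X, \partial_i)$. It is determined almost everywhere; its values outside
  \<open>\<Omega>\<close> are irrelevant.
\<close>

definition weak_gradient ::
    "('m, 'n::finite) rmanifold \<Rightarrow> 'm set \<Rightarrow> ('m \<Rightarrow> real) \<Rightarrow> ('m \<Rightarrow> ('m, 'n) tvec) \<Rightarrow> bool" where
  "weak_gradient M \<Omega> \<rho> X \<longleftrightarrow>
     (\<forall>x\<in>\<Omega>. X x \<in> tangent_space M x) \<and>
     (\<forall>c\<in>charts M.
        weak_partials (snd c ` (fst c \<inter> \<Omega>)) (\<rho> \<circ> chart_inv c)
          (\<lambda>y. let x = chart_inv c y in \<chi> i. metric M x (X x) (coord_vec M c i x)))"

text \<open>\<open>\<rho>\<close> belongs to \<open>W\<^sup>1\<^sup>,\<^sup>p\<^sub>l\<^sub>o\<^sub>c(\<Omega>)\<close>, with weak gradient \<open>X\<close>.\<close>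

definition W1p_loc ::
    "('m::topological_space, 'n::finite) rmanifold \<Rightarrow> 'm measure \<Rightarrow> real \<Rightarrow> 'm set \<Rightarrow>
     ('m \<Rightarrow> real) \<Rightarrow> ('m \<Rightarrow> ('m, 'n) tvec) \<Rightarrow> bool" where
  "W1p_loc M vol p \<Omega> \<rho> X \<longleftrightarrow>
     Lp_loc vol p \<Omega> \<rho> \<and> weak_gradient M \<Omega> \<rho> X \<and> Lp_loc vol p \<Omega> (\<lambda>x. tnorm M x (X x))"

section \<open>The weak inequality and powers\<close>

text \<open>
  $-c\,\Delta_p\rho \ge 0$ on \<open>\<Omega>\<close> in the weak sense, for \<open>\<rho>\<close> with weak gradient \<open>X\<close>. Where \<open>X = 0\<close>,
  the integrand is 0 for every \<open>p\<close>, as it should be.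
\<close>

definition weak_p_Laplace_ineq ::
    "('m::topological_space, 'n::finite) rmanifold \<Rightarrow> 'm measure \<Rightarrow> real \<Rightarrow> 'm set \<Rightarrow> real \<Rightarrow>
     ('m \<Rightarrow> ('m, 'n) tvec) \<Rightarrow> bool" where
  "weak_p_Laplace_ineq M vol p \<Omega> c X \<longleftrightarrow>
     (\<forall>\<phi>\<in>C0k M 1 \<Omega>. (\<forall>x. 0 \<le> \<phi> x) \<longrightarrow>
        0 \<le> c * (LINT x:\<Omega>|vol. tnorm M x (X x) powr (p - 2) * metric M x (X x) (grad M \<phi> x)))"

text \<open>
  Real powers of a nonnegative number with values in $[0,\infty]$, where (unlike with \<open>powr\<close>)
  \<open>0\<^sup>0 = 1\<close> and \<open>0\<^sup>a = \<infinity>\<close> for \<open>a < 0\<close>. In \<open>ennreal\<close>, division by 0 satisfies \<open>0 / 0 = 0\<close> and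
  \<open>x / 0 = \<infinity>\<close> for \<open>x > 0\<close>; thus quotients such as $|\nabla\rho|^p/\rho^q$ with \<open>q > 0\<close> vanish
  where \<open>\<rho>\<close> and \<open>\<nabla>\<rho>\<close> both do, that is, almost everywhere on the zero set of \<open>\<rho>\<close>.
\<close>

definition epowr :: "real \<Rightarrow> real \<Rightarrow> ennreal" where
  "epowr r a =
     (if r = 0 then (if a < 0 then \<infinity> else if a = 0 then 1 else 0) else ennreal (r powr a))"

end

theory Submission
  imports Defs
begin

text \<open>
  Put $b = p - 1 - \alpha$. Testing the weak inequality with $|u|^p F(\rho)$, where $F$ approximates
  $t^{-b}$, and letting $F \to t^{-b}$ gives
  $b^2 \int |u|^p \rho^{\alpha-p} |\nabla\rho|^p \le
    b \int \rho^{-b} |\nabla\rho|^{p-2} \nabla\rho \cdot \nabla |u|^p$, and Young's inequality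
  with the weight $|b|/p$ turns this into the claim; the left-hand side is finite by hypothesis, so it
  can be absorbed.

  The test function is admissible after localisation: a partition of unity writes $|u|^p$ as a finite
  sum of nonnegative $C^1$ functions $w$ supported in charts, and in a chart $w F(\rho)$ is a limit of
  the $C^1$ functions $w F(\rho_\delta)$ with $\rho_\delta$ a mollification of $\rho$. The gradients
  converge in $L^p$, which is enough because $|\nabla\rho|^{p-1}$ is in the dual space.
\<close>

text \<open>The sign of \<open>b\<close> is free. The factor \<open>b\<close> of the weak inequality
  meets the factor -b from differentiating t^(-b), and the product -b^2 gives the same estimate for
  both signs. For the same reason \<open>F\<close> has to be tamed at 0 and at infinity at once. The
  passage to the limit rests on the identity -b = (\<alpha> - p)(p - 1)/p + \<alpha>/p. By Young,
  \<rho>^(-b) |grad \<rho>|^(p-1) is at most |grad \<rho>|^p \<rho>^(\<alpha>-p) + \<rho>^\<alpha>,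
  and these two terms are locally integrable by the two conditions in (ii). For the remaining
  gradient term Fatou's lemma suffices. The weight s = |b|/p maximises |b| s^(p-1) - (p-1) s^p, the
  constant that absorption leaves, and the maximum is s^p. A separate concern is the zero set of
  \<rho>: real powers are 0 there, while the extended powers of the statement may be infinite.
  Condition (ii) makes the gradient vanish almost everywhere on this set when \<alpha> < p.\<close>

section \<open>Calculus of C^k functions and a smooth bump function\<close>

lemma Ck_on_SucD: "Ck_on (Suc k) S f \<Longrightarrow> Ck_on k S f"
proof (induction k arbitrary: f)
  case 0
  then show ?case
    by (auto intro!: continuous_at_imp_continuous_on differentiable_imp_continuous_within)
qed auto

lemma Ck_on_const: "Ck_on k UNIV (\<lambda>_. c)"
  by (induction k arbitrary: c) auto

lemma Ck_on_add:
  assumes "Ck_on k UNIV f" "Ck_on k UNIV g"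
  shows "Ck_on k UNIV (\<lambda>x. f x + g x)"
  using assms
proof (induction k arbitrary: f g)
  case 0
  then show ?case by (auto intro: continuous_intros)
next
  case (Suc k)
  have "frechet_derivative (\<lambda>x. f x + g x) (at x) v
      = frechet_derivative f (at x) v + frechet_derivative g (at x) v" for x v
  proof -
    have "((\<lambda>x. f x + g x) has_derivative
        (\<lambda>v. frechet_derivative f (at x) v + frechet_derivative g (at x) v)) (at x)"
      using Suc.prems by (auto intro!: derivative_intros simp: frechet_derivative_works[symmetric])
    from frechet_derivative_at[OF this] show ?thesis by metis
  qed
  then show ?case using Suc by (auto intro: derivative_intros)
qed

lemma Ck_on_mult:
  fixes f g :: "'a::euclidean_space \<Rightarrow> real"
  assumes "Ck_on k UNIV f" "Ck_on k UNIV g"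
  shows "Ck_on k UNIV (\<lambda>x. f x * g x)"
  using assms
proof (induction k arbitrary: f g)
  case 0
  then show ?case by (auto intro: continuous_intros)
next
  case (Suc k)
  have *: "frechet_derivative (\<lambda>x. f x * g x) (at x) v
      = f x * frechet_derivative g (at x) v + frechet_derivative f (at x) v * g x" for x v
  proof -
    have "((\<lambda>x. f x * g x) has_derivative
        (\<lambda>v. f x * frechet_derivative g (at x) v + frechet_derivative f (at x) v * g x)) (at x)"
      using Suc.prems by (auto intro!: derivative_intros simp: frechet_derivative_works[symmetric])
    from frechet_derivative_at[OF this] show ?thesis by metis
  qed
  have "Ck_on k UNIV f" "Ck_on k UNIV g"
    using Suc.prems Ck_on_SucD by blast+
  then show ?case using Suc unfolding * Ck_on.simps
    by (auto intro!: derivative_intros Ck_on_add)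
qed

lemma Ck_on_bounded_linear:
  assumes "bounded_linear f" shows "Ck_on k UNIV f"
proof (cases k)
  case (Suc j)
  have "frechet_derivative f (at x) v = f v" for x v
    using frechet_derivative_at[OF bounded_linear_imp_has_derivative[OF assms]] by metis
  then show ?thesis using Suc assms
    by (auto simp: Ck_on_const bounded_linear_imp_differentiable)
qed (use assms in \<open>auto simp: linear_continuous_on\<close>)

text \<open>The polynomials for which the \<open>m\<close>-th derivative of $e^{-1/t}$ is $P_m(1/t)\,e^{-1/t}$.\<close>

primrec bump_poly :: "nat \<Rightarrow> real poly" where
  "bump_poly 0 = 1"
| "bump_poly (Suc m) = [:0, 0, 1:] * (bump_poly m - pderiv (bump_poly m))"

definition bump_deriv :: "nat \<Rightarrow> real \<Rightarrow> real" where
  "bump_deriv m t = (if t > 0 then poly (bump_poly m) (1 / t) * exp (- (1 / t)) else 0)"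

lemma poly_mult_exp_tendsto_0: "((\<lambda>s::real. poly P s * exp (- s)) \<longlongrightarrow> 0) at_top"
proof -
  have "((\<lambda>s. \<Sum>i\<le>degree P. coeff P i * (s ^ i / exp s)) \<longlongrightarrow> (\<Sum>i\<le>degree P. coeff P i * 0)) at_top"
    by (intro tendsto_intros tendsto_power_div_exp_0)
  then show ?thesis
    by (simp add: poly_altdef exp_minus divide_inverse sum_distrib_right mult.assoc)
qed

text \<open>Away from 0 this is the recursion for \<open>bump_poly\<close>. At 0 the difference
  quotient is a polynomial in 1/h times e^(-1/h) on the right and 0 on the left, so the derivative
  is 0.\<close>

lemma DERIV_bump_deriv: "(bump_deriv m has_real_derivative bump_deriv (Suc m) t) (at t)"
proof -
  consider "t > 0" | "t < 0" | "t = 0" by linarith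
  then show ?thesis
  proof cases
    case 1
    have "((\<lambda>t. poly (bump_poly m) (1 / t) * exp (- (1 / t))) has_real_derivative bump_deriv (Suc m) t) (at t)"
      using 1 by (auto intro!: derivative_eq_intros DERIV_chain2[OF poly_DERIV]
          simp: bump_deriv_def field_simps power2_eq_square)
    then show ?thesis
    proof (rule DERIV_cong_ev[OF refl _ refl, THEN iffD1, rotated])
      show "\<forall>\<^sub>F x in nhds t. poly (bump_poly m) (1 / x) * exp (- (1 / x)) = bump_deriv m x"
        using eventually_nhds_in_open[of "{0<..}" t] 1
        by (auto simp: bump_deriv_def elim!: eventually_mono)
    qed
  next
    case 2
    have "((\<lambda>_. 0) has_real_derivative bump_deriv (Suc m) t) (at t)"
      using 2 by (auto simp: bump_deriv_def)
    then show ?thesis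
    proof (rule DERIV_cong_ev[OF refl _ refl, THEN iffD1, rotated])
      show "\<forall>\<^sub>F x in nhds t. 0 = bump_deriv m x"
        using eventually_nhds_in_open[of "{..<0}" t] 2
        by (auto simp: bump_deriv_def elim!: eventually_mono)
    qed
  next
    case 3
    have "((\<lambda>h. bump_deriv m h / h) \<longlongrightarrow> 0) (at 0)"
    proof (subst filterlim_split_at)
      \<comment> \<open>With s = 1/h, the extra factor \<open>[:0, 1:]\<close> is the division by h
        in the difference quotient.\<close>
      have "((\<lambda>s. poly ([:0, 1:] * bump_poly m) s * exp (- s)) \<longlongrightarrow> 0) at_top"
        by (rule poly_mult_exp_tendsto_0)
      from filterlim_compose[OF this filterlim_inverse_at_top_right]
      have "((\<lambda>h. poly ([:0, 1:] * bump_poly m) (inverse h) * exp (- inverse h)) \<longlongrightarrow> 0) (at_right (0::real))" .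
      moreover have "\<forall>\<^sub>F h in at_right 0. poly ([:0, 1:] * bump_poly m) (inverse h) * exp (- inverse h)
          = bump_deriv m h / h"
        by (auto simp: eventually_at_filter bump_deriv_def field_simps)
      ultimately show "((\<lambda>h. bump_deriv m h / h) \<longlongrightarrow> 0) (at_right 0)"
        by (rule Lim_transform_eventually)
      show "((\<lambda>h. bump_deriv m h / h) \<longlongrightarrow> 0) (at_left 0)"
        by (rule tendsto_eventually) (auto simp: eventually_at_filter bump_deriv_def)
    qed auto
    then show ?thesis by (simp add: 3 DERIV_def bump_deriv_def)
  qed
qed

text \<open>The induction runs over all \<open>m\<close> at once, since the chain rule replaces the
  \<open>m\<close>-th derivative of the flat function by the next one.\<close>

lemma Ck_on_compose_bump:
  fixes q :: "'a::euclidean_space \<Rightarrow> real"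
  assumes "\<And>j. Ck_on j UNIV q"
  shows "Ck_on k UNIV (\<lambda>x. bump_deriv m (q x))"
proof (induction k arbitrary: m)
  case 0
  have "continuous_on UNIV (bump_deriv m)"
    using DERIV_bump_deriv by (intro continuous_at_imp_continuous_on) (auto intro: DERIV_isCont)
  moreover have "continuous_on UNIV q" using assms[of 0] by simp
  ultimately show ?case
    by (auto intro: continuous_on_compose2)
next
  case (Suc k)
  have q: "q differentiable (at x)" "Ck_on k UNIV (\<lambda>x. frechet_derivative q (at x) v)" for x v
    using assms[of "Suc k"] by auto
  have D: "((\<lambda>x. bump_deriv m (q x)) has_derivative
      (\<lambda>v. frechet_derivative q (at x) v * bump_deriv (Suc m) (q x))) (at x)" for x
    by (rule DERIV_compose_FDERIV[OF DERIV_bump_deriv])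
      (use q frechet_derivative_works in blast)
  then have "frechet_derivative (\<lambda>x. bump_deriv m (q x)) (at x) v
      = frechet_derivative q (at x) v * bump_deriv (Suc m) (q x)" for x v
    using frechet_derivative_at by metis
  then show ?case using D Suc q by (auto intro!: Ck_on_mult simp: differentiable_def)
qed

text \<open>The argument is r^2 - |y - a|^2 rather than r - |y - a|, so that it is a polynomial in y
  and smooth at the centre as well.\<close>

definition bump :: "'a::euclidean_space \<Rightarrow> real \<Rightarrow> 'a \<Rightarrow> real" where
  "bump a r y = bump_deriv 0 (r\<^sup>2 - (norm (y - a))\<^sup>2)"

lemma bump_nonneg: "0 \<le> bump a r y"
  by (simp add: bump_def bump_deriv_def)

lemma bump_pos_iff: "r > 0 \<Longrightarrow> bump a r y > 0 \<longleftrightarrow> dist y a < r"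
proof -
  assume "r > 0"
  then have "(norm (y - a))\<^sup>2 < r\<^sup>2 \<longleftrightarrow> norm (y - a) < r"
    by (meson norm_ge_zero power2_less_imp_less power_strict_mono pos2 less_imp_le)
  then show ?thesis by (simp add: bump_def bump_deriv_def dist_norm)
qed

lemma bump_eq_0: "r > 0 \<Longrightarrow> dist y a \<ge> r \<Longrightarrow> bump a r y = 0"
  using bump_pos_iff[of r a y] bump_nonneg[of a r y] by auto

lemma smooth_on_bump: "smooth_on UNIV (bump a r)"
proof -
  have lin: "Ck_on j UNIV (\<lambda>y. (y - a) \<bullet> b)" for b j
    using Ck_on_add[OF Ck_on_bounded_linear[OF bounded_linear_inner_left] Ck_on_const[of _ "- (a \<bullet> b)"]]
    by (simp add: inner_diff_left)
  have "Ck_on j UNIV (\<lambda>y. r\<^sup>2 + (\<Sum>b\<in>B. - 1 * (((y - a) \<bullet> b) * ((y - a) \<bullet> b))))"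
    if "finite B" for j and B :: "'a set"
    using that
  proof (induction B rule: finite_induct)
    case (insert x F)
    then show ?case
      using Ck_on_add[OF insert.IH(1) Ck_on_mult[OF Ck_on_const[of _ "-1"] Ck_on_mult[OF lin[of _ x] lin[of _ x]]]]
      by (simp add: algebra_simps)
  qed (simp add: Ck_on_const)
  from this[OF finite_Basis] have "Ck_on j UNIV (\<lambda>y. r\<^sup>2 - (norm (y - a))\<^sup>2)" for j
    unfolding power2_norm_eq_inner euclidean_inner[of "_ - a" "_ - a"] by (simp add: sum_negf)
  from Ck_on_compose_bump[OF this] show ?thesis
    by (simp add: smooth_on_def bump_def[abs_def])
qed

section \<open>Elementary inequalities for real powers\<close>

text \<open>Young's inequality for the exponents p/(p-1) and p, multiplied by p so that no conjugate
  exponent appears. In this form it is also the tangent line inequality for t^p at x, and it covers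
  p = 1, which is used for the L^1 convergence of mollifications.\<close>

lemma young_powr:
  fixes x y p :: real
  assumes "p \<ge> 1" "x \<ge> 0" "y \<ge> 0"
  shows "p * x powr (p - 1) * y \<le> (p - 1) * x powr p + y powr p"
proof (cases "p = 1")
  case True
  then show ?thesis using assms by auto
next
  case False
  with assms have p: "p > 1" by simp
  have "y * x powr (p - 1) \<le> y powr p / p + (x powr (p - 1)) powr (p / (p - 1)) / (p / (p - 1))"
    using p assms by (intro Youngs_inequality) (auto simp: field_simps)
  also have "(x powr (p - 1)) powr (p / (p - 1)) = x powr p"
    using p by (simp add: powr_powr)
  finally show ?thesis using p by (simp add: field_simps)
qed

text \<open>The sum is at most three times the largest of the three absolute values. This crude
  bound stands in for Minkowski's inequality, so that L^p convergence can be treated through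
  integrals of p-th powers.\<close>

lemma powr_add3_le:
  fixes a b c p :: real
  assumes "p \<ge> 0"
  shows "\<bar>a + b + c\<bar> powr p \<le> 3 powr p * (\<bar>a\<bar> powr p + \<bar>b\<bar> powr p + \<bar>c\<bar> powr p)"
proof -
  define m where "m = max \<bar>a\<bar> (max \<bar>b\<bar> \<bar>c\<bar>)"
  have "\<bar>a + b + c\<bar> powr p \<le> (3 * m) powr p"
    using assms by (intro powr_mono2) (auto simp: m_def)
  also have "\<dots> = 3 powr p * m powr p"
    by (simp add: powr_mult m_def)
  also have "m powr p \<le> \<bar>a\<bar> powr p + \<bar>b\<bar> powr p + \<bar>c\<bar> powr p"
    unfolding m_def max_def by auto
  finally show ?thesis by simp
qed

section \<open>Mollification\<close>

lemma integrable_continuous_support: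
  fixes f :: "'a::euclidean_space \<Rightarrow> real"
  assumes "continuous_on UNIV f" "compact K" "\<And>x. x \<notin> K \<Longrightarrow> f x = 0"
  shows "integrable lborel f"
proof -
  have "integrable lborel (\<lambda>x. indicator K x *\<^sub>R f x)"
    using assms by (intro borel_integrable_compact continuous_on_subset[OF assms(1)]) auto
  also have "(\<lambda>x. indicator K x *\<^sub>R f x) = f"
    using assms by (intro ext) (metis indicator_simps scaleR_one scaleR_zero_left)
  finally show ?thesis .
qed

lemma continuous_support_bounded:
  fixes f :: "'a::euclidean_space \<Rightarrow> real"
  assumes "continuous_on UNIV f" "compact K" "\<And>x. x \<notin> K \<Longrightarrow> f x = 0"
  shows "\<exists>C\<ge>0. \<forall>x. \<bar>f x\<bar> \<le> C"
proof -
  have "bounded (f ` K)"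
    by (intro compact_imp_bounded compact_continuous_image continuous_on_subset[OF assms(1)] assms) auto
  then obtain C where "\<forall>x\<in>K. \<bar>f x\<bar> \<le> C" by (auto simp: bounded_iff)
  then have "\<bar>f x\<bar> \<le> \<bar>C\<bar>" for x using assms(3)[of x] by (cases "x \<in> K") force+
  then show ?thesis by (intro exI[of _ "\<bar>C\<bar>"]) simp
qed

lemma nn_integral_lborel_diff:
  fixes f :: "'a::euclidean_space \<Rightarrow> ennreal"
  assumes [measurable]: "f \<in> borel_measurable borel"
  shows "(\<integral>\<^sup>+y. f (y - c) \<partial>lborel) = (\<integral>\<^sup>+y. f y \<partial>lborel)"
proof -
  have "(\<integral>\<^sup>+y. f y \<partial>lborel) = (\<integral>\<^sup>+y. f y \<partial>distr lborel borel ((+) (- c)))"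
    by (simp add: lborel_distr_plus)
  also have "\<dots> = (\<integral>\<^sup>+y. f (y - c) \<partial>lborel)"
    by (subst nn_integral_distr) auto
  finally show ?thesis by simp
qed

lemma bump_continuous: "continuous_on S (bump a r)"
  using smooth_on_bump[of a r] unfolding smooth_on_def
  by (metis Ck_on.simps(1) continuous_on_subset subset_UNIV)

lemma bump_support: "r > 0 \<Longrightarrow> y \<notin> cball a r \<Longrightarrow> bump a r y = 0"
  by (simp add: bump_eq_0 dist_commute)

lemma bump_integrable: "r > 0 \<Longrightarrow> integrable lborel (bump a r)"
  by (rule integrable_continuous_support[OF bump_continuous compact_cball bump_support])

text \<open>A nonnegative function with integral 0 vanishes almost everywhere, but the bump is
  positive on an open ball, which is not negligible. This justifies the normalisation of the
  mollifier.\<close>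

lemma bump_integral_pos:
  assumes "r > 0" shows "(\<integral>x. bump a r x \<partial>lborel) > 0"
proof -
  have "\<not> (AE x in lborel. bump a r x = 0)"
  proof
    assume "AE x in lborel. bump a r x = 0"
    then have "{x. bump a r x \<noteq> 0} \<in> null_sets lborel"
      using AE_iff_null_sets[of "{x. bump a r x \<noteq> 0}" lborel]
        borel_measurable_continuous_onI[OF bump_continuous, of a r] by simp
    moreover have "{x. bump a r x \<noteq> 0} = ball a r"
      using bump_pos_iff[OF assms, of a] bump_nonneg[of a r] by (auto simp: dist_commute less_le)
    ultimately have "negligible (ball a r)"
      by (simp add: negligible_iff_null_sets null_sets_completionI)
    then show False using assms open_not_negligible[of "ball a r"] by auto
  qed
  then show ?thesis
    using integral_nonneg_eq_0_iff_AE[OF bump_integrable[OF assms], of a] bump_nonneg[of a r]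
    by (simp add: less_le)
qed

text \<open>Each radius is normalised by its own integral instead of rescaling one fixed kernel, so
  that no change of variables is needed.\<close>

definition mollifier :: "real \<Rightarrow> 'a::euclidean_space \<Rightarrow> real" where
  "mollifier \<delta> z = bump 0 \<delta> z / (\<integral>x. bump (0::'a) \<delta> x \<partial>lborel)"

definition mollify :: "real \<Rightarrow> ('a::euclidean_space \<Rightarrow> real) \<Rightarrow> 'a \<Rightarrow> real" where
  "mollify \<delta> f y = (\<integral>z. mollifier \<delta> (y - z) * f z \<partial>lborel)"

lemma Ck_on_mollifier: "Ck_on k UNIV (mollifier \<delta> :: 'a::euclidean_space \<Rightarrow> real)"
proof -
  have "Ck_on k UNIV (\<lambda>z::'a. 1 / (\<integral>x. bump (0::'a) \<delta> x \<partial>lborel) * bump 0 \<delta> z)"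
    using smooth_on_bump unfolding smooth_on_def by (intro Ck_on_mult Ck_on_const) auto
  then show ?thesis by (simp add: mollifier_def[abs_def])
qed

lemma mollifier_continuous: "continuous_on UNIV (mollifier \<delta>)"
  using Ck_on_mollifier[of 0] by simp

lemma mollifier_measurable [measurable]: "mollifier \<delta> \<in> borel_measurable borel"
  by (intro borel_measurable_continuous_onI mollifier_continuous)

lemma mollifier_nonneg: "mollifier \<delta> z \<ge> 0"
  unfolding mollifier_def by (intro divide_nonneg_nonneg Bochner_Integration.integral_nonneg bump_nonneg)

lemma mollifier_eq_0: "\<delta> > 0 \<Longrightarrow> \<delta> \<le> norm z \<Longrightarrow> mollifier \<delta> z = 0"
  using bump_eq_0[of \<delta> z 0] by (simp add: mollifier_def)

lemma mollifier_eq_0': "\<delta> > 0 \<Longrightarrow> z \<notin> cball 0 \<delta> \<Longrightarrow> mollifier \<delta> z = 0"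
  using mollifier_eq_0[of \<delta> z] by simp

lemma mollifier_bounded: "\<delta> > 0 \<Longrightarrow> \<exists>C\<ge>0. \<forall>z::'a::euclidean_space. \<bar>mollifier \<delta> z\<bar> \<le> C"
  by (rule continuous_support_bounded[OF mollifier_continuous compact_cball mollifier_eq_0'])

lemma nn_integral_mollifier:
  assumes "\<delta> > 0"
  shows "(\<integral>\<^sup>+z. ennreal (mollifier \<delta> (z::'a::euclidean_space)) \<partial>lborel) = 1"
proof -
  have "(\<integral>z. mollifier \<delta> (z::'a) \<partial>lborel) = 1"
    using bump_integral_pos[OF assms, of "0::'a"] by (simp add: mollifier_def)
  moreover have "integrable lborel (mollifier \<delta> :: 'a \<Rightarrow> real)"
    by (rule integrable_continuous_support[OF mollifier_continuous compact_cball mollifier_eq_0'[OF assms]])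
  ultimately show ?thesis
    by (subst nn_integral_eq_integral) (auto simp: mollifier_nonneg)
qed

lemma mollifier_diff_commute: "mollifier \<delta> (y - z) = mollifier \<delta> (z - y)"
  by (simp add: mollifier_def bump_def norm_minus_commute)

lemma nn_integral_mollifier_diff:
  assumes "\<delta> > 0"
  shows "(\<integral>\<^sup>+z. ennreal (mollifier \<delta> (z - y :: 'a::euclidean_space)) \<partial>lborel) = 1"
    and "(\<integral>\<^sup>+z. ennreal (mollifier \<delta> (y - z :: 'a)) \<partial>lborel) = 1"
  using nn_integral_lborel_diff[of "\<lambda>z. ennreal (mollifier \<delta> z)" y] nn_integral_mollifier[OF assms]
  by (simp_all add: mollifier_diff_commute[of _ y])

lemma mollifier_diff_integral:
  assumes "\<delta> > 0"
  shows "integrable lborel (\<lambda>z::'a::euclidean_space. mollifier \<delta> (y - z))"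
    "(\<integral>z. mollifier \<delta> (y - z :: 'a) \<partial>lborel) = 1"
proof -
  show 1: "integrable lborel (\<lambda>z::'a. mollifier \<delta> (y - z))"
    using nn_integral_mollifier_diff(2)[OF assms, of y]
    by (intro integrableI_nonneg) (auto simp: mollifier_nonneg)
  show "(\<integral>z. mollifier \<delta> (y - z :: 'a) \<partial>lborel) = 1"
    using nn_integral_mollifier_diff(2)[OF assms, of y]
    by (subst (asm) nn_integral_eq_integral[OF 1]) (auto simp: mollifier_nonneg)
qed

lemma integrable_bounded_mult:
  fixes k f :: "'a::euclidean_space \<Rightarrow> real"
  assumes "integrable lborel f" "k \<in> borel_measurable borel" "\<And>z. \<bar>k z\<bar> \<le> C"
  shows "integrable lborel (\<lambda>z. k z * f z)"
proof (rule Bochner_Integration.integrable_bound[where f = "\<lambda>z. C * f z"])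
  have "\<bar>k x\<bar> \<le> \<bar>C\<bar>" for x using assms(3)[of x] by simp
  then show "AE x in lborel. norm (k x * f x) \<le> norm (C * f x)"
    by (auto simp: abs_mult intro!: mult_right_mono)
qed (use assms in auto)

lemma mollify_integrand:
  fixes f :: "'a::euclidean_space \<Rightarrow> real"
  assumes "\<delta> > 0" "integrable lborel f"
  shows "integrable lborel (\<lambda>z. mollifier \<delta> (y - z) * f z)"
proof -
  obtain C where "\<forall>z::'a. \<bar>mollifier \<delta> z\<bar> \<le> C"
    using mollifier_bounded[OF assms(1)] by blast
  then show ?thesis using assms by (intro integrable_bounded_mult[where C=C]) auto
qed

lemma mollify_measurable [measurable]:
  assumes [measurable]: "f \<in> borel_measurable borel"
  shows "mollify \<delta> f \<in> borel_measurable borel"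
  unfolding mollify_def[abs_def] by measurable

text \<open>Jensen's inequality for the probability density z ->
  \<open>mollifier \<delta> (y - z)\<close>. With m the average of |f|, the tangent line of t^p at m
  lies below t^p; averaging this inequality over z gives m^p on the left.\<close>

lemma mollify_powr_le:
  fixes f :: "'a::euclidean_space \<Rightarrow> real"
  assumes d: "\<delta> > 0" and p: "p \<ge> 1" and f: "integrable lborel f"
    and fp: "integrable lborel (\<lambda>z. \<bar>f z\<bar> powr p)"
  shows "\<bar>mollify \<delta> f y\<bar> powr p \<le> (\<integral>z. mollifier \<delta> (y - z) * \<bar>f z\<bar> powr p \<partial>lborel)"
proof -
  define m where "m = (\<integral>z. mollifier \<delta> (y - z) * \<bar>f z\<bar> \<partial>lborel)"
  note I = mollify_integrand[OF d]
  have m: "\<bar>mollify \<delta> f y\<bar> \<le> m" "m \<ge> 0"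
    using integral_norm_bound[of lborel "\<lambda>z. mollifier \<delta> (y - z) * f z"]
    by (auto simp: mollify_def m_def abs_mult mollifier_nonneg intro!: integral_nonneg)
  have le: "p * m powr (p - 1) * (mollifier \<delta> (y - z) * \<bar>f z\<bar>)
      \<le> (p - 1) * m powr p * mollifier \<delta> (y - z) + mollifier \<delta> (y - z) * \<bar>f z\<bar> powr p" for z
    using mult_left_mono[OF young_powr[OF p m(2), of "\<bar>f z\<bar>"], of "mollifier \<delta> (y - z)"]
    by (simp add: mollifier_nonneg algebra_simps)
  have "(\<integral>z. p * m powr (p - 1) * (mollifier \<delta> (y - z) * \<bar>f z\<bar>) \<partial>lborel)
     \<le> (\<integral>z. (p - 1) * m powr p * mollifier \<delta> (y - z) + mollifier \<delta> (y - z) * \<bar>f z\<bar> powr p \<partial>lborel)"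
    using I[of "\<lambda>z. \<bar>f z\<bar>" y] I[OF fp, of y] f mollifier_diff_integral[OF d, of y] le by (intro integral_mono) auto
  then have "p * m powr (p - 1) * m \<le> (p - 1) * m powr p + (\<integral>z. mollifier \<delta> (y - z) * \<bar>f z\<bar> powr p \<partial>lborel)"
    using I[OF fp, of y] mollifier_diff_integral[OF d, of y] by (simp add: m_def)
  moreover have "m powr (p - 1) * m = m powr p"
    using m(2) p by (cases "m = 0") (auto simp: powr_diff)
  ultimately have "p * m powr p \<le> (p - 1) * m powr p + (\<integral>z. mollifier \<delta> (y - z) * \<bar>f z\<bar> powr p \<partial>lborel)"
    by (simp add: mult.assoc)
  then have "m powr p \<le> (\<integral>z. mollifier \<delta> (y - z) * \<bar>f z\<bar> powr p \<partial>lborel)"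
    by (simp add: algebra_simps)
  moreover have "\<bar>mollify \<delta> f y\<bar> powr p \<le> m powr p"
    using m p by (intro powr_mono2) auto
  ultimately show ?thesis by simp
qed

text \<open>Jensen pointwise, then Tonelli: the kernel also has integral 1 with respect to
  y.\<close>

lemma mollify_Lp_contraction:
  fixes f :: "'a::euclidean_space \<Rightarrow> real"
  assumes d: "\<delta> > 0" and p: "p \<ge> 1" and f: "integrable lborel f"
    and fp: "integrable lborel (\<lambda>z. \<bar>f z\<bar> powr p)"
  shows "(\<integral>\<^sup>+y. ennreal (\<bar>mollify \<delta> f y\<bar> powr p) \<partial>lborel) \<le> (\<integral>\<^sup>+y. ennreal (\<bar>f y\<bar> powr p) \<partial>lborel)"
proof -
  have [measurable]: "f \<in> borel_measurable borel" using f by auto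
  have "(\<integral>\<^sup>+y. ennreal (\<bar>mollify \<delta> f y\<bar> powr p) \<partial>lborel)
      \<le> (\<integral>\<^sup>+y. ennreal (\<integral>z. mollifier \<delta> (y - z) * \<bar>f z\<bar> powr p \<partial>lborel) \<partial>lborel)"
    by (intro nn_integral_mono ennreal_leI mollify_powr_le assms)
  also have "\<dots> = (\<integral>\<^sup>+y. (\<integral>\<^sup>+z. ennreal (mollifier \<delta> (y - z) * \<bar>f z\<bar> powr p) \<partial>lborel) \<partial>lborel)"
    by (subst nn_integral_eq_integral[OF mollify_integrand[OF d fp]]) (auto simp: mollifier_nonneg)
  also have "\<dots> = (\<integral>\<^sup>+z. (\<integral>\<^sup>+y. ennreal (mollifier \<delta> (y - z) * \<bar>f z\<bar> powr p) \<partial>lborel) \<partial>lborel)"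
    by (rule lborel_pair.Fubini') measurable
  also have "\<dots> = (\<integral>\<^sup>+z. (\<integral>\<^sup>+y. ennreal (mollifier \<delta> (y - z)) * ennreal (\<bar>f z\<bar> powr p) \<partial>lborel) \<partial>lborel)"
    by (simp add: ennreal_mult mollifier_nonneg)
  also have "\<dots> = (\<integral>\<^sup>+z. ennreal (\<bar>f z\<bar> powr p) \<partial>lborel)"
    by (simp add: nn_integral_multc nn_integral_mollifier_diff[OF d])
  finally show ?thesis .
qed

lemma mollify_diff:
  fixes f g :: "'a::euclidean_space \<Rightarrow> real"
  assumes "\<delta> > 0" "integrable lborel f" "integrable lborel g"
  shows "mollify \<delta> (\<lambda>z. f z - g z) y = mollify \<delta> f y - mollify \<delta> g y"
  using Bochner_Integration.integral_diff[OF mollify_integrand[OF assms(1,2)] mollify_integrand[OF assms(1,3)], of y y]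
  by (simp add: mollify_def right_diff_distrib)

text \<open>Truncate first, so that the continuous approximants can be clamped and hence dominated.\<close>

lemma Lp_continuous_approx:
  fixes f :: "'a::euclidean_space \<Rightarrow> real"
  assumes p: "p \<ge> 1" and f [measurable]: "f \<in> borel_measurable borel"
    and fp: "integrable lborel (\<lambda>z. \<bar>f z\<bar> powr p)"
    and supp: "\<And>z. z \<notin> cball 0 R \<Longrightarrow> f z = 0" and e: "e > 0"
  shows "\<exists>g. continuous_on UNIV g \<and> (\<forall>z. z \<notin> cball 0 (R + 1) \<longrightarrow> g z = 0) \<and>
    (\<integral>\<^sup>+z. ennreal (\<bar>f z - g z\<bar> powr p) \<partial>lborel) < ennreal e"
proof -
  define cl where "cl B t = max (- real B) (min (real B) t)" for B :: nat and t :: real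
  have cl_bd: "\<bar>cl B t\<bar> \<le> B" for B t by (auto simp: cl_def)
  have cl_cont: "continuous_on UNIV (cl B)" for B
    unfolding cl_def[abs_def] by (intro continuous_intros)
  have [measurable]: "cl B \<in> borel_measurable borel" for B
    by (intro borel_measurable_continuous_onI cl_cont)
  have "((\<lambda>B. \<integral>z. \<bar>f z - cl B (f z)\<bar> powr p \<partial>lborel) \<longlonglongrightarrow> (\<integral>z. 0 \<partial>(lborel :: 'a measure)))"
  proof (rule integral_dominated_convergence[where w = "\<lambda>z. \<bar>f z\<bar> powr p"])
    show "AE z in lborel. (\<lambda>B. \<bar>f z - cl B (f z)\<bar> powr p) \<longlonglongrightarrow> 0"
    proof (intro AE_I2 tendsto_eventually)
      fix z
      obtain N where "\<bar>f z\<bar> \<le> real N" using real_arch_simple by blast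
      then have "\<forall>B\<ge>N. \<bar>f z - cl B (f z)\<bar> powr p = 0" by (auto simp: cl_def)
      then show "\<forall>\<^sub>F B in sequentially. \<bar>f z - cl B (f z)\<bar> powr p = 0"
        by (auto simp: eventually_sequentially)
    qed
    show "AE z in lborel. norm (\<bar>f z - cl B (f z)\<bar> powr p) \<le> \<bar>f z\<bar> powr p" for B
      using p by (auto intro!: powr_mono2 simp: cl_def)
  qed (use fp in auto)
  then have "\<forall>\<^sub>F B in sequentially. (\<integral>z. \<bar>f z - cl B (f z)\<bar> powr p \<partial>lborel) < e / (2 * 3 powr p)"
    using e by (intro order_tendstoD(2)) auto
  \<comment> \<open>The truncation error and the later approximation error each get half of e; the
    factor 3^p is the price of adding them with \<open>powr_add3_le\<close>.\<close>
  then obtain B where B: "(\<integral>z. \<bar>f z - cl B (f z)\<bar> powr p \<partial>lborel) < e / (2 * 3 powr p)"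
    by (auto simp: eventually_sequentially)
  have Bi: "integrable lborel (\<lambda>z. \<bar>f z - cl B (f z)\<bar> powr p)"
    by (rule Bochner_Integration.integrable_bound[OF fp]) (use p in \<open>auto intro!: powr_mono2 simp: cl_def\<close>)
  have "f measurable_on UNIV"
    by (intro lebesgue_measurable_imp_measurable_on measurable_completion) (auto simp: f)
  then obtain N g where N: "negligible N" and g: "\<And>n. continuous_on UNIV (g n)"
    and lim: "\<And>z. z \<notin> N \<Longrightarrow> (\<lambda>n. g n z) \<longlonglongrightarrow> f z"
    unfolding measurable_on_def by auto
  have AEN: "AE z in lborel. z \<notin> N"
    using AE_not_in[OF N[unfolded negligible_iff_null_sets]] by (simp only: AE_completion_iff)
  \<comment> \<open>A continuous cutoff that is 1 where \<open>f\<close> may be nonzero and 0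
    outside the larger ball. It gives all approximants one compact support, and with the clamping
    one integrable majorant.\<close>
  define c where "c z = max 0 (min 1 (R + 1 - norm z))" for z :: 'a
  define h where "h n z = c z * cl B (g n z)" for n z
  have clg: "continuous_on UNIV (\<lambda>z. cl B (g n z))" for n
    by (rule continuous_on_compose2[OF cl_cont g]) simp
  have cc: "continuous_on UNIV c"
    unfolding c_def[abs_def] by (intro continuous_intros)
  have hc: "continuous_on UNIV (h n)" for n
    unfolding h_def[abs_def] by (intro continuous_on_mult cc clg)
  have [measurable]: "h n \<in> borel_measurable borel" for n
    by (intro borel_measurable_continuous_onI hc)
  have c1: "0 \<le> c z" "c z \<le> 1" for z by (auto simp: c_def)
  have hb: "\<bar>h n z\<bar> \<le> B" for n z
    using mult_mono[OF c1(2)[of z] cl_bd[of B "g n z"]] c1[of z] by (auto simp: h_def abs_mult)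
  have c0: "c z = 0" if "z \<notin> cball 0 (R + 1)" for z using that by (auto simp: c_def)
  have c01: "c z = 1" if "z \<in> cball 0 R" for z using that by (auto simp: c_def)
  have cf: "c z * cl B (f z) = cl B (f z)" for z
    using c01[of z] supp[of z] by (cases "z \<in> cball 0 R") (auto simp: cl_def)
  let ?w = "\<lambda>z. indicator (cball 0 (R + 1)) z *\<^sub>R (2 * real B) powr p"
  have wi: "integrable lborel ?w"
    by (rule borel_integrable_compact) auto
  have dom: "\<bar>cl B (f z) - h n z\<bar> powr p \<le> ?w z" for n z
  proof (cases "z \<in> cball 0 (R + 1)")
    case True
    have "\<bar>cl B (f z) - h n z\<bar> \<le> 2 * real B" using cl_bd[of B "f z"] hb[of n z] by linarith
    then show ?thesis using True p by (auto intro!: powr_mono2)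
  next
    case False
    then have "cl B (f z) = 0" "h n z = 0" using supp[of z] c0[of z] by (auto simp: cl_def h_def)
    then show ?thesis by simp
  qed
  have "((\<lambda>n. \<integral>z. \<bar>cl B (f z) - h n z\<bar> powr p \<partial>lborel) \<longlonglongrightarrow> (\<integral>z. 0 \<partial>(lborel :: 'a measure)))"
  proof (rule integral_dominated_convergence[where w = ?w])
    show "AE z in lborel. (\<lambda>n. \<bar>cl B (f z) - h n z\<bar> powr p) \<longlonglongrightarrow> 0"
      using AEN
    proof eventually_elim
      case (elim z)
      have "(\<lambda>n. cl B (g n z)) \<longlonglongrightarrow> cl B (f z)"
        unfolding cl_def by (intro tendsto_intros lim elim)
      then have "(\<lambda>n. h n z) \<longlonglongrightarrow> cl B (f z)"
        unfolding h_def by (subst cf[symmetric]) (intro tendsto_intros)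
      then have "(\<lambda>n. \<bar>cl B (f z) - h n z\<bar>) \<longlonglongrightarrow> 0"
        by (intro tendsto_rabs_zero) (auto intro!: tendsto_eq_intros)
      then show ?case using p by (intro tendsto_zero_powrI[where b=p]) auto
    qed
  qed (use wi dom in auto)
  then have "\<forall>\<^sub>F n in sequentially. (\<integral>z. \<bar>cl B (f z) - h n z\<bar> powr p \<partial>lborel) < e / (2 * 3 powr p)"
    using e by (intro order_tendstoD(2)) auto
  then obtain n where n: "(\<integral>z. \<bar>cl B (f z) - h n z\<bar> powr p \<partial>lborel) < e / (2 * 3 powr p)"
    by (auto simp: eventually_sequentially)
  have ni: "integrable lborel (\<lambda>z. \<bar>cl B (f z) - h n z\<bar> powr p)"
    by (rule Bochner_Integration.integrable_bound[OF wi]) (use dom in auto)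
  have "(\<integral>\<^sup>+z. ennreal (\<bar>f z - h n z\<bar> powr p) \<partial>lborel)
      \<le> (\<integral>\<^sup>+z. ennreal (3 powr p * (\<bar>f z - cl B (f z)\<bar> powr p + \<bar>cl B (f z) - h n z\<bar> powr p)) \<partial>lborel)"
  proof (intro nn_integral_mono ennreal_leI)
    fix z
    show "\<bar>f z - h n z\<bar> powr p \<le> 3 powr p * (\<bar>f z - cl B (f z)\<bar> powr p + \<bar>cl B (f z) - h n z\<bar> powr p)"
      using powr_add3_le[of p "f z - cl B (f z)" "cl B (f z) - h n z" 0] p by simp
  qed
  also have "\<dots> = ennreal (3 powr p * ((\<integral>z. \<bar>f z - cl B (f z)\<bar> powr p \<partial>lborel) + (\<integral>z. \<bar>cl B (f z) - h n z\<bar> powr p \<partial>lborel)))"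
    using Bi ni by (subst nn_integral_eq_integral) auto
  also have "\<dots> < ennreal e"
    using B n e by (intro ennreal_lessI) (auto simp: field_simps)
  finally show ?thesis using hc c0 by (intro exI[of _ "h n"]) (auto simp: h_def)
qed

lemma mollify_uniform_approx:
  fixes g :: "'a::euclidean_space \<Rightarrow> real"
  assumes d: "\<delta> > 0" and g: "integrable lborel g" and w: "\<And>z. dist z y < \<delta> \<Longrightarrow> \<bar>g z - g y\<bar> \<le> w" "w \<ge> 0"
  shows "\<bar>mollify \<delta> g y - g y\<bar> \<le> w"
proof -
  note I = mollifier_diff_integral[OF d, of y] mollify_integrand[OF d g, of y]
  have "\<bar>mollifier \<delta> (y - z) * (g z - g y)\<bar> \<le> w * mollifier \<delta> (y - z)" for z
  proof (cases "dist z y < \<delta>")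
    case True
    then show ?thesis using w mult_right_mono[OF w(1)[OF True] mollifier_nonneg[of \<delta> "y - z"]]
      by (simp add: abs_mult mollifier_nonneg mult.commute)
  next
    case False
    then show ?thesis using mollifier_eq_0[OF d, of "y - z"] by (simp add: dist_norm norm_minus_commute)
  qed
  then have le: "(\<integral>z. \<bar>mollifier \<delta> (y - z) * (g z - g y)\<bar> \<partial>lborel) \<le> (\<integral>z. w * mollifier \<delta> (y - z) \<partial>lborel)"
    using I by (intro integral_mono) (auto simp: right_diff_distrib)
  have "mollify \<delta> g y - g y = (\<integral>z. mollifier \<delta> (y - z) * (g z - g y) \<partial>lborel)"
    using I by (simp add: mollify_def right_diff_distrib)
  also have "\<bar>\<dots>\<bar> \<le> (\<integral>z. \<bar>mollifier \<delta> (y - z) * (g z - g y)\<bar> \<partial>lborel)"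
    by (rule integral_abs_bound)
  finally show ?thesis using le I by simp
qed

lemma mollify_eq_0:
  assumes "\<delta> > 0" "\<And>z. dist z y < \<delta> \<Longrightarrow> g z = 0"
  shows "mollify \<delta> g y = 0"
proof -
  have "mollifier \<delta> (y - z) * g z = 0" for z
    using assms(2)[of z] mollifier_eq_0[OF assms(1), of "y - z"]
    by (cases "dist z y < \<delta>") (auto simp: dist_norm norm_minus_commute)
  then have "(\<lambda>z. mollifier \<delta> (y - z) * g z) = (\<lambda>_. 0)" by (rule ext)
  then show ?thesis by (simp add: mollify_def)
qed

lemma mollify_Lp_tendsto_continuous:
  fixes g :: "'a::euclidean_space \<Rightarrow> real"
  assumes p: "p \<ge> 1" and g: "continuous_on UNIV g" and supp: "\<And>z. z \<notin> cball 0 R \<Longrightarrow> g z = 0"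
    and e: "e > 0"
  shows "\<exists>d>0. \<forall>\<delta>. 0 < \<delta> \<and> \<delta> < d \<longrightarrow> (\<integral>\<^sup>+y. ennreal (\<bar>mollify \<delta> g y - g y\<bar> powr p) \<partial>lborel) < ennreal e"
proof -
  have gi: "integrable lborel g"
    by (rule integrable_continuous_support[OF g compact_cball supp])
  have fin: "emeasure lborel (cball (0::'a) (R + 1)) < \<infinity>"
    by (rule emeasure_bounded_finite) auto
  define V where "V = measure lborel (cball (0::'a) (R + 1))"
  have V: "emeasure lborel (cball (0::'a) (R + 1)) = ennreal V" "V \<ge> 0"
    using fin by (auto simp: V_def emeasure_eq_ennreal_measure)
  \<comment> \<open>The oscillation allowed on a set of volume \<open>V\<close>: this choice makes
    w^p V < e, and V + 1 avoids division by zero.\<close>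
  define w where "w = (e / (2 * (V + 1))) powr (1 / p)"
  have w: "w > 0" "w powr p * V < e"
  proof -
    have "0 < V * e + e * 2" using V e by (intro add_nonneg_pos) auto
    then show "w powr p * V < e" "w > 0"
      using p e V by (auto simp: w_def powr_powr field_simps)
  qed
  \<comment> \<open>For y within R + 1 and radius below 1, every point seen by the mollifier lies
    within R + 2. Outside R + 1 both \<open>g\<close> and its mollification vanish.\<close>
  have "uniformly_continuous_on (cball 0 (R + 2)) g"
    by (intro compact_uniformly_continuous continuous_on_subset[OF g]) auto
  then obtain d where d: "d > 0" "\<And>x y. x \<in> cball 0 (R + 2) \<Longrightarrow> y \<in> cball 0 (R + 2) \<Longrightarrow> dist y x < d \<Longrightarrow> dist (g y) (g x) < w"
    using w unfolding uniformly_continuous_on_def by metis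
  show ?thesis
  proof (intro exI[of _ "min d 1"] conjI allI impI)
    show "min d 1 > 0" using d by auto
    fix \<delta> assume "0 < \<delta> \<and> \<delta> < min d 1"
    then have \<delta>: "0 < \<delta>" "\<delta> < d" "\<delta> < 1" by auto
    have le: "ennreal (\<bar>mollify \<delta> g y - g y\<bar> powr p) \<le> ennreal (w powr p) * indicator (cball 0 (R + 1)) y" for y
    proof (cases "y \<in> cball 0 (R + 1)")
      case True
      have "\<bar>g z - g y\<bar> \<le> w" if "dist z y < \<delta>" for z
      proof -
        have "norm z \<le> norm y + dist z y" by (metis dist_norm norm_triangle_sub)
        then have "z \<in> cball 0 (R + 2)" using that True \<delta> by auto
        then show ?thesis using d(2)[of y z] that True \<delta> by (auto simp: dist_real_def)
      qed
      then have "\<bar>mollify \<delta> g y - g y\<bar> \<le> w"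
        using mollify_uniform_approx[OF \<delta>(1) gi] w by auto
      then show ?thesis using True p by (auto intro!: ennreal_leI powr_mono2)
    next
      case False
      have "g z = 0" if "dist z y < \<delta>" for z
      proof (rule supp)
        have "norm y \<le> norm z + dist z y" by (metis dist_commute dist_norm norm_triangle_sub)
        then show "z \<notin> cball 0 R" using that False \<delta> by auto
      qed
      then have "mollify \<delta> g y = 0" "g y = 0" using mollify_eq_0[OF \<delta>(1)] \<delta> by auto
      then show ?thesis by simp
    qed
    have "(\<integral>\<^sup>+y. ennreal (\<bar>mollify \<delta> g y - g y\<bar> powr p) \<partial>lborel)
        \<le> (\<integral>\<^sup>+y. ennreal (w powr p) * indicator (cball (0::'a) (R + 1)) y \<partial>lborel)"
      by (intro nn_integral_mono le)
    also have "\<dots> = ennreal (w powr p * V)"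
      by (simp add: nn_integral_cmult_indicator V ennreal_mult)
    also have "\<dots> < ennreal e" using w e by (intro ennreal_lessI)
    finally show "(\<integral>\<^sup>+y. ennreal (\<bar>mollify \<delta> g y - g y\<bar> powr p) \<partial>lborel) < ennreal e" .
  qed
qed

lemma nn_integral_add3:
  assumes "f \<in> borel_measurable M" "g \<in> borel_measurable M" "h \<in> borel_measurable M"
  shows "(\<integral>\<^sup>+x. f x + g x + h x \<partial>M) = (\<integral>\<^sup>+x. f x \<partial>M) + (\<integral>\<^sup>+x. g x \<partial>M) + (\<integral>\<^sup>+x. h x \<partial>M)"
  using assms by (simp add: nn_integral_add)

text \<open>Density argument: with J the mollification and g continuous close to f, J f - f = J (f -
  g) + (J g - g) + (g - f). The contraction property bounds the first term by the third uniformly in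
  the radius, and the middle one is the continuous case.\<close>

lemma mollify_Lp_tendsto:
  fixes f :: "'a::euclidean_space \<Rightarrow> real"
  assumes p: "p \<ge> 1" and f: "integrable lborel f"
    and fp: "integrable lborel (\<lambda>z. \<bar>f z\<bar> powr p)"
    and supp: "\<And>z. z \<notin> cball 0 R \<Longrightarrow> f z = 0" and e: "e > 0"
  shows "\<exists>d>0. \<forall>\<delta>. 0 < \<delta> \<and> \<delta> < d \<longrightarrow> (\<integral>\<^sup>+y. ennreal (\<bar>mollify \<delta> f y - f y\<bar> powr p) \<partial>lborel) < ennreal e"
proof -
  have fm [measurable]: "f \<in> borel_measurable borel" using f by auto
  define c where "c = 3 powr p"
  have c: "c > 0" by (simp add: c_def)
  define e' where "e' = e / (3 * c)"
  have e': "e' > 0" "c * (3 * e') = e" using e c by (auto simp: e'_def)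
  obtain g where g: "continuous_on UNIV g" and gs: "\<And>z. z \<notin> cball 0 (R + 1) \<Longrightarrow> g z = 0"
    and fg: "(\<integral>\<^sup>+z. ennreal (\<bar>f z - g z\<bar> powr p) \<partial>lborel) < ennreal e'"
    using Lp_continuous_approx[OF p fm fp supp e'(1)] by blast
  have gm [measurable]: "g \<in> borel_measurable borel"
    by (intro borel_measurable_continuous_onI g)
  have gi: "integrable lborel g"
    by (rule integrable_continuous_support[OF g compact_cball gs])
  have fgi: "integrable lborel (\<lambda>z. \<bar>f z - g z\<bar> powr p)"
    using fg by (intro integrableI_nonneg) (auto intro: order.strict_trans)
  obtain d where d: "d > 0" "\<And>\<delta>. 0 < \<delta> \<Longrightarrow> \<delta> < d \<Longrightarrow> (\<integral>\<^sup>+y. ennreal (\<bar>mollify \<delta> g y - g y\<bar> powr p) \<partial>lborel) < ennreal e'"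
    using mollify_Lp_tendsto_continuous[OF p g gs e'(1)] by blast
  show ?thesis
  proof (intro exI[of _ d] conjI allI impI d(1))
    fix \<delta> assume "0 < \<delta> \<and> \<delta> < d"
    then have \<delta>: "0 < \<delta>" "\<delta> < d" by auto
    let ?a = "\<lambda>y. ennreal (\<bar>mollify \<delta> (\<lambda>z. f z - g z) y\<bar> powr p)"
    let ?b = "\<lambda>y. ennreal (\<bar>mollify \<delta> g y - g y\<bar> powr p)"
    let ?c = "\<lambda>y. ennreal (\<bar>f y - g y\<bar> powr p)"
    have "ennreal (\<bar>mollify \<delta> f y - f y\<bar> powr p) \<le> ennreal c * (?a y + ?b y + ?c y)" for y
    proof -
      have "\<bar>mollify \<delta> f y - f y\<bar> powr p
         \<le> c * (\<bar>mollify \<delta> (\<lambda>z. f z - g z) y\<bar> powr p + \<bar>mollify \<delta> g y - g y\<bar> powr p + \<bar>g y - f y\<bar> powr p)"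
        using powr_add3_le[of p "mollify \<delta> (\<lambda>z. f z - g z) y" "mollify \<delta> g y - g y" "g y - f y"] p
        by (simp add: c_def mollify_diff[OF \<delta>(1) f gi])
      from ennreal_leI[OF this] show ?thesis
        using c by (simp add: ennreal_mult abs_minus_commute[of "g y"])
    qed
    then have "(\<integral>\<^sup>+y. ennreal (\<bar>mollify \<delta> f y - f y\<bar> powr p) \<partial>lborel)
        \<le> (\<integral>\<^sup>+y. ennreal c * (?a y + ?b y + ?c y) \<partial>lborel)"
      by (intro nn_integral_mono)
    also have "\<dots> = ennreal c * (integral\<^sup>N lborel ?a + integral\<^sup>N lborel ?b + integral\<^sup>N lborel ?c)"
      by (simp add: nn_integral_cmult nn_integral_add3)
    also have "\<dots> \<le> ennreal c * (integral\<^sup>N lborel ?c + integral\<^sup>N lborel ?b + integral\<^sup>N lborel ?c)"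
      using mollify_Lp_contraction[OF \<delta>(1) p _ fgi] f gi by (intro mult_left_mono add_mono) auto
    also have "\<dots> < ennreal c * (ennreal e' + ennreal e' + ennreal e')"
      using c fg d(2)[OF \<delta>] by (intro ennreal_mult_strict_left_mono add_strict_mono) auto
    also have "\<dots> = ennreal e"
      using e'(1) c by (simp flip: ennreal_plus ennreal_mult add: e'(2))
    finally show "(\<integral>\<^sup>+y. ennreal (\<bar>mollify \<delta> f y - f y\<bar> powr p) \<partial>lborel) < ennreal e" .
  qed
qed

section \<open>Derivatives of mollifications\<close>

abbreviation mollifier_deriv :: "real \<Rightarrow> 'a::euclidean_space \<Rightarrow> 'a \<Rightarrow> real" where
  "mollifier_deriv \<delta> a v \<equiv> frechet_derivative (mollifier \<delta>) (at a) v"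

lemma mollifier_has_derivative:
  fixes a :: "'a::euclidean_space"
  shows "(mollifier \<delta> has_derivative mollifier_deriv \<delta> a) (at a)"
  using Ck_on_mollifier[of 1 \<delta>, where 'a='a] by (simp add: frechet_derivative_works)

lemma mollifier_deriv_continuous:
  fixes v :: "'a::euclidean_space"
  shows "continuous_on UNIV (\<lambda>a. mollifier_deriv \<delta> a v)"
  using Ck_on_mollifier[of 1 \<delta>, where 'a='a] by simp

lemma mollifier_deriv_measurable [measurable]: "(\<lambda>a. mollifier_deriv \<delta> a v) \<in> borel_measurable borel"
  by (intro borel_measurable_continuous_onI mollifier_deriv_continuous)

lemma mollifier_deriv_eq_0:
  fixes a :: "'a::euclidean_space"
  assumes "\<delta> > 0" "a \<notin> cball 0 \<delta>" shows "mollifier_deriv \<delta> a v = 0"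
proof -
  have "(mollifier \<delta> has_derivative (\<lambda>_. 0)) (at a)"
    by (rule has_derivative_transform_within_open[of "\<lambda>_. 0" _ _ _ "- cball 0 \<delta>"])
      (use assms mollifier_eq_0'[OF assms(1)] in auto)
  from frechet_derivative_at[OF this] show ?thesis by metis
qed

lemma mollifier_deriv_bounded:
  assumes "\<delta> > 0"
  obtains L where "L \<ge> 0" "\<And>a v::'a::euclidean_space. \<bar>mollifier_deriv \<delta> a v\<bar> \<le> L * norm v"
proof -
  have "\<exists>C\<ge>0. \<forall>a. \<bar>mollifier_deriv \<delta> a b\<bar> \<le> C" for b :: 'a
    by (rule continuous_support_bounded[OF mollifier_deriv_continuous compact_cball mollifier_deriv_eq_0[OF assms]])
  then obtain C where C: "\<And>b::'a. C b \<ge> 0" "\<And>a b::'a. \<bar>mollifier_deriv \<delta> a b\<bar> \<le> C b" by metis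
  show thesis
  proof
    show "(\<Sum>b\<in>Basis. C (b::'a)) \<ge> 0" using C by (intro sum_nonneg) auto
    fix a v :: 'a
    interpret bounded_linear "mollifier_deriv \<delta> a"
      using mollifier_has_derivative has_derivative_bounded_linear by blast
    have "mollifier_deriv \<delta> a v = mollifier_deriv \<delta> a (\<Sum>b\<in>Basis. (v \<bullet> b) *\<^sub>R b)"
      by (simp add: euclidean_representation)
    also have "\<dots> = (\<Sum>b\<in>Basis. (v \<bullet> b) * mollifier_deriv \<delta> a b)" by (simp add: sum scaleR)
    also have "\<bar>\<dots>\<bar> \<le> (\<Sum>b\<in>Basis. norm v * C b)"
      by (rule order_trans[OF sum_abs])
        (auto intro!: sum_mono mult_mono C simp: abs_mult Basis_le_norm)
    finally show "\<bar>mollifier_deriv \<delta> a v\<bar> \<le> (\<Sum>b\<in>Basis. C b) * norm v"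
      by (simp add: sum_distrib_left mult.commute)
  qed
qed

lemma mollify_deriv_integrable:
  fixes f :: "'a::euclidean_space \<Rightarrow> real"
  assumes "\<delta> > 0" "integrable lborel f"
  shows "integrable lborel (\<lambda>z. mollifier_deriv \<delta> (y - z) v * f z)"
proof -
  obtain L where "L \<ge> 0" "\<And>a v::'a. \<bar>mollifier_deriv \<delta> a v\<bar> \<le> L * norm v"
    by (rule mollifier_deriv_bounded[OF assms(1)]) (rule that; assumption)
  then show ?thesis using assms by (intro integrable_bounded_mult[where C="L * norm v"]) auto
qed

text \<open>Differentiation under the integral, with the derivative on the kernel because
  \<open>f\<close> is only integrable. Limits are taken along sequences so that dominated
  convergence applies. The remainder quotient of the kernel is at most 2 L: one L from its Lipschitz
  bound, one from the bound on its derivative.\<close>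

lemma mollify_has_derivative:
  fixes f :: "'a::euclidean_space \<Rightarrow> real"
  assumes d: "\<delta> > 0" and f: "integrable lborel f"
  shows "(mollify \<delta> f has_derivative (\<lambda>v. \<integral>z. mollifier_deriv \<delta> (y - z) v * f z \<partial>lborel)) (at y)"
proof -
  have fm [measurable]: "f \<in> borel_measurable borel" using f by auto
  obtain L where L: "L \<ge> 0" "\<And>a v::'a. \<bar>mollifier_deriv \<delta> a v\<bar> \<le> L * norm v"
    by (rule mollifier_deriv_bounded[OF d]) (rule that; assumption)
  note DI = mollify_deriv_integrable[OF d f]
  have lin: "bounded_linear (mollifier_deriv \<delta> a)" for a :: 'a
    using mollifier_has_derivative has_derivative_bounded_linear by blast
  have lip: "\<bar>mollifier \<delta> a - mollifier \<delta> b\<bar> \<le> L * norm (a - b)" for a b :: 'a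
  proof -
    have "onorm (mollifier_deriv \<delta> x) \<le> L" for x :: 'a
      using L by (intro onorm_bound) simp_all
    then have "norm (mollifier \<delta> a - mollifier \<delta> b) \<le> L * norm (a - b)"
      by (intro differentiable_bound[of UNIV _ "mollifier_deriv \<delta>"] mollifier_has_derivative) simp_all
    then show ?thesis by simp
  qed
  let ?F = "\<lambda>v. \<integral>z. mollifier_deriv \<delta> (y - z) v * f z \<partial>lborel"
  have bl: "bounded_linear ?F"
  proof
    show "?F (u + v) = ?F u + ?F v" for u v
      using DI by (simp add: linear_simps[OF lin] distrib_right)
    show "?F (c *\<^sub>R v) = c *\<^sub>R ?F v" for c v
      using DI by (simp add: linear_simps[OF lin] mult.assoc)
    have "norm (?F v) \<le> norm v * (\<integral>z. L * \<bar>f z\<bar> \<partial>lborel)" for v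
    proof -
      have "norm (?F v) \<le> (\<integral>z. norm (mollifier_deriv \<delta> (y - z) v * f z) \<partial>lborel)"
        by (rule integral_norm_bound)
      also have "\<dots> \<le> (\<integral>z. norm v * (L * \<bar>f z\<bar>) \<partial>lborel)"
      proof (intro integral_mono integrable_norm DI)
        show "norm (mollifier_deriv \<delta> (y - z) v * f z) \<le> norm v * (L * \<bar>f z\<bar>)" for z
          using mult_right_mono[OF L(2)[of "y - z" v], of "\<bar>f z\<bar>"] by (simp add: abs_mult mult_ac)
      qed (use f in simp)
      finally show ?thesis by simp
    qed
    then show "\<exists>K. \<forall>v. norm (?F v) \<le> norm v * K" by blast
  qed
  show ?thesis
    unfolding has_derivative_iff_norm tendsto_at_iff_sequentially
  proof (intro conjI bl allI impI)
    fix X :: "nat \<Rightarrow> 'a" assume X: "\<forall>i. X i \<in> UNIV - {y}" and lim: "X \<longlonglongrightarrow> y"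
    define e where "e n z = (mollifier \<delta> (X n - z) - mollifier \<delta> (y - z) - mollifier_deriv \<delta> (y - z) (X n - y)) / norm (X n - y)" for n z
    have Xn: "norm (X n - y) > 0" for n using X by auto
    have e0: "(\<lambda>n. e n z) \<longlonglongrightarrow> 0" for z
    proof -
      have "(\<lambda>n. X n - z) \<longlonglongrightarrow> y - z" using lim by (intro tendsto_intros)
      moreover have "\<forall>n. X n - z \<in> UNIV - {y - z}" using X by auto
      ultimately have "(\<lambda>n. norm (mollifier \<delta> (X n - z) - mollifier \<delta> (y - z) - mollifier_deriv \<delta> (y - z) ((X n - z) - (y - z)))
          / norm ((X n - z) - (y - z))) \<longlonglongrightarrow> 0"
        using mollifier_has_derivative[of \<delta> "y - z", unfolded has_derivative_iff_norm tendsto_at_iff_sequentially,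
            THEN conjunct2, THEN spec, of "\<lambda>n. X n - z"]
        by (simp add: comp_def)
      then have "(\<lambda>n. norm (e n z)) \<longlonglongrightarrow> 0" by (simp add: e_def)
      then show ?thesis by (rule tendsto_norm_zero_cancel)
    qed
    have eb: "\<bar>e n z\<bar> \<le> 2 * L" for n z
    proof -
      have "\<bar>mollifier \<delta> (X n - z) - mollifier \<delta> (y - z) - mollifier_deriv \<delta> (y - z) (X n - y)\<bar> \<le> 2 * L * norm (X n - y)"
        using lip[of "X n - z" "y - z"] L(2)[of "y - z" "X n - y"] by simp
      then show ?thesis using Xn[of n] by (simp add: e_def field_simps)
    qed
    have em [measurable]: "e n \<in> borel_measurable borel" for n
      unfolding e_def[abs_def] by measurable
    have "(\<lambda>n. \<integral>z. e n z * f z \<partial>lborel) \<longlonglongrightarrow> (\<integral>z. 0 \<partial>(lborel :: 'a measure))"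
    proof (rule integral_dominated_convergence[where w = "\<lambda>z. 2 * L * \<bar>f z\<bar>"])
      show "AE z in lborel. (\<lambda>n. e n z * f z) \<longlonglongrightarrow> 0"
        using tendsto_mult_right[OF e0] by auto
      show "AE z in lborel. norm (e n z * f z) \<le> 2 * L * \<bar>f z\<bar>" for n
        using eb by (auto simp: abs_mult intro!: mult_right_mono)
    qed (use f in auto)
    moreover have "(\<integral>z. e n z * f z \<partial>lborel) = ((mollify \<delta> f (X n) - mollify \<delta> f y) - ?F (X n - y)) / norm (X n - y)" for n
      unfolding e_def mollify_def times_divide_eq_left[symmetric] left_diff_distrib
      using DI mollify_integrand[OF d f] by (simp add: left_diff_distrib)
    ultimately have "(\<lambda>n. norm (((mollify \<delta> f (X n) - mollify \<delta> f y) - ?F (X n - y)) / norm (X n - y))) \<longlonglongrightarrow> 0"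
      by (intro tendsto_norm_zero) simp
    then show "((\<lambda>x. norm (mollify \<delta> f x - mollify \<delta> f y - ?F (x - y)) / norm (x - y)) \<circ> X) \<longlonglongrightarrow> 0"
      by (simp add: comp_def)
  qed
qed

lemma mollify_deriv_continuous:
  fixes f :: "'a::euclidean_space \<Rightarrow> real"
  assumes d: "\<delta> > 0" and f: "integrable lborel f"
  shows "continuous_on UNIV (\<lambda>y. \<integral>z. mollifier_deriv \<delta> (y - z) v * f z \<partial>lborel)"
proof -
  have fm [measurable]: "f \<in> borel_measurable borel" using f by auto
  obtain L where L: "L \<ge> 0" "\<And>a v::'a. \<bar>mollifier_deriv \<delta> a v\<bar> \<le> L * norm v"
    by (rule mollifier_deriv_bounded[OF d]) (rule that; assumption)
  have "(\<lambda>n. \<integral>z. mollifier_deriv \<delta> (X n - z) v * f z \<partial>lborel) \<longlonglongrightarrow> (\<integral>z. mollifier_deriv \<delta> (y - z) v * f z \<partial>lborel)"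
    if X: "X \<longlonglongrightarrow> y" for X y
  proof (rule integral_dominated_convergence[where w = "\<lambda>z. L * norm v * \<bar>f z\<bar>"])
    have "isCont (\<lambda>a. mollifier_deriv \<delta> a v) a" for a
      using mollifier_deriv_continuous[of \<delta> v] by (simp add: continuous_on_eq_continuous_at)
    then show "AE z in lborel. (\<lambda>n. mollifier_deriv \<delta> (X n - z) v * f z) \<longlonglongrightarrow> mollifier_deriv \<delta> (y - z) v * f z"
      by (intro AE_I2 tendsto_mult_right isCont_tendsto_compose[where g="\<lambda>a. mollifier_deriv \<delta> a v"] tendsto_diff X tendsto_const)
    show "AE z in lborel. norm (mollifier_deriv \<delta> (X n - z) v * f z) \<le> L * norm v * \<bar>f z\<bar>" for n
      using L by (auto simp: abs_mult intro!: mult_right_mono)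
  qed (use f in auto)
  then show ?thesis by (simp add: continuous_on_sequentially comp_def)
qed

section \<open>Limits of integrals of products, one factor being of order Q^(p-1)\<close>

text \<open>Young's inequality applied to s Q and s^(1-p) x, a scaling that leaves Q^(p-1) x
  unchanged. The free parameter s makes the Q-term small at the cost of the other one, and in this
  way replaces Hoelder's inequality in the limit arguments.\<close>

lemma powr_mult_le_add:
  fixes Q x p :: real
  assumes p: "p > 1" and "Q \<ge> 0" "x \<ge> 0" and s: "s > 0"
  shows "Q powr (p - 1) * x \<le> s powr p * Q powr p + s powr (p * (1 - p)) * x powr p"
proof -
  have "(s * Q) powr (p - 1) * (s powr (1 - p) * x) = (s powr (p - 1) * s powr (1 - p)) * (Q powr (p - 1) * x)"
    using assms by (simp add: powr_mult mult_ac)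
  also have "s powr (p - 1) * s powr (1 - p) = 1"
    using s by (simp flip: powr_add)
  finally have eq: "(s * Q) powr (p - 1) * (s powr (1 - p) * x) = Q powr (p - 1) * x" by simp
  have "p * (Q powr (p - 1) * x) \<le> (p - 1) * (s * Q) powr p + (s powr (1 - p) * x) powr p"
    using young_powr[of p "s * Q" "s powr (1 - p) * x"] assms by (simp only: mult.assoc eq) simp
  also have "(s * Q) powr p = s powr p * Q powr p"
    using assms by (simp add: powr_mult)
  also have "(s powr (1 - p) * x) powr p = s powr (p * (1 - p)) * x powr p"
    using assms by (simp add: powr_mult powr_powr mult.commute)
  also have "(p - 1) * (s powr p * Q powr p) \<le> p * (s powr p * Q powr p)"
    by (intro mult_right_mono) auto
  also have "s powr (p * (1 - p)) * x powr p \<le> p * (s powr (p * (1 - p)) * x powr p)"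
    using p mult_right_mono[of 1 p "s powr (p * (1 - p)) * x powr p"] by simp
  finally have "p * (Q powr (p - 1) * x) \<le> p * (s powr p * Q powr p + s powr (p * (1 - p)) * x powr p)"
    by (simp add: distrib_left)
  then show ?thesis using p by simp
qed

lemma weighted_integrable:
  fixes B Q H :: "'x \<Rightarrow> real"
  assumes p: "p > 1" and [measurable]: "B \<in> borel_measurable M" "H \<in> borel_measurable M"
    and B: "\<And>x. \<bar>B x\<bar> \<le> C * Q x powr (p - 1)" and Q: "\<And>x. Q x \<ge> 0" and "C \<ge> 0"
    and Qi: "integrable M (\<lambda>x. Q x powr p)" and Hi: "integrable M (\<lambda>x. \<bar>H x\<bar> powr p)"
  shows "integrable M (\<lambda>x. B x * H x)"
proof (rule Bochner_Integration.integrable_bound[where f = "\<lambda>x. C * (Q x powr p + \<bar>H x\<bar> powr p)"])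
  show "AE x in M. norm (B x * H x) \<le> norm (C * (Q x powr p + \<bar>H x\<bar> powr p))"
  proof (rule AE_I2)
    fix x
    have "\<bar>B x * H x\<bar> \<le> C * (Q x powr (p - 1) * \<bar>H x\<bar>)"
      using mult_right_mono[OF B[of x], of "\<bar>H x\<bar>"] by (simp add: abs_mult mult.assoc)
    also have "\<dots> \<le> C * (Q x powr p + \<bar>H x\<bar> powr p)"
      using powr_mult_le_add[OF p Q[of x], of "\<bar>H x\<bar>" 1] \<open>C \<ge> 0\<close> by (intro mult_left_mono) auto
    finally show "norm (B x * H x) \<le> norm (C * (Q x powr p + \<bar>H x\<bar> powr p))" by simp
  qed
qed (use Qi Hi in auto)

text \<open>Splits A_n B H_n into A_n B (H_n - h) and A_n B h. The first integral tends to 0 since B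
  is of dual order and H_n tends to h in L^p; the second converges by dominated convergence, the A_n
  being uniformly bounded.\<close>

lemma weighted_product_tendsto:
  fixes a :: "'x \<Rightarrow> real" and A :: "nat \<Rightarrow> 'x \<Rightarrow> real"
  assumes p: "p > 1"
    and Am [measurable]: "\<And>n. A n \<in> borel_measurable M" "a \<in> borel_measurable M"
    and Ab: "\<And>n x. \<bar>A n x\<bar> \<le> C" and Al: "AE x in M. (\<lambda>n. A n x) \<longlonglongrightarrow> a x"
    and Bm [measurable]: "B \<in> borel_measurable M"
    and B: "\<And>x. \<bar>B x\<bar> \<le> C' * Q x powr (p - 1)" and Q: "\<And>x. Q x \<ge> 0"
    and Qi: "integrable M (\<lambda>x. Q x powr p)"
    and Hm [measurable]: "\<And>n. H n \<in> borel_measurable M" "h \<in> borel_measurable M"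
    and hi: "integrable M (\<lambda>x. \<bar>h x\<bar> powr p)"
    and Hhi: "\<And>n. integrable M (\<lambda>x. \<bar>H n x - h x\<bar> powr p)"
    and lim: "(\<lambda>n. \<integral>x. \<bar>H n x - h x\<bar> powr p \<partial>M) \<longlonglongrightarrow> 0"
  shows "\<And>n. integrable M (\<lambda>x. A n x * B x * H n x)" "integrable M (\<lambda>x. a x * B x * h x)"
    "(\<lambda>n. \<integral>x. A n x * B x * H n x \<partial>M) \<longlonglongrightarrow> (\<integral>x. a x * B x * h x \<partial>M)"
proof -
  define D where "D = \<bar>C\<bar> * \<bar>C'\<bar>"
  have D: "D \<ge> 0" by (simp add: D_def)
  have AB: "\<bar>c * B x\<bar> \<le> D * Q x powr (p - 1)" if "\<bar>c\<bar> \<le> \<bar>C\<bar>" for c x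
  proof -
    have "\<bar>B x\<bar> \<le> \<bar>C'\<bar> * Q x powr (p - 1)"
      by (rule order_trans[OF B]) (intro mult_right_mono, auto)
    from mult_mono[OF that this] show ?thesis by (simp add: abs_mult D_def mult.assoc)
  qed
  have ABn: "\<bar>A n x * B x\<bar> \<le> D * Q x powr (p - 1)" for n x
    using Ab[of n x] by (intro AB) auto
  have i1: "integrable M (\<lambda>x. A n x * B x * (H n x - h x))" for n
    by (rule weighted_integrable[OF p _ _ ABn Q D Qi Hhi]) auto
  have i2: "integrable M (\<lambda>x. A n x * B x * h x)" for n
    by (rule weighted_integrable[OF p _ _ ABn Q D Qi hi]) auto
  have "integrable M (\<lambda>x. A n x * B x * (H n x - h x) + A n x * B x * h x)" for n
    using i1 i2 by (rule Bochner_Integration.integrable_add)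
  then show i3: "integrable M (\<lambda>x. A n x * B x * H n x)" for n
    by (simp add: right_diff_distrib)
  have Bhi: "integrable M (\<lambda>x. B x * h x)"
  proof (rule weighted_integrable[OF p _ _ _ Q _ Qi hi])
    show "\<bar>B x\<bar> \<le> \<bar>C'\<bar> * Q x powr (p - 1)" for x
      by (rule order_trans[OF B]) (intro mult_right_mono, auto)
  qed auto
  have dc: "integrable M (\<lambda>x. a x * B x * h x) \<and>
      (\<lambda>n. \<integral>x. A n x * B x * h x \<partial>M) \<longlonglongrightarrow> (\<integral>x. a x * B x * h x \<partial>M)"
  proof (intro conjI)
    have m: "(\<lambda>x. a x * B x * h x) \<in> borel_measurable M" "\<And>n. (\<lambda>x. A n x * B x * h x) \<in> borel_measurable M"
      by auto
    have w: "integrable M (\<lambda>x. \<bar>C\<bar> * \<bar>B x * h x\<bar>)" using Bhi by auto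
    have l: "AE x in M. (\<lambda>n. A n x * B x * h x) \<longlonglongrightarrow> a x * B x * h x"
      using Al by eventually_elim (intro tendsto_intros)
    have b: "AE x in M. norm (A n x * B x * h x) \<le> \<bar>C\<bar> * \<bar>B x * h x\<bar>" for n
    proof (rule AE_I2)
      fix x
      have "\<bar>A n x\<bar> \<le> \<bar>C\<bar>" using Ab[of n x] by simp
      then show "norm (A n x * B x * h x) \<le> \<bar>C\<bar> * \<bar>B x * h x\<bar>"
        using mult_right_mono[of "\<bar>A n x\<bar>" "\<bar>C\<bar>" "\<bar>B x * h x\<bar>"] by (simp add: abs_mult mult.assoc)
    qed
    show "integrable M (\<lambda>x. a x * B x * h x)"
      by (rule integrable_dominated_convergence[OF m w l b])
    show "(\<lambda>n. \<integral>x. A n x * B x * h x \<partial>M) \<longlonglongrightarrow> (\<integral>x. a x * B x * h x \<partial>M)"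
      by (rule integral_dominated_convergence[OF m w l b])
  qed
  then show "integrable M (\<lambda>x. a x * B x * h x)" by blast
  define I where "I = (\<integral>x. Q x powr p \<partial>M)"
  define E where "E n = (\<integral>x. \<bar>H n x - h x\<bar> powr p \<partial>M)" for n
  have I: "I \<ge> 0" by (simp add: I_def)
  have le: "\<bar>\<integral>x. A n x * B x * (H n x - h x) \<partial>M\<bar> \<le> D * (s powr p * I + s powr (p * (1 - p)) * E n)" if s: "s > 0" for s n
  proof -
    have "\<bar>\<integral>x. A n x * B x * (H n x - h x) \<partial>M\<bar> \<le> (\<integral>x. \<bar>A n x * B x * (H n x - h x)\<bar> \<partial>M)"
      by (rule integral_abs_bound)
    also have "\<dots> \<le> (\<integral>x. D * (s powr p * Q x powr p + s powr (p * (1 - p)) * \<bar>H n x - h x\<bar> powr p) \<partial>M)"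
    proof (rule integral_mono)
      fix x
      have "\<bar>A n x * B x * (H n x - h x)\<bar> \<le> D * (Q x powr (p - 1) * \<bar>H n x - h x\<bar>)"
        using mult_right_mono[OF ABn[of n x], of "\<bar>H n x - h x\<bar>"] by (simp add: abs_mult mult.assoc)
      also have "\<dots> \<le> D * (s powr p * Q x powr p + s powr (p * (1 - p)) * \<bar>H n x - h x\<bar> powr p)"
        using powr_mult_le_add[OF p Q[of x] _ s, of "\<bar>H n x - h x\<bar>"] D by (intro mult_left_mono) auto
      finally show "\<bar>A n x * B x * (H n x - h x)\<bar> \<le> D * (s powr p * Q x powr p + s powr (p * (1 - p)) * \<bar>H n x - h x\<bar> powr p)" .
    qed (use i1 Qi Hhi in auto)
    also have "\<dots> = D * (s powr p * I + s powr (p * (1 - p)) * E n)"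
      using Qi Hhi by (simp add: I_def E_def)
    finally show ?thesis .
  qed
  have T0: "(\<lambda>n. \<integral>x. A n x * B x * (H n x - h x) \<partial>M) \<longlonglongrightarrow> 0"
  proof (rule tendstoI)
    fix e :: real assume e: "e > 0"
    \<comment> \<open>Chosen independently of n so that the Q-term costs less than e/2; the summand
      1 covers the case D * I = 0.\<close>
    define s where "s = (e / (2 * (D * I + 1))) powr (1 / p)"
    have DI: "D * I \<ge> 0" using D I by simp
    have s: "s > 0" using e DI by (simp add: s_def add_nonneg_pos)
    have sp: "s powr p = e / (2 * (D * I + 1))"
      using e DI p by (simp add: s_def powr_powr)
    have s1: "D * (s powr p * I) < e / 2"
      unfolding sp using e DI by (simp add: field_simps)
    have "(\<lambda>n. D * (s powr (p * (1 - p)) * E n)) \<longlonglongrightarrow> D * (s powr (p * (1 - p)) * 0)"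
      using lim by (intro tendsto_intros) (simp add: E_def)
    then have "\<forall>\<^sub>F n in sequentially. D * (s powr (p * (1 - p)) * E n) < e / 2"
      using e by (intro order_tendstoD(2)) auto
    then show "\<forall>\<^sub>F n in sequentially. dist (\<integral>x. A n x * B x * (H n x - h x) \<partial>M) 0 < e"
    proof eventually_elim
      case (elim n)
      then show ?case using le[OF s, of n] s1 by (simp add: distrib_left)
    qed
  qed
  have "(\<integral>x. A n x * B x * H n x \<partial>M) = (\<integral>x. A n x * B x * (H n x - h x) \<partial>M) + (\<integral>x. A n x * B x * h x \<partial>M)" for n
    using i1 i2 by (subst Bochner_Integration.integral_add[symmetric]) (auto simp: right_diff_distrib)
  then show "(\<lambda>n. \<integral>x. A n x * B x * H n x \<partial>M) \<longlonglongrightarrow> (\<integral>x. a x * B x * h x \<partial>M)"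
    using tendsto_add[OF T0 conjunct2[OF dc]] by simp
qed

section \<open>Borel versions, compactly supported C^1 functions and weak derivatives\<close>

text \<open>The data are Lebesgue measurable on \<open>W\<close> only, whereas mollification and
  Tonelli work with Borel functions on the whole space. Altering the function on a null set and
  cutting it off outside \<open>K\<close> bridges the gap.\<close>

lemma borel_version_on_compact:
  fixes f :: "'a::euclidean_space \<Rightarrow> real"
  assumes W: "open W" and K: "compact K" "K \<subseteq> W"
    and f: "f \<in> borel_measurable (lebesgue_on W)"
  obtains g where "g \<in> borel_measurable borel" "\<And>z. z \<notin> K \<Longrightarrow> g z = 0"
    "AE z in lborel. z \<in> K \<longrightarrow> g z = f z"
proof -
  have W': "W \<inter> space lebesgue \<in> sets lebesgue" using W by auto
  have "(\<lambda>x. indicator W x *\<^sub>R f x) \<in> borel_measurable (completion lborel)"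
    using f by (simp add: borel_measurable_restrict_space_iff[OF W'])
  from completion_ex_borel_measurable_real[OF this]
  obtain g' where g': "g' \<in> borel_measurable lborel" and ae: "AE x in lborel. indicator W x *\<^sub>R f x = g' x"
    by auto
  have [measurable]: "g' \<in> borel_measurable borel" using g' by simp
  have [measurable]: "K \<in> sets borel" using compact_imp_closed[OF K(1)] by (rule borel_closed)
  show ?thesis
  proof (rule that[of "\<lambda>x. indicator K x * g' x"])
    show "AE z in lborel. z \<in> K \<longrightarrow> indicator K z * g' z = f z"
      using ae by eventually_elim (use K in auto)
  qed auto
qed

lemma mollify_Lp_sequence:
  fixes f :: "'a::euclidean_space \<Rightarrow> real" and d :: "nat \<Rightarrow> real"
  assumes p: "p \<ge> 1" and f: "integrable lborel f"
    and fp: "integrable lborel (\<lambda>z. \<bar>f z\<bar> powr p)"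
    and supp: "\<And>z. z \<notin> cball 0 R \<Longrightarrow> f z = 0" and d: "\<And>n. d n > 0" "d \<longlonglongrightarrow> 0"
  shows "integrable lborel (\<lambda>y. \<bar>mollify (d n) f y - f y\<bar> powr p)"
    "(\<lambda>n. \<integral>y. \<bar>mollify (d n) f y - f y\<bar> powr p \<partial>lborel) \<longlonglongrightarrow> 0"
proof -
  have fm [measurable]: "f \<in> borel_measurable borel" using f by auto
  have cm: "integrable lborel (\<lambda>y. \<bar>mollify (d n) f y\<bar> powr p)" for n
  proof (rule integrableI_nonneg)
    have "(\<integral>\<^sup>+y. ennreal (\<bar>f y\<bar> powr p) \<partial>lborel) < \<infinity>"
      using fp by (simp add: nn_integral_eq_integral)
    with mollify_Lp_contraction[OF d(1) p f fp]
    show "(\<integral>\<^sup>+y. ennreal (\<bar>mollify (d n) f y\<bar> powr p) \<partial>lborel) < \<infinity>"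
      by (rule order.strict_trans1)
  qed auto
  show i: "integrable lborel (\<lambda>y. \<bar>mollify (d n) f y - f y\<bar> powr p)" for n
  proof (rule Bochner_Integration.integrable_bound[where f = "\<lambda>y. 3 powr p * (\<bar>mollify (d n) f y\<bar> powr p + \<bar>f y\<bar> powr p)"])
    show "AE y in lborel. norm (\<bar>mollify (d n) f y - f y\<bar> powr p) \<le> norm (3 powr p * (\<bar>mollify (d n) f y\<bar> powr p + \<bar>f y\<bar> powr p))"
      using powr_add3_le[of p "mollify (d n) f _" "- f _" 0] p by auto
  qed (use cm fp in auto)
  show "(\<lambda>n. \<integral>y. \<bar>mollify (d n) f y - f y\<bar> powr p \<partial>lborel) \<longlonglongrightarrow> 0"
  proof (rule tendstoI)
    fix e :: real assume e: "e > 0"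
    obtain c where c: "c > 0" "\<And>\<delta>. 0 < \<delta> \<Longrightarrow> \<delta> < c \<Longrightarrow> (\<integral>\<^sup>+y. ennreal (\<bar>mollify \<delta> f y - f y\<bar> powr p) \<partial>lborel) < ennreal e"
      using mollify_Lp_tendsto[OF p f fp supp e] by blast
    have "\<forall>\<^sub>F n in sequentially. d n < c"
      using d(2) c(1) by (rule order_tendstoD(2))
    then show "\<forall>\<^sub>F n in sequentially. dist (\<integral>y. \<bar>mollify (d n) f y - f y\<bar> powr p \<partial>lborel) 0 < e"
    proof eventually_elim
      case (elim n)
      have "ennreal (\<integral>y. \<bar>mollify (d n) f y - f y\<bar> powr p \<partial>lborel) < ennreal e"
        using c(2)[OF d(1) elim] nn_integral_eq_integral[OF i, of n] by simp
      then show ?case by (simp add: ennreal_less_iff)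
    qed
  qed
qed

lemma lebesgue_set_integral_eq_lborel:
  fixes f g :: "'a::euclidean_space \<Rightarrow> real"
  assumes W: "open W" and f: "f \<in> borel_measurable (lebesgue_on W)"
    and g: "g \<in> borel_measurable borel" and ae: "AE z in lborel. indicator W z * f z = g z"
  shows "(LINT z:W|lebesgue. f z) = (\<integral>z. g z \<partial>lborel)"
proof -
  have W': "W \<inter> space lebesgue \<in> sets lebesgue" using W by auto
  have "(\<lambda>x. indicator W x *\<^sub>R f x) \<in> borel_measurable lebesgue"
    using f by (simp add: borel_measurable_restrict_space_iff[OF W'])
  then have "(LINT z:W|lebesgue. f z) = (\<integral>z. g z \<partial>lebesgue)"
    unfolding set_lebesgue_integral_def
    using ae g by (intro integral_cong_AE) (auto intro!: AE_completion measurable_completion)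
  then show ?thesis using g by (simp add: integral_completion)
qed

lemma continuous_measurable_restrict_lebesgue:
  fixes f :: "'a::euclidean_space \<Rightarrow> 'b::euclidean_space"
  assumes "continuous_on UNIV f"
  shows "f \<in> borel_measurable (lebesgue_on W)"
  using assms by (intro measurable_restrict_space1 measurable_completion) (simp add: borel_measurable_continuous_onI)

text \<open>The function is taken as already extended by zero to the whole space, and its gradient
  is an explicit continuous field, so that products and limits never mention
  \<open>frechet_derivative\<close>.\<close>

definition C1c :: "(real ^ 'n::finite) set \<Rightarrow> (real ^ 'n \<Rightarrow> real) \<Rightarrow> (real ^ 'n \<Rightarrow> real ^ 'n) \<Rightarrow> bool" where
  "C1c W f D \<longleftrightarrow> (\<forall>y. (f has_derivative (\<lambda>v. D y \<bullet> v)) (at y)) \<and> continuous_on UNIV D \<and>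
     (\<exists>K. compact K \<and> K \<subseteq> W \<and> (\<forall>y. y \<notin> K \<longrightarrow> f y = 0))"

lemma has_derivative_zero_outside:
  assumes "compact K" "\<And>y. y \<notin> K \<Longrightarrow> f y = (0::real)" "(f has_derivative (\<lambda>v. D \<bullet> v)) (at y)"
    and y: "(y::'a::euclidean_space) \<notin> K"
  shows "D = 0"
proof -
  have "(f has_derivative (\<lambda>_. 0)) (at y)"
    by (rule has_derivative_transform_within_open[of "\<lambda>_. 0" _ _ _ "- K"])
      (use assms compact_imp_closed[OF assms(1)] in \<open>auto simp: open_Compl\<close>)
  from has_derivative_unique[OF this assms(3)] have "D \<bullet> D = 0" by metis
  then show ?thesis by simp
qed

lemma smooth_on_mollifier_diff:
  "smooth_on UNIV (\<lambda>z::'a::euclidean_space. mollifier d (y - z))"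
proof -
  have "mollifier d (y - z) = 1 / (\<integral>x. bump (0::'a) d x \<partial>lborel) * bump y d z" for z
    by (simp add: mollifier_def bump_def norm_minus_commute)
  then show ?thesis
    using smooth_on_bump[of y d] unfolding smooth_on_def
    by (simp only:) (intro allI Ck_on_mult Ck_on_const, blast)
qed

lemma frechet_derivative_mollifier_diff:
  fixes z :: "'a::euclidean_space"
  shows "frechet_derivative (\<lambda>z. mollifier d (y - z)) (at z) v = - mollifier_deriv d (y - z) v"
proof -
  have "((\<lambda>z. mollifier d (y - z)) has_derivative (\<lambda>v. mollifier_deriv d (y - z) (- v))) (at z)"
    by (rule has_derivative_compose[OF _ mollifier_has_derivative, of "\<lambda>z. y - z" uminus])
      (auto intro!: derivative_eq_intros)
  from frechet_derivative_at[OF this]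
  have "frechet_derivative (\<lambda>z. mollifier d (y - z)) (at z) v = mollifier_deriv d (y - z) (- v)" by metis
  also have "\<dots> = - mollifier_deriv d (y - z) v"
    using has_derivative_bounded_linear[OF mollifier_has_derivative, of d "y - z"]
    by (simp add: linear_simps)
  finally show ?thesis .
qed

lemma mollifier_diff_compactly_supported:
  assumes d: "d > 0" and "cball y d \<subseteq> W"
  shows "compactly_supported_in W (\<lambda>z::'a::euclidean_space. mollifier d (y - z))"
proof -
  have "{z. mollifier d (y - z) \<noteq> 0} \<subseteq> cball y d"
  proof
    fix z assume "z \<in> {z. mollifier d (y - z) \<noteq> 0}"
    then have "\<not> d \<le> norm (y - z)" using mollifier_eq_0[OF d, of "y - z"] by auto
    then show "z \<in> cball y d" by (simp add: dist_norm)
  qed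
  then have "closure {z. mollifier d (y - z) \<noteq> 0} \<subseteq> cball y d" "bounded {z. mollifier d (y - z) \<noteq> 0}"
    by (intro closure_minimal bounded_subset[OF bounded_cball]; simp)+
  then show ?thesis unfolding compactly_supported_in_def
    using assms by (auto simp: compact_closure)
qed

text \<open>The kernel z -> \<open>mollifier d (y - z)\<close> is itself an admissible test
  function. The minus sign in the definition of weak derivatives cancels the one from
  differentiating y - z in z. The Borel versions agree with the data only on \<open>K\<close>, which
  is enough because the kernel vanishes off \<open>K\<close>.\<close>

lemma mollify_deriv_weak_partials:
  fixes r :: "real ^ 'n::finite \<Rightarrow> real"
  assumes W: "open W" and wp: "weak_partials W r G" and K: "K \<subseteq> W"
    and d: "d > 0" "cball y d \<subseteq> K"
    and r': "r' \<in> borel_measurable borel" "AE z in lborel. z \<in> K \<longrightarrow> r' z = r z"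
    and G': "G' \<in> borel_measurable borel" "AE z in lborel. z \<in> K \<longrightarrow> G' z = G z $ i"
  shows "(\<integral>z. mollifier_deriv d (y - z) (axis i 1) * r' z \<partial>lborel) = mollify d G' y"
proof -
  note [measurable] = r'(1) G'(1)
  let ?\<psi> = "\<lambda>z. mollifier d (y - z)"
  have zero: "mollifier d (y - z) = 0" "mollifier_deriv d (y - z) v = 0" if "z \<notin> K" for z v
  proof -
    have "y - z \<notin> cball 0 d" using that d by (auto simp: dist_norm norm_minus_commute)
    then show "mollifier d (y - z) = 0" "mollifier_deriv d (y - z) v = 0"
      using mollifier_eq_0'[OF d(1)] mollifier_deriv_eq_0[OF d(1)] by blast+
  qed
  have rm: "r \<in> borel_measurable (lebesgue_on W)" "G \<in> borel_measurable (lebesgue_on W)"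
    using wp by (auto simp: weak_partials_def Lp_loc_def)
  have Gm: "(\<lambda>z. G z $ i) \<in> borel_measurable (lebesgue_on W)"
    using rm(2) by (rule measurable_compose[OF _ borel_measurable_nth])
  have m1: "(\<lambda>z. mollifier_deriv d (y - z) v) \<in> borel_measurable (lebesgue_on W)" for v
    by (intro continuous_measurable_restrict_lebesgue continuous_on_compose2[OF mollifier_deriv_continuous[of d v]] continuous_intros) auto
  have m2: "(\<lambda>z. mollifier d (y - z)) \<in> borel_measurable (lebesgue_on W)"
    by (intro continuous_measurable_restrict_lebesgue continuous_on_compose2[OF mollifier_continuous[of d]] continuous_intros) auto
  have "(LINT z:W|lebesgue. r z * frechet_derivative ?\<psi> (at z) (axis i 1)) = - (LINT z:W|lebesgue. G z $ i * ?\<psi> z)"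
    using wp smooth_on_mollifier_diff mollifier_diff_compactly_supported[OF d(1) order_trans[OF d(2) K]]
    unfolding weak_partials_def by blast
  moreover have "(LINT z:W|lebesgue. r z * frechet_derivative ?\<psi> (at z) (axis i 1))
      = (\<integral>z. - (mollifier_deriv d (y - z) (axis i 1) * r' z) \<partial>lborel)"
  proof (rule lebesgue_set_integral_eq_lborel[OF W])
    show "AE z in lborel. indicator W z * (r z * frechet_derivative ?\<psi> (at z) (axis i 1)) = - (mollifier_deriv d (y - z) (axis i 1) * r' z)"
      using r'(2)
    proof eventually_elim
      case (elim z)
      then show ?case using zero[of z] K by (cases "z \<in> K") (auto simp: frechet_derivative_mollifier_diff)
    qed
    show "(\<lambda>z. r z * frechet_derivative ?\<psi> (at z) (axis i 1)) \<in> borel_measurable (lebesgue_on W)"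
      unfolding frechet_derivative_mollifier_diff using m1 rm by (intro borel_measurable_times borel_measurable_uminus)
  qed measurable
  moreover have "(LINT z:W|lebesgue. G z $ i * ?\<psi> z) = mollify d G' y"
    unfolding mollify_def
  proof (rule lebesgue_set_integral_eq_lborel[OF W])
    show "AE z in lborel. indicator W z * (G z $ i * ?\<psi> z) = mollifier d (y - z) * G' z"
      using G'(2)
    proof eventually_elim
      case (elim z)
      then show ?case using zero[of z] K by (cases "z \<in> K") auto
    qed
    show "(\<lambda>z. G z $ i * ?\<psi> z) \<in> borel_measurable (lebesgue_on W)"
      using Gm m2 by (intro borel_measurable_times)
  qed measurable
  ultimately show ?thesis by simp
qed

section \<open>Nonlinear test functions for the weak inequality in one chart\<close>

lemma C1c_bounded:
  assumes "C1c W w Dw"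
  obtains C where "C \<ge> 0" "\<And>y. \<bar>w y\<bar> \<le> C" "\<And>y. norm (Dw y) \<le> C"
proof -
  obtain K where K: "compact K" "\<And>y. y \<notin> K \<Longrightarrow> w y = 0"
    and D: "\<And>y. (w has_derivative (\<lambda>v. Dw y \<bullet> v)) (at y)" "continuous_on UNIV Dw"
    using assms unfolding C1c_def by blast
  have "continuous_on UNIV w"
    by (intro continuous_at_imp_continuous_on ballI has_derivative_continuous[OF D(1)])
  from continuous_support_bounded[OF this K] obtain C1 where C1: "\<forall>y. \<bar>w y\<bar> \<le> C1" by blast
  have "continuous_on UNIV (\<lambda>y. norm (Dw y))" using D(2) by (rule continuous_on_norm)
  from continuous_support_bounded[OF this K(1)]
  obtain C2 where C2: "\<forall>y. \<bar>norm (Dw y)\<bar> \<le> C2"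
    using has_derivative_zero_outside[OF K D(1)] by auto
  have "\<bar>w y\<bar> \<le> \<bar>C1\<bar> + \<bar>C2\<bar>" "norm (Dw y) \<le> \<bar>C1\<bar> + \<bar>C2\<bar>" for y
    using C1[rule_format, of y] C2[rule_format, of y] by linarith+
  then show thesis by (intro that[of "\<bar>C1\<bar> + \<bar>C2\<bar>"]) auto
qed

text \<open>
  The coordinate form of the hypotheses of the theorem in one chart: \<open>r\<close> and \<open>G\<close> are the function
  and its differential, \<open>q\<close> is the norm of the gradient, and \<open>A\<close> is the vector field
  $|\nabla\rho|^{p-2}\nabla\rho$ times the density of the volume.
\<close>

locale chart_supersolution =
  fixes W :: "(real ^ 'n::finite) set" and r :: "real ^ 'n \<Rightarrow> real" and G A :: "real ^ 'n \<Rightarrow> real ^ 'n"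
    and q :: "real ^ 'n \<Rightarrow> real" and p b :: real
  assumes W: "open W" and p: "p > 1" and wp: "weak_partials W r G"
    and Am: "A \<in> borel_measurable (lebesgue_on W)"
    and qm: "q \<in> borel_measurable (lebesgue_on W)" and q0: "\<And>y. q y \<ge> 0"
    and bd: "\<And>K. compact K \<Longrightarrow> K \<subseteq> W \<Longrightarrow>
      \<exists>C\<ge>0. \<forall>y\<in>K. norm (A y) \<le> C * q y powr (p - 1) \<and> norm (G y) \<le> C * q y"
    and qp: "\<And>K. compact K \<Longrightarrow> K \<subseteq> W \<Longrightarrow> (\<integral>\<^sup>+y\<in>K. ennreal (q y powr p) \<partial>lebesgue) < \<infinity>"
    and r0: "AE y in lebesgue. y \<in> W \<longrightarrow> 0 \<le> r y"
    and ineq: "\<And>f D. C1c W f D \<Longrightarrow> (\<And>y. f y \<ge> 0) \<Longrightarrow> 0 \<le> b * (LINT y:W|lebesgue. A y \<bullet> D y)"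
begin

lemma W_sets: "W \<inter> space lebesgue \<in> sets lebesgue"
  using W by auto

lemma q_powr_integrable:
  assumes "compact K" "K \<subseteq> W"
  shows "integrable lebesgue (\<lambda>y. indicator K y * q y powr p)"
proof (rule integrableI_nonneg)
  have K: "K \<in> sets lebesgue" using borel_closed[OF compact_imp_closed[OF assms(1)]] by auto
  have "(\<lambda>y. indicator W y *\<^sub>R q y powr p) \<in> borel_measurable lebesgue"
    using qm unfolding borel_measurable_restrict_space_iff[OF W_sets, symmetric]
    by measurable
  then have "(\<lambda>y. indicator K y * (indicator W y *\<^sub>R q y powr p)) \<in> borel_measurable lebesgue"
    using K by (intro borel_measurable_times borel_measurable_indicator)
  also have "(\<lambda>y. indicator K y * (indicator W y *\<^sub>R q y powr p)) = (\<lambda>y. indicator K y * q y powr p)"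
    by (intro ext) (use assms in \<open>auto simp: indicator_def\<close>)
  finally show "(\<lambda>y. indicator K y * q y powr p) \<in> borel_measurable lebesgue" .
  have "(\<integral>\<^sup>+y. ennreal (indicator K y * q y powr p) \<partial>lebesgue) = (\<integral>\<^sup>+y\<in>K. ennreal (q y powr p) \<partial>lebesgue)"
    by (intro nn_integral_cong) (auto simp: indicator_def)
  then show "(\<integral>\<^sup>+y. ennreal (indicator K y * q y powr p) \<partial>lebesgue) < \<infinity>"
    using qp[OF assms] by simp
qed auto

text \<open>The admissibility of w F(r) as a test function. With r replaced by its mollifications
  the product is C^1 and the weak inequality applies; both terms of its gradient pass to the limit
  by \<open>weighted_product_tendsto\<close>, since A is of order q^(p-1) and q^p is locally
  integrable.\<close>

lemma weak_ineq_composed: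
  fixes F F' :: "real \<Rightarrow> real"
  assumes w: "C1c W w Dw" "\<And>y. w y \<ge> 0"
    and F: "\<And>t. t \<ge> 0 \<Longrightarrow> (F has_real_derivative F' t) (at t)" "continuous_on {0..} F'"
    and Fb: "\<And>t. t \<ge> 0 \<Longrightarrow> 0 \<le> F t \<and> F t \<le> M \<and> \<bar>F' t\<bar> \<le> M"
  shows "0 \<le> b * (LINT y:W|lebesgue. F (r y) * (A y \<bullet> Dw y) + w y * F' (r y) * (A y \<bullet> G y))"
proof -
  obtain K where K: "compact K" "K \<subseteq> W" "\<And>y. y \<notin> K \<Longrightarrow> w y = 0"
    and D: "\<And>y. (w has_derivative (\<lambda>v. Dw y \<bullet> v)) (at y)" "continuous_on UNIV Dw"
    using w unfolding C1c_def by blast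
  have wc: "continuous_on UNIV w"
    by (intro continuous_at_imp_continuous_on ballI has_derivative_continuous[OF D(1)])
  have Dw0: "Dw y = 0" if "y \<notin> K" for y
    using has_derivative_zero_outside[OF K(1,3) D(1) that] .
  \<comment> \<open>Room around the support of \<open>w\<close>: a mollification of radius below e
    at a point of \<open>K\<close> sees only values on \<open>K1\<close>, which is still compact in
    \<open>W\<close>.\<close>
  obtain e where e: "e > 0" "(\<Union>x\<in>K. cball x e) \<subseteq> W"
    using compact_subset_open_imp_cball_epsilon_subset[OF K(1) W K(2)] by blast
  define K1 where "K1 = (\<Union>x\<in>K. cball x e)"
  have K1: "compact K1" "K1 \<subseteq> W" "K \<subseteq> K1"
    using compact_minkowski_sum_cball[OF K(1)] e by (auto simp: K1_def intro!: bexI[of _ _ K])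
  have K1b: "cball y e \<subseteq> K1" if "y \<in> K" for y using that by (auto simp: K1_def)
  obtain R where "\<forall>x\<in>K1. norm x \<le> R" using compact_imp_bounded[OF K1(1)] by (auto simp: bounded_iff)
  then have R: "K1 \<subseteq> cball 0 R" by auto
  have K1m [measurable]: "K1 \<in> sets borel" by (rule borel_closed[OF compact_imp_closed[OF K1(1)]])
  have rGm: "r \<in> borel_measurable (lebesgue_on W)" "G \<in> borel_measurable (lebesgue_on W)"
    and rGi: "(\<integral>\<^sup>+x\<in>K1. ennreal (norm (r x) powr 1) \<partial>lebesgue) < \<infinity>" "(\<integral>\<^sup>+x\<in>K1. ennreal (norm (G x) powr 1) \<partial>lebesgue) < \<infinity>"
    using wp K1 by (auto simp: weak_partials_def Lp_loc_def)
  obtain r1 where r1: "r1 \<in> borel_measurable borel" "\<And>z. z \<notin> K1 \<Longrightarrow> r1 z = 0" "AE z in lborel. z \<in> K1 \<longrightarrow> r1 z = r z"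
    using borel_version_on_compact[OF W K1(1,2) rGm(1)] by blast
  \<comment> \<open>The Borel version may be negative on a null set. Clamping it keeps all
    mollifications nonnegative, where \<open>F\<close> is controlled.\<close>
  define r' where "r' z = max 0 (r1 z)" for z
  have r'm [measurable]: "r' \<in> borel_measurable borel" using r1(1) by (simp add: r'_def[abs_def])
  have r'0: "r' z \<ge> 0" "z \<notin> K1 \<Longrightarrow> r' z = 0" for z by (auto simp: r'_def r1)
  have r'r: "AE z in lborel. z \<in> K1 \<longrightarrow> r' z = r z"
    using r1(3) r0[unfolded AE_completion_iff] by eventually_elim (use K1 in \<open>auto simp: r'_def\<close>)
  have "\<exists>g. g \<in> borel_measurable borel \<and> (\<forall>z. z \<notin> K1 \<longrightarrow> g z = 0) \<and> (AE z in lborel. z \<in> K1 \<longrightarrow> g z = G z $ i)" for i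
  proof -
    have "(\<lambda>z. G z $ i) \<in> borel_measurable (lebesgue_on W)"
      using rGm(2) by (rule measurable_compose[OF _ borel_measurable_nth])
    from borel_version_on_compact[OF W K1(1,2) this] show ?thesis by blast
  qed
  then have "\<exists>G'. \<forall>i. G' i \<in> borel_measurable borel \<and> (\<forall>z. z \<notin> K1 \<longrightarrow> G' i z = 0) \<and> (AE z in lborel. z \<in> K1 \<longrightarrow> G' i z = G z $ i)"
    by (intro choice allI)
  then obtain G' where "\<forall>i. G' i \<in> borel_measurable borel \<and> (\<forall>z. z \<notin> K1 \<longrightarrow> G' i z = 0) \<and> (AE z in lborel. z \<in> K1 \<longrightarrow> G' i z = G z $ i)"
    by (elim exE) (rule that)
  then have G'm [measurable]: "\<And>i. G' i \<in> borel_measurable borel" and G'0: "\<And>i z. z \<notin> K1 \<Longrightarrow> G' i z = 0"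
    and G'G: "\<And>i. AE z in lborel. z \<in> K1 \<longrightarrow> G' i z = G z $ i" by simp_all
  have r'i: "integrable lborel r'"
  proof (rule integrableI_bounded)
    have "(\<integral>\<^sup>+z. ennreal (norm (r' z)) \<partial>lborel) = (\<integral>\<^sup>+z\<in>K1. ennreal (norm (r z) powr 1) \<partial>lborel)"
      using r'r
      by (intro nn_integral_cong_AE, eventually_elim) (use r'0 in \<open>auto simp: indicator_def abs_of_nonneg\<close>, metis abs_of_nonneg)
    also have "\<dots> < \<infinity>" using rGi(1) by (simp add: nn_integral_completion)
    finally show "(\<integral>\<^sup>+z. ennreal (norm (r' z)) \<partial>lborel) < \<infinity>" .
  qed auto
  have G'i: "integrable lborel (G' i)" for i
  proof (rule integrableI_bounded)
    have "(\<integral>\<^sup>+z. ennreal (norm (G' i z)) \<partial>lborel) \<le> (\<integral>\<^sup>+z\<in>K1. ennreal (norm (G z) powr 1) \<partial>lborel)"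
      by (rule nn_integral_mono_AE)
        (use G'G[of i] G'0 in \<open>auto elim!: eventually_mono simp: indicator_def intro!: ennreal_leI component_le_norm_cart[unfolded real_norm_def]\<close>)
    also have "\<dots> < \<infinity>" using rGi(2) by (simp add: nn_integral_completion)
    finally show "(\<integral>\<^sup>+z. ennreal (norm (G' i z)) \<partial>lborel) < \<infinity>" .
  qed auto
  obtain C where C: "C \<ge> 0" "\<And>y. y \<in> K1 \<Longrightarrow> norm (A y) \<le> C * q y powr (p - 1)" "\<And>y. y \<in> K1 \<Longrightarrow> norm (G y) \<le> C * q y"
    using bd[OF K1(1,2)] by blast
  define Q where "Q y = indicator K1 y * q y" for y
  have Q0: "Q y \<ge> 0" for y by (simp add: Q_def q0)
  have Qp: "Q y powr p = indicator K1 y * q y powr p" for y by (simp add: Q_def indicator_def)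
  have Qi: "integrable lebesgue (\<lambda>y. Q y powr p)"
    unfolding Qp by (rule q_powr_integrable[OF K1(1,2)])
  define B where "B i y = indicator K1 y * A y $ i" for i y
  have B: "\<bar>B i y\<bar> \<le> C * Q y powr (p - 1)" for i y
    using C(2)[of y] component_le_norm_cart[of "A y" i] by (auto simp: B_def Q_def indicator_def)
  have Bm [measurable]: "B i \<in> borel_measurable lebesgue" for i
  proof -
    have "(\<lambda>y. A y $ i) \<in> borel_measurable (lebesgue_on W)"
      using Am by (rule measurable_compose[OF _ borel_measurable_nth])
    then have "(\<lambda>y. indicator W y *\<^sub>R A y $ i) \<in> borel_measurable lebesgue"
      by (simp add: borel_measurable_restrict_space_iff[OF W_sets])
    then have "(\<lambda>y. indicator K1 y * (indicator W y *\<^sub>R A y $ i)) \<in> borel_measurable lebesgue"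
      by (intro borel_measurable_times borel_measurable_indicator) auto
    also have "(\<lambda>y. indicator K1 y * (indicator W y *\<^sub>R A y $ i)) = B i"
      by (intro ext) (use K1 in \<open>auto simp: indicator_def B_def\<close>)
    finally show ?thesis .
  qed
  \<comment> \<open>Weak partial derivatives are only locally L^1 by definition; the bound of G by a
    multiple of q raises this to L^p.\<close>
  have G'pL: "integrable lebesgue (\<lambda>z. \<bar>G' i z\<bar> powr p)" for i
  proof (rule Bochner_Integration.integrable_bound[where f = "\<lambda>z. C powr p * Q z powr p"])
    show "AE z in lebesgue. norm (\<bar>G' i z\<bar> powr p) \<le> norm (C powr p * Q z powr p)"
      unfolding AE_completion_iff using G'G[of i]
    proof eventually_elim
      case (elim z)
      show ?case
      proof (cases "z \<in> K1")
        case True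
        then have "\<bar>G' i z\<bar> \<le> C * Q z"
          using elim C(3)[of z] component_le_norm_cart[of "G z" i] by (auto simp: Q_def)
        then have "\<bar>G' i z\<bar> powr p \<le> (C * Q z) powr p" using p by (intro powr_mono2) auto
        then show ?thesis using C(1) Q0[of z] by (simp add: powr_mult)
      qed (use G'0 p in simp)
    qed
  qed (use Qi in \<open>auto intro!: measurable_completion\<close>)
  then have G'p: "integrable lborel (\<lambda>z. \<bar>G' i z\<bar> powr p)" for i
    by (subst (asm) integrable_completion) auto
  \<comment> \<open>Nothing is known about \<open>F\<close> and \<open>F'\<close> at negative
    arguments; freezing them there at their value in 0 gives continuous bounded functions on the
    whole line.\<close>
  define F2 where "F2 t = F (max 0 t)" for t
  define F2' where "F2' t = F' (max 0 t)" for t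
  have "isCont F t" if "t \<ge> 0" for t using F(1)[OF that] DERIV_isCont by blast
  then have Fc: "continuous_on {0..} F" by (auto intro: continuous_at_imp_continuous_on)
  have F2c: "continuous_on UNIV F2" "continuous_on UNIV F2'"
    unfolding F2_def[abs_def] F2'_def[abs_def]
    by (rule continuous_on_compose2[OF Fc] continuous_on_compose2[OF F(2)]; auto intro!: continuous_intros)+
  have F2b: "\<bar>F2 t\<bar> \<le> M" "\<bar>F2' t\<bar> \<le> M" for t using Fb[of "max 0 t"] by (auto simp: F2_def F2'_def)
  have F2eq: "F2 t = F t" "F2' t = F' t" if "t \<ge> 0" for t using that by (auto simp: F2_def F2'_def)
  have [measurable]: "F2 \<in> borel_measurable borel" "F2' \<in> borel_measurable borel" "w \<in> borel_measurable borel"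
    by (intro borel_measurable_continuous_onI F2c wc)+
  have Dwm [measurable]: "(\<lambda>y. Dw y $ i) \<in> borel_measurable borel" for i
    by (intro borel_measurable_continuous_onI continuous_on_component D)
  obtain Cw where Cw: "Cw \<ge> 0" "\<And>y. \<bar>w y\<bar> \<le> Cw" "\<And>y. norm (Dw y) \<le> Cw"
    using C1c_bounded[OF w(1)] by blast
  \<comment> \<open>The shift by 2 makes already the initial radius e/2 strictly smaller than
    e.\<close>
  define \<delta> where "\<delta> n = e / real (n + 2)" for n
  have \<delta>: "\<delta> n > 0" "\<delta> n < e" for n using e by (auto simp: \<delta>_def field_simps intro: add_pos_nonneg)
  have \<delta>0: "\<delta> \<longlonglongrightarrow> 0" unfolding \<delta>_def by (rule LIMSEQ_ignore_initial_segment[OF lim_const_over_n])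
  have supp: "z \<notin> cball 0 R \<Longrightarrow> z \<notin> K1" for z using R by auto
  \<comment> \<open>The mollifications converge in L^1 (the case p = 1), hence almost everywhere
    along a subsequence; pointwise convergence is what the nonlinear \<open>F\<close> needs.\<close>
  have "\<exists>s::nat\<Rightarrow>nat. strict_mono s \<and> (AE y in lborel. (\<lambda>n. mollify (\<delta> (s n)) r' y - r' y) \<longlonglongrightarrow> 0)"
  proof (rule tendsto_L1_AE_subseq)
    have r'1: "integrable lborel (\<lambda>z. \<bar>r' z\<bar> powr 1)" using r'i by simp
    have r's: "r' z = 0" if "z \<notin> cball 0 R" for z using that r'0(2) supp by blast
    note s = mollify_Lp_sequence[where R = R, OF order_refl r'i r'1 r's \<delta>(1) \<delta>0, simplified]
    show "integrable lborel (\<lambda>y. mollify (\<delta> n) r' y - r' y)" for n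
      using s(1)[of n] by (subst integrable_norm_iff[symmetric]) auto
    show "(\<lambda>n. LBINT y. norm (mollify (\<delta> n) r' y - r' y)) \<longlonglongrightarrow> 0"
      using s(2) by simp
  qed
  then obtain s where s: "strict_mono s" and sl: "AE y in lborel. (\<lambda>n. mollify (\<delta> (s n)) r' y - r' y) \<longlonglongrightarrow> 0" by blast
  define d where "d n = \<delta> (s n)" for n
  have d: "d n > 0" "d n < e" for n using \<delta> by (auto simp: d_def)
  have d0: "d \<longlonglongrightarrow> 0" using LIMSEQ_subseq_LIMSEQ[OF \<delta>0 s] by (simp add: d_def[abs_def] comp_def)
  define Rn where "Rn n = mollify (d n) r'" for n
  have Rn0: "Rn n y \<ge> 0" for n y
    unfolding Rn_def mollify_def by (intro Bochner_Integration.integral_nonneg mult_nonneg_nonneg mollifier_nonneg r'0)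
  have [measurable]: "Rn n \<in> borel_measurable borel" for n unfolding Rn_def by measurable
  have Rnl: "AE y in lborel. (\<lambda>n. Rn n y) \<longlonglongrightarrow> r' y"
    using sl by eventually_elim (simp add: Rn_def d_def LIM_zero_iff)
  define DR where "DR n y = (\<chi> i. \<integral>z. mollifier_deriv (d n) (y - z) (axis i 1) * r' z \<partial>lborel)" for n y
  have DRd: "(Rn n has_derivative (\<lambda>v. DR n y \<bullet> v)) (at y)" for n y
  proof -
    note h = mollify_has_derivative[OF d(1) r'i, of n y]
    interpret bounded_linear "\<lambda>v. \<integral>z. mollifier_deriv (d n) (y - z) v * r' z \<partial>lborel"
      using h by (rule has_derivative_bounded_linear)
    have "(\<integral>z. mollifier_deriv (d n) (y - z) v * r' z \<partial>lborel) = DR n y \<bullet> v" for v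
    proof -
      have "(\<integral>z. mollifier_deriv (d n) (y - z) v * r' z \<partial>lborel) = (\<integral>z. mollifier_deriv (d n) (y - z) (\<Sum>i\<in>UNIV. v $ i *\<^sub>R axis i 1) * r' z \<partial>lborel)"
        using basis_expansion[of v] by (simp add: scalar_mult_eq_scaleR)
      also have "\<dots> = DR n y \<bullet> v"
        by (simp only: sum scaleR) (simp add: DR_def inner_vec_def mult.commute)
      finally show ?thesis .
    qed
    then show ?thesis using h by (simp add: Rn_def)
  qed
  have DRc: "continuous_on UNIV (DR n)" for n
    unfolding DR_def[abs_def] by (intro continuous_on_vec_lambda mollify_deriv_continuous d(1) r'i)
  \<comment> \<open>Restricted to \<open>K\<close>, where the kernel fits into \<open>K1\<close>.
    Off \<open>K\<close> this gradient only occurs multiplied by \<open>w\<close>, which is 0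
    there.\<close>
  have DRG: "DR n y $ i = mollify (d n) (G' i) y" if "y \<in> K" for n y i
  proof -
    have "cball y (d n) \<subseteq> K1" using K1b[OF that] d(2)[of n] by (meson less_imp_le order_trans subset_cball)
    from mollify_deriv_weak_partials[OF W wp K1(2) d(1) this r'm r'r G'm G'G] show ?thesis by (simp add: DR_def)
  qed
  define X where "X n i = (\<integral>y. F2 (Rn n y) * B i y * Dw y $ i \<partial>lebesgue)" for n i
  define Y where "Y n i = (\<integral>y. w y * F2' (Rn n y) * B i y * mollify (d n) (G' i) y \<partial>lebesgue)" for n i
  define X0 where "X0 i = (\<integral>y. F2 (r' y) * B i y * Dw y $ i \<partial>lebesgue)" for i
  define Y0 where "Y0 i = (\<integral>y. w y * F2' (r' y) * B i y * G' i y \<partial>lebesgue)" for i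
  have F2t: "(\<lambda>n. F2 (x n)) \<longlonglongrightarrow> F2 x0" "(\<lambda>n. F2' (x n)) \<longlonglongrightarrow> F2' x0" if "x \<longlonglongrightarrow> x0" for x x0
    using that F2c by (auto intro: continuous_on_tendsto_compose)
  have Dwp: "integrable lebesgue (\<lambda>y. \<bar>Dw y $ i\<bar> powr p)" for i
  proof -
    have "integrable lborel (\<lambda>y. \<bar>Dw y $ i\<bar> powr p)"
      by (rule integrable_continuous_support[OF _ K(1)])
        (use Dw0 p D in \<open>auto intro!: continuous_on_powr' continuous_on_rabs continuous_on_component\<close>)
    then show ?thesis by (simp add: integrable_completion)
  qed
  have lebI: "f \<in> borel_measurable lebesgue" if "f \<in> borel_measurable borel" for f :: "real ^ 'n \<Rightarrow> real"
    using that by (intro measurable_completion) simp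
  \<comment> \<open>Here the L^p factor \<open>Dw\<close> is constant in n and only F2 of the
    mollification varies.\<close>
  have Xl: "(\<forall>n. integrable lebesgue (\<lambda>y. F2 (Rn n y) * B i y * Dw y $ i)) \<and> integrable lebesgue (\<lambda>y. F2 (r' y) * B i y * Dw y $ i)
    \<and> (\<lambda>n. X n i) \<longlonglongrightarrow> X0 i" for i
  proof -
    have m: "(\<lambda>y. F2 (Rn n y)) \<in> borel_measurable lebesgue" "(\<lambda>y. F2 (r' y)) \<in> borel_measurable lebesgue" "(\<lambda>y. Dw y $ i) \<in> borel_measurable lebesgue" for n
      by (auto intro!: lebI)
    have l: "AE y in lebesgue. (\<lambda>n. F2 (Rn n y)) \<longlonglongrightarrow> F2 (r' y)"
      unfolding AE_completion_iff using Rnl by eventually_elim (rule F2t)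
    have H: "integrable lebesgue (\<lambda>y. \<bar>Dw y $ i - Dw y $ i\<bar> powr p)" "(\<lambda>n. \<integral>y. \<bar>Dw y $ i - Dw y $ i\<bar> powr p \<partial>lebesgue) \<longlonglongrightarrow> 0"
      by simp_all
    note wt = weighted_product_tendsto[OF p m(1,2) F2b(1) l Bm[of i] B[of i] Q0 Qi m(3) m(3) Dwp[of i] H]
    show ?thesis unfolding X_def X0_def using wt by blast
  qed
  \<comment> \<open>Here both factors vary: the bounded one converges almost everywhere, the
    mollified weak derivative in L^p.\<close>
  have Yl: "(\<forall>n. integrable lebesgue (\<lambda>y. w y * F2' (Rn n y) * B i y * mollify (d n) (G' i) y)) \<and> integrable lebesgue (\<lambda>y. w y * F2' (r' y) * B i y * G' i y)
    \<and> (\<lambda>n. Y n i) \<longlonglongrightarrow> Y0 i" for i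
  proof -
    have m: "(\<lambda>y. w y * F2' (Rn n y)) \<in> borel_measurable lebesgue" "(\<lambda>y. w y * F2' (r' y)) \<in> borel_measurable lebesgue"
      "mollify (d n) (G' i) \<in> borel_measurable lebesgue" "G' i \<in> borel_measurable lebesgue" for n
      by (auto intro!: lebI)
    have l: "AE y in lebesgue. (\<lambda>n. w y * F2' (Rn n y)) \<longlonglongrightarrow> w y * F2' (r' y)"
      unfolding AE_completion_iff using Rnl by eventually_elim (intro tendsto_intros F2t)
    have bd: "\<bar>w y * F2' (Rn n y)\<bar> \<le> Cw * M" for n y
      unfolding abs_mult by (intro mult_mono Cw F2b) auto
    have G's: "G' i z = 0" if "z \<notin> cball 0 R" for z using that G'0 supp by blast
    note s = mollify_Lp_sequence[where R = R, OF less_imp_le[OF p] G'i[of i] G'p[of i] G's d(1) d0, simplified]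
    have H1: "integrable lebesgue (\<lambda>y. \<bar>mollify (d n) (G' i) y - G' i y\<bar> powr p)" for n
      using s(1)[of n] by (subst integrable_completion) auto
    have H2: "(\<lambda>n. \<integral>y. \<bar>mollify (d n) (G' i) y - G' i y\<bar> powr p \<partial>lebesgue) \<longlonglongrightarrow> 0"
      using s(2) by (subst integral_completion) auto
    note wt = weighted_product_tendsto[OF p m(1,2) bd l Bm[of i] B[of i] Q0 Qi m(3,4) G'pL[of i] H1 H2]
    show ?thesis unfolding Y_def Y0_def using wt by blast
  qed
  have Xint: "integrable lebesgue (\<lambda>y. F2 (Rn n y) * B i y * Dw y $ i)" "integrable lebesgue (\<lambda>y. F2 (r' y) * B i y * Dw y $ i)"
    and Xlim: "(\<lambda>n. X n i) \<longlonglongrightarrow> X0 i" for n i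
    using Xl[of i] by blast+
  have Yint: "integrable lebesgue (\<lambda>y. w y * F2' (Rn n y) * B i y * mollify (d n) (G' i) y)" "integrable lebesgue (\<lambda>y. w y * F2' (r' y) * B i y * G' i y)"
    and Ylim: "(\<lambda>n. Y n i) \<longlonglongrightarrow> Y0 i" for n i
    using Yl[of i] by blast+
  \<comment> \<open>The weak inequality for the C^1 test function w F(Rn n), written out in
    components.\<close>
  have nonneg: "0 \<le> b * (\<Sum>i\<in>UNIV. X n i + Y n i)" for n
  proof -
    define \<phi> where "\<phi> y = w y * F (Rn n y)" for y
    define D\<phi> where "D\<phi> y = F2 (Rn n y) *\<^sub>R Dw y + (w y * F2' (Rn n y)) *\<^sub>R DR n y" for y
    have Rnc: "continuous_on UNIV (Rn n)"
      by (intro continuous_at_imp_continuous_on ballI has_derivative_continuous[OF DRd])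
    have "C1c W \<phi> D\<phi>"
      unfolding C1c_def
    proof (intro conjI allI exI[of _ K] K)
      fix y
      show "(\<phi> has_derivative (\<lambda>v. D\<phi> y \<bullet> v)) (at y)"
        unfolding \<phi>_def[abs_def]
        by (rule has_derivative_eq_rhs[OF has_derivative_mult[OF D(1) DERIV_compose_FDERIV[OF F(1)[OF Rn0] DRd]]])
          (auto simp: D\<phi>_def F2eq Rn0 inner_add_left algebra_simps)
      show "y \<notin> K \<longrightarrow> \<phi> y = 0" using K by (simp add: \<phi>_def)
      show "continuous_on UNIV D\<phi>"
        unfolding D\<phi>_def[abs_def]
        by (intro continuous_intros wc D DRc continuous_on_compose2[OF F2c(1) Rnc] continuous_on_compose2[OF F2c(2) Rnc]) auto
    qed
    moreover have "\<phi> y \<ge> 0" for y using w(2) Fb[OF Rn0] by (simp add: \<phi>_def)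
    ultimately have "0 \<le> b * (LINT y:W|lebesgue. A y \<bullet> D\<phi> y)" by (rule ineq)
    also have "(LINT y:W|lebesgue. A y \<bullet> D\<phi> y)
        = (\<integral>y. (\<Sum>i\<in>UNIV. F2 (Rn n y) * B i y * Dw y $ i + w y * F2' (Rn n y) * B i y * mollify (d n) (G' i) y) \<partial>lebesgue)"
      unfolding set_lebesgue_integral_def
    proof (rule Bochner_Integration.integral_cong[OF refl])
      fix y
      show "indicat_real W y *\<^sub>R (A y \<bullet> D\<phi> y) = (\<Sum>i\<in>UNIV. F2 (Rn n y) * B i y * Dw y $ i + w y * F2' (Rn n y) * B i y * mollify (d n) (G' i) y)"
      proof (cases "y \<in> K")
        case True
        then have "y \<in> W" "y \<in> K1" using K1 K by auto
        with True show ?thesis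
          by (simp add: inner_vec_def D\<phi>_def DRG B_def algebra_simps)
      next
        case False
        then show ?thesis using K Dw0 by (simp add: D\<phi>_def)
      qed
    qed
    also have "\<dots> = (\<Sum>i\<in>UNIV. X n i + Y n i)"
      unfolding X_def Y_def using Xint Yint by simp
    finally show ?thesis .
  qed
  have "(\<lambda>n. b * (\<Sum>i\<in>UNIV. X n i + Y n i)) \<longlonglongrightarrow> b * (\<Sum>i\<in>UNIV. X0 i + Y0 i)"
    by (intro tendsto_intros Xlim Ylim)
  then have "0 \<le> b * (\<Sum>i\<in>UNIV. X0 i + Y0 i)"
    by (rule LIMSEQ_le_const) (use nonneg in auto)
  also have "(\<Sum>i\<in>UNIV. X0 i + Y0 i)
     = (\<integral>y. (\<Sum>i\<in>UNIV. F2 (r' y) * B i y * Dw y $ i + w y * F2' (r' y) * B i y * G' i y) \<partial>lebesgue)"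
    unfolding X0_def Y0_def using Xint Yint by simp
  also have "\<dots> = (LINT y:W|lebesgue. F (r y) * (A y \<bullet> Dw y) + w y * F' (r y) * (A y \<bullet> G y))"
    unfolding set_lebesgue_integral_def
  proof (rule integral_cong_AE)
    let ?S = "\<lambda>y. \<Sum>i\<in>UNIV. F2 (r' y) * B i y * Dw y $ i + w y * F2' (r' y) * B i y * G' i y"
    let ?T = "\<lambda>y. indicat_real W y *\<^sub>R (F (r y) * (A y \<bullet> Dw y) + w y * F' (r y) * (A y \<bullet> G y))"
    have "AE y in lborel. \<forall>i. y \<in> K1 \<longrightarrow> G' i y = G y $ i"
      unfolding AE_all_countable using G'G by blast
    then show ae: "AE y in lebesgue. ?S y = ?T y"
      unfolding AE_completion_iff using r'r
    proof eventually_elim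
      case (elim y)
      show ?case
      proof (cases "y \<in> K")
        case True
        then have "r y \<ge> 0" "r' y = r y" "y \<in> W" "y \<in> K1" "\<And>i. G' i y = G y $ i"
          using elim K1 K r'0(1)[of y] by auto
        with True show ?thesis
          by (simp add: inner_vec_def F2eq B_def algebra_simps sum_distrib_left sum.distrib)
      next
        case False
        then show ?thesis using K Dw0 by simp
      qed
    qed
    show "?S \<in> borel_measurable lebesgue"
      using Xint Yint by (intro borel_measurable_sum borel_measurable_add) auto
    \<comment> \<open>\<open>F\<close> composed with \<open>r\<close> need not be measurable where
      \<open>r\<close> is negative, so measurability is shown for the extensions \<open>F2\<close>,
      \<open>F2'\<close> and transferred almost everywhere.\<close>
    show "?T \<in> borel_measurable lebesgue"
    proof -
      have "(\<lambda>y. indicat_real W y *\<^sub>R (F2 (r y) * (A y \<bullet> Dw y) + w y * F2' (r y) * (A y \<bullet> G y))) \<in> borel_measurable lebesgue"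
        unfolding borel_measurable_restrict_space_iff[OF W_sets, symmetric]
      proof (intro borel_measurable_add borel_measurable_times borel_measurable_inner)
        show "(\<lambda>y. F2 (r y)) \<in> borel_measurable (lebesgue_on W)" "(\<lambda>y. F2' (r y)) \<in> borel_measurable (lebesgue_on W)"
          by (rule measurable_compose[OF rGm(1)], measurable)+
        show "Dw \<in> borel_measurable (lebesgue_on W)" "w \<in> borel_measurable (lebesgue_on W)"
          by (intro continuous_measurable_restrict_lebesgue wc D)+
      qed (use Am rGm in auto)
      moreover have "AE y in lebesgue. indicat_real W y *\<^sub>R (F2 (r y) * (A y \<bullet> Dw y) + w y * F2' (r y) * (A y \<bullet> G y)) = ?T y"
        using r0 by eventually_elim (auto simp: F2eq indicator_def)
      ultimately show ?thesis
        by (rule borel_measurable_AE)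
    qed
  qed
  finally show ?thesis .
qed

end

text \<open>
  On $t \ge 0$ the powers of \<open>squash e\<close> are bounded with bounded derivative, and they converge to those
  of $t$ as $e \to 0$. The values lie between \<open>t\<close> and \<open>1\<close>, which dominates the powers uniformly in \<open>e\<close>.
\<close>

definition squash :: "real \<Rightarrow> real \<Rightarrow> real" where
  "squash e t = (t + e) / (1 + e * t)"

definition squash' :: "real \<Rightarrow> real \<Rightarrow> real" where
  "squash' e t = (1 - e\<^sup>2) / (1 + e * t)\<^sup>2"

context
  fixes e t :: real
  assumes e: "0 < e" "e < 1" and t: "t \<ge> 0"
begin

lemma squash_denominator: "1 + e * t \<ge> 1" "1 + e * t > 0"
proof -
  have "e * t \<ge> 0" using e t by simp
  then show "1 + e * t \<ge> 1" "1 + e * t > 0" by linarith+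
qed

lemma squash_DERIV: "(squash e has_real_derivative squash' e t) (at t)"
  unfolding squash_def[abs_def] squash'_def
  using squash_denominator
  by (auto intro!: derivative_eq_intros simp: field_simps power2_eq_square)

lemma squash_bounds: "e \<le> squash e t" "squash e t \<le> 1 / e" "squash e t > 0"
proof -
  have "e * (e * t) \<le> 1 * (1 * t)" using e t by (intro mult_mono) auto
  then show 1: "e \<le> squash e t"
    using squash_denominator by (simp add: squash_def pos_le_divide_eq algebra_simps)
  have "e * e \<le> 1" using e by (simp add: mult_le_one)
  then show "squash e t \<le> 1 / e"
    using squash_denominator e by (simp add: squash_def divide_simps algebra_simps)
  show "squash e t > 0" using 1 e by simp
qed

text \<open>The map is a Moebius transformation fixing 1: squash e t - 1 = (1 - e)(t - 1)/(1 + e t)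
  and t - squash e t = e (t^2 - 1)/(1 + e t), both with the sign of t - 1.\<close>

lemma squash_between: "t \<le> 1 \<Longrightarrow> t \<le> squash e t \<and> squash e t \<le> 1" "1 \<le> t \<Longrightarrow> 1 \<le> squash e t \<and> squash e t \<le> t"
proof -
  have *: "e * (t * t) \<le> e * 1 \<longleftrightarrow> t * t \<le> 1" "e * 1 \<le> e * (t * t) \<longleftrightarrow> 1 \<le> t * t" using e by simp_all
  have **: "(1 - e) * t \<le> (1 - e) * 1 \<longleftrightarrow> t \<le> 1" "(1 - e) * 1 \<le> (1 - e) * t \<longleftrightarrow> 1 \<le> t" using e by simp_all
  show "t \<le> squash e t \<and> squash e t \<le> 1" if "t \<le> 1"
    using * ** that t mult_mono[of t 1 t 1] squash_denominator
    by (auto simp: squash_def pos_le_divide_eq pos_divide_le_eq algebra_simps)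
  show "1 \<le> squash e t \<and> squash e t \<le> t" if "1 \<le> t"
    using * ** that t mult_mono[of 1 t 1 t] squash_denominator
    by (auto simp: squash_def pos_le_divide_eq pos_divide_le_eq algebra_simps)
qed

lemma squash_powr_le:
  assumes "t > 0" shows "squash e t powr c \<le> t powr c + 1"
proof (cases "t \<le> 1"; cases "c \<ge> 0")
  assume "t \<le> 1" "c \<ge> 0"
  then have "squash e t powr c \<le> 1 powr c" using squash_between squash_bounds by (intro powr_mono2) auto
  then show ?thesis by (simp add: add_increasing)
next
  assume "t \<le> 1" "\<not> c \<ge> 0"
  then have "squash e t powr c \<le> t powr c" using squash_between assms by (intro powr_mono2') auto
  then show ?thesis by simp
next
  assume "\<not> t \<le> 1" "c \<ge> 0"
  then have "squash e t powr c \<le> t powr c" using squash_between squash_bounds by (intro powr_mono2) auto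
  then show ?thesis by simp
next
  assume "\<not> t \<le> 1" "\<not> c \<ge> 0"
  then have "squash e t powr c \<le> 1 powr c" using squash_between by (intro powr_mono2') auto
  then show ?thesis by (simp add: add_increasing)
qed

text \<open>The values lie in [e, 1/e]; the sign of \<open>c\<close> decides which endpoint is the
  extreme one.\<close>

lemma squash_powr_bounded: "squash e t powr c \<le> e powr (- \<bar>c\<bar>)"
proof (cases "c \<ge> 0")
  case True
  then have "squash e t powr c \<le> (1 / e) powr c" using squash_bounds by (intro powr_mono2) auto
  then show ?thesis using e True by (simp add: powr_minus powr_divide inverse_eq_divide)
next
  case False
  then have "squash e t powr c \<le> e powr c" using squash_bounds e by (intro powr_mono2') auto
  then show ?thesis using False by simp
qed

lemma squash'_bounds: "0 \<le> squash' e t" "squash' e t \<le> 1"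
proof -
  have e2: "0 \<le> e\<^sup>2" "e\<^sup>2 \<le> 1" using e by (auto simp: power_le_one)
  show "0 \<le> squash' e t" using e2 by (simp add: squash'_def)
  have "1 \<le> (1 + e * t)\<^sup>2" using squash_denominator by (intro one_le_power) auto
  with e2 have "1 - e\<^sup>2 \<le> (1 + e * t)\<^sup>2" by linarith
  then show "squash' e t \<le> 1" by (simp add: squash'_def divide_simps)
qed

end

lemma squash_tendsto:
  assumes "E \<longlonglongrightarrow> 0"
  shows "(\<lambda>n. squash (E n) t) \<longlonglongrightarrow> t" "(\<lambda>n. squash' (E n) t) \<longlonglongrightarrow> 1"
  unfolding squash_def squash'_def using assms by (auto intro!: tendsto_eq_intros)

lemma squash_continuous:
  assumes e: "0 < e" "e < 1"
  shows "continuous_on {0..} (squash e)" "continuous_on {0..} (squash' e)"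
  unfolding squash_def[abs_def] squash'_def[abs_def]
  using squash_denominator[OF e] by (intro continuous_intros; force)+

section \<open>Extended powers and the energy estimate in one chart\<close>

lemma epowr_pos: "r > 0 \<Longrightarrow> epowr r a = ennreal (r powr a)"
  by (simp add: epowr_def)

text \<open>At 0 \<open>powr\<close> gives 0 while \<open>epowr\<close> may be 1 or infinite. Thus
  the real integrands lie below the extended ones, and the integrability hypotheses carry over to
  them.\<close>

lemma ennreal_powr_le_epowr: "r \<ge> 0 \<Longrightarrow> ennreal (r powr a) \<le> epowr r a"
  by (auto simp: epowr_def)

lemma ennreal_quotient_le_epowr:
  assumes "r \<ge> 0" "x \<ge> 0"
  shows "ennreal (x * r powr (- a)) \<le> ennreal x / epowr r a"
proof (cases "r = 0")
  case False
  then show ?thesis using assms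
    by (simp add: epowr_pos divide_ennreal powr_minus divide_inverse)
qed simp

context chart_supersolution
begin

lemma indicator_measurable:
  fixes f :: "real ^ 'n \<Rightarrow> real"
  assumes "f \<in> borel_measurable (lebesgue_on W)" "compact K" "K \<subseteq> W"
  shows "(\<lambda>y. indicator K y * f y) \<in> borel_measurable lebesgue"
proof -
  have K: "K \<in> sets lebesgue" using borel_closed[OF compact_imp_closed[OF assms(2)]] by auto
  have "(\<lambda>y. indicator W y *\<^sub>R f y) \<in> borel_measurable lebesgue"
    using assms(1) by (simp add: borel_measurable_restrict_space_iff[OF W_sets])
  then have "(\<lambda>y. indicator K y * (indicator W y *\<^sub>R f y)) \<in> borel_measurable lebesgue"
    using K by (intro borel_measurable_times borel_measurable_indicator)
  also have "(\<lambda>y. indicator K y * (indicator W y *\<^sub>R f y)) = (\<lambda>y. indicator K y * f y)"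
    by (intro ext) (use assms in \<open>auto simp: indicator_def\<close>)
  finally show ?thesis .
qed

lemma rm: "r \<in> borel_measurable (lebesgue_on W)" and Gm: "G \<in> borel_measurable (lebesgue_on W)"
  using wp by (auto simp: weak_partials_def Lp_loc_def)

text \<open>The weak inequality is tested with w F_n(r), where F_n is the power -b of
  \<open>squash\<close> and F_n' = -b V_n. Multiplying by b puts b^2 in front of the term with V_n
  for either sign of b. The side with \<open>Dw\<close> converges by domination and the other by
  Fatou, so the finiteness of the left-hand integral is part of the conclusion.\<close>

lemma caccioppoli:
  fixes \<alpha> :: real
  assumes b: "b = p - 1 - \<alpha>" "b \<noteq> 0"
    and AG: "\<And>y. y \<in> W \<Longrightarrow> A y \<bullet> G y \<ge> 0"
    and ii1: "\<And>K. compact K \<Longrightarrow> K \<subseteq> W \<Longrightarrow> (\<integral>\<^sup>+y\<in>K. ennreal (q y powr p) / epowr (r y) (p - \<alpha>) \<partial>lebesgue) < \<infinity>"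
    and ii2: "\<And>K. compact K \<Longrightarrow> K \<subseteq> W \<Longrightarrow> (\<integral>\<^sup>+y\<in>K. epowr (r y) \<alpha> \<partial>lebesgue) < \<infinity>"
    and w: "C1c W w Dw" "\<And>y. w y \<ge> 0"
  shows "integrable lebesgue (\<lambda>y. indicator W y * (r y powr (- b) * (A y \<bullet> Dw y)))"
    "(\<integral>\<^sup>+y. ennreal (b\<^sup>2 * (indicator W y * (w y * r y powr (\<alpha> - p) * (A y \<bullet> G y)))) \<partial>lebesgue)
      \<le> ennreal (b * (\<integral>y. indicator W y * (r y powr (- b) * (A y \<bullet> Dw y)) \<partial>lebesgue))"
    "0 \<le> b * (\<integral>y. indicator W y * (r y powr (- b) * (A y \<bullet> Dw y)) \<partial>lebesgue)"
proof -
  obtain K where K: "compact K" "K \<subseteq> W" "\<And>y. y \<notin> K \<Longrightarrow> w y = 0"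
    and D: "\<And>y. (w has_derivative (\<lambda>v. Dw y \<bullet> v)) (at y)" "continuous_on UNIV Dw"
    using w unfolding C1c_def by blast
  have Dw0: "Dw y = 0" if "y \<notin> K" for y
    using has_derivative_zero_outside[OF K(1,3) D(1) that] .
  have wc: "continuous_on UNIV w"
    by (intro continuous_at_imp_continuous_on ballI has_derivative_continuous[OF D(1)])
  obtain Cw where Cw: "Cw \<ge> 0" "\<And>y. \<bar>w y\<bar> \<le> Cw" "\<And>y. norm (Dw y) \<le> Cw"
    using C1c_bounded[OF w(1)] by blast
  obtain C where C: "C \<ge> 0" "\<And>y. y \<in> K \<Longrightarrow> norm (A y) \<le> C * q y powr (p - 1)" "\<And>y. y \<in> K \<Longrightarrow> norm (G y) \<le> C * q y"
    using bd[OF K(1,2)] by blast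
  note [measurable] = Am qm rm Gm
  have [measurable]: "w \<in> borel_measurable (lebesgue_on W)" "Dw \<in> borel_measurable (lebesgue_on W)"
    by (intro continuous_measurable_restrict_lebesgue wc D)+
  have WK: "indicat_real W y * (c * (A y \<bullet> Dw y)) = indicator K y * (c * (A y \<bullet> Dw y))"
    "indicat_real W y * (w y * c * (A y \<bullet> G y)) = indicator K y * (w y * c * (A y \<bullet> G y))" for y c
    using K Dw0[of y] by (cases "y \<in> K"; auto)+
  have Kf: "emeasure lebesgue K < \<infinity>"
    using emeasure_bounded_finite[OF compact_imp_bounded[OF K(1)]] by (simp add: main_part_sets borel_closed[OF compact_imp_closed[OF K(1)]])
  have Km: "K \<in> sets lebesgue" using borel_closed[OF compact_imp_closed[OF K(1)]] by auto
  have rpos: "AE y in lebesgue. y \<in> K \<longrightarrow> r y \<ge> 0" using r0 by eventually_elim (use K in auto)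
  have i1: "integrable lebesgue (\<lambda>y. indicator K y * (q y powr p * r y powr (\<alpha> - p)))"
  proof (rule integrableI_nonneg)
    show "(\<lambda>y. indicator K y * (q y powr p * r y powr (\<alpha> - p))) \<in> borel_measurable lebesgue"
      by (rule indicator_measurable[OF _ K(1,2)]) measurable
    have "(\<integral>\<^sup>+y. ennreal (indicator K y * (q y powr p * r y powr (\<alpha> - p))) \<partial>lebesgue)
        \<le> (\<integral>\<^sup>+y\<in>K. ennreal (q y powr p) / epowr (r y) (p - \<alpha>) \<partial>lebesgue)"
    proof (rule nn_integral_mono_AE)
      show "AE y in lebesgue. ennreal (indicator K y * (q y powr p * r y powr (\<alpha> - p)))
          \<le> ennreal (q y powr p) / epowr (r y) (p - \<alpha>) * indicator K y"
        using rpos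
      proof eventually_elim
        case (elim y)
        then show ?case
          using ennreal_quotient_le_epowr[of "r y" "q y powr p" "p - \<alpha>"] by (cases "y \<in> K") auto
      qed
    qed
    also have "\<dots> < \<infinity>" by (rule ii1[OF K(1,2)])
    finally show "(\<integral>\<^sup>+y. ennreal (indicator K y * (q y powr p * r y powr (\<alpha> - p))) \<partial>lebesgue) < \<infinity>" .
  qed auto
  have i2: "integrable lebesgue (\<lambda>y. indicator K y * r y powr \<alpha>)"
  proof (rule integrableI_nonneg)
    show "(\<lambda>y. indicator K y * r y powr \<alpha>) \<in> borel_measurable lebesgue"
      by (rule indicator_measurable[OF _ K(1,2)]) measurable
    have "(\<integral>\<^sup>+y. ennreal (indicator K y * r y powr \<alpha>) \<partial>lebesgue) \<le> (\<integral>\<^sup>+y\<in>K. epowr (r y) \<alpha> \<partial>lebesgue)"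
    proof (rule nn_integral_mono_AE)
      show "AE y in lebesgue. ennreal (indicator K y * r y powr \<alpha>) \<le> epowr (r y) \<alpha> * indicator K y"
        using rpos
      proof eventually_elim
        case (elim y)
        then show ?case using ennreal_powr_le_epowr[of "r y" \<alpha>] by (cases "y \<in> K") auto
      qed
    qed
    also have "\<dots> < \<infinity>" by (rule ii2[OF K(1,2)])
    finally show "(\<integral>\<^sup>+y. ennreal (indicator K y * r y powr \<alpha>) \<partial>lebesgue) < \<infinity>" .
  qed auto
  have i3: "integrable lebesgue (\<lambda>y. indicator K y * q y powr p)" by (rule q_powr_integrable[OF K(1,2)])
  have i4: "integrable lebesgue (indicat_real K)" using Kf Km by simp
  text \<open>Where \<open>r\<close> vanishes and \<open>b > 0\<close>, local integrability of the quotient forces \<open>q = 0\<close>.\<close>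
  have A0: "AE y in lebesgue. y \<in> K \<and> r y = 0 \<and> b > 0 \<longrightarrow> A y = 0"
  proof (cases "b > 0")
    case True
    let ?N = "{y \<in> K. r y = 0 \<and> q y \<noteq> 0}"
    have "(\<lambda>y. indicat_real K y * of_bool (r y = 0 \<and> q y \<noteq> 0)) \<in> borel_measurable lebesgue"
      by (rule indicator_measurable[OF _ K(1,2)]) measurable
    then have "(\<lambda>y. indicat_real K y * of_bool (r y = 0 \<and> q y \<noteq> 0)) -` {1} \<inter> space lebesgue \<in> sets lebesgue"
      by (rule measurable_sets) simp
    also have "(\<lambda>y. indicat_real K y * of_bool (r y = 0 \<and> q y \<noteq> 0)) -` {1} \<inter> space lebesgue = ?N"
      by (auto simp: indicator_def of_bool_def split: if_splits)
    finally have N: "?N \<in> sets lebesgue" .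
    have "\<infinity> * emeasure lebesgue ?N = (\<integral>\<^sup>+y. \<infinity> * indicator ?N y \<partial>lebesgue)"
      using N by (simp add: nn_integral_cmult_indicator)
    also have "\<dots> \<le> (\<integral>\<^sup>+y\<in>K. ennreal (q y powr p) / epowr (r y) (p - \<alpha>) \<partial>lebesgue)"
    proof (rule nn_integral_mono)
      fix y
      show "\<infinity> * indicator ?N y \<le> ennreal (q y powr p) / epowr (r y) (p - \<alpha>) * indicator K y"
      proof (cases "y \<in> ?N")
        case True
        then have "ennreal (q y powr p) \<noteq> 0" using q0[of y] by simp
        then show ?thesis using True \<open>b > 0\<close> b
          by (simp add: epowr_def ennreal_divide_zero)
      qed simp
    qed
    also have "\<dots> < \<infinity>" by (rule ii1[OF K(1,2)])
    finally have "emeasure lebesgue ?N = 0" by (auto simp: ennreal_top_mult split: if_splits)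
    then have "AE y in lebesgue. y \<notin> ?N" using N by (intro AE_not_in) (auto simp: null_sets_def)
    then show ?thesis
    proof eventually_elim
      case (elim y)
      then show ?case using C(2)[of y] by auto
    qed
  qed auto
  \<comment> \<open>The shift by 2 keeps every parameter strictly between 0 and 1, as
    \<open>squash\<close> requires.\<close>
  define E where "E n = 1 / real (n + 2)" for n
  have E: "0 < E n" "E n < 1" for n by (auto simp: E_def)
  have E0: "E \<longlonglongrightarrow> 0" unfolding E_def by (rule LIMSEQ_ignore_initial_segment[OF lim_const_over_n])
  define F where "F n t = squash (E n) t powr (- b)" for n t
  \<comment> \<open>The derivative of \<open>F n\<close> without its factor -b, which makes
    \<open>V n\<close> nonnegative whatever the sign of b.\<close>
  define V where "V n t = squash (E n) t powr (- b - 1) * squash' (E n) t" for n t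
  define M where "M n = E n powr (- \<bar>- b\<bar>) + \<bar>b\<bar> * E n powr (- \<bar>- b - 1\<bar>)" for n
  have V0: "0 \<le> V n t" "V n t \<le> E n powr (- \<bar>- b - 1\<bar>)" if "t \<ge> 0" for n t
  proof -
    show "0 \<le> V n t" using squash'_bounds[OF E that] by (simp add: V_def)
    have "V n t \<le> E n powr (- \<bar>- b - 1\<bar>) * 1"
      unfolding V_def using squash'_bounds[OF E that] squash_powr_bounded[OF E that] by (intro mult_mono) auto
    then show "V n t \<le> E n powr (- \<bar>- b - 1\<bar>)" by simp
  qed
  have F0: "0 \<le> F n t" "F n t \<le> E n powr (- \<bar>- b\<bar>)" if "t \<ge> 0" for n t
    using squash_powr_bounded[OF E that, where c = "- b"] by (auto simp: F_def)
  have step1: "0 \<le> b * (LINT y:W|lebesgue. F n (r y) * (A y \<bullet> Dw y) + w y * (- b * V n (r y)) * (A y \<bullet> G y))" for n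
  proof (rule weak_ineq_composed[OF w, where M = "M n"])
    fix t :: real assume t: "t \<ge> 0"
    show "(F n has_real_derivative - b * V n t) (at t)"
      unfolding F_def[abs_def] V_def
      using DERIV_chain2[OF has_real_derivative_powr[OF squash_bounds(3)[OF E t], where r = "- b"] squash_DERIV[OF E t]]
      by (simp add: mult.assoc)
    have "\<bar>- b * V n t\<bar> \<le> \<bar>b\<bar> * E n powr (- \<bar>- b - 1\<bar>)"
      using V0[OF t] by (auto simp: abs_mult intro!: mult_left_mono)
    moreover have "E n powr (- \<bar>- b\<bar>) \<ge> 0" "\<bar>b\<bar> * E n powr (- \<bar>- b - 1\<bar>) \<ge> 0" by auto
    ultimately show "0 \<le> F n t \<and> F n t \<le> M n \<and> \<bar>- b * V n t\<bar> \<le> M n"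
      using F0[OF t, of n] unfolding M_def by linarith
  next
    have cp: "continuous_on {0..} (\<lambda>t. squash (E n) t powr (- b - 1))"
      using squash_bounds(3)[OF E, THEN less_imp_neq]
      by (intro continuous_on_powr squash_continuous E continuous_on_const) (metis atLeast_iff)
    show "continuous_on {0..} (\<lambda>t. - b * V n t)"
      unfolding V_def by (intro continuous_on_mult continuous_on_const cp squash_continuous E)
  qed
  have Fm: "(\<lambda>y. F n (r y)) \<in> borel_measurable (lebesgue_on W)" "(\<lambda>y. V n (r y)) \<in> borel_measurable (lebesgue_on W)" for n
    unfolding F_def V_def squash_def squash'_def by measurable
  note [measurable] = Fm
  define X where "X n y = indicator W y * (F n (r y) * (A y \<bullet> Dw y))" for n y
  define X0 where "X0 y = indicator W y * (r y powr (- b) * (A y \<bullet> Dw y))" for y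
  define Y where "Y n y = indicator W y * (w y * V n (r y) * (A y \<bullet> G y))" for n y
  have "(\<lambda>y. F n (r y) * (A y \<bullet> Dw y)) \<in> borel_measurable (lebesgue_on W)"
    "(\<lambda>y. r y powr (- b) * (A y \<bullet> Dw y)) \<in> borel_measurable (lebesgue_on W)"
    "(\<lambda>y. w y * V n (r y) * (A y \<bullet> G y)) \<in> borel_measurable (lebesgue_on W)" for n
    by measurable
  note Xm' = this[THEN indicator_measurable[OF _ K(1,2)]]
  have Xm: "X n \<in> borel_measurable lebesgue" "X0 \<in> borel_measurable lebesgue" "Y n \<in> borel_measurable lebesgue" for n
    unfolding X_def[abs_def] X0_def[abs_def] Y_def[abs_def] WK by (rule Xm')+
  \<comment> \<open>Since F_n(r) is at most r^(-b) + 1, the factor q^(p-1) is split twice: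
    \<open>young1\<close> yields the summands q^p r^(\<alpha>-p) and r^\<alpha>,
    \<open>young2\<close> the summands q^p and 1. The constants bound A and Dw.\<close>
  define dom where "dom y = C * Cw * (indicator K y * (q y powr p * r y powr (\<alpha> - p)) + indicator K y * r y powr \<alpha> + indicator K y * q y powr p + indicator K y)" for y
  have domi: "integrable lebesgue dom"
    unfolding dom_def[abs_def] using i1 i2 i3 i4 by auto
  \<comment> \<open>Distributes r^(-b) over the two Young factors as (q r^((\<alpha>-p)/p))^(p-1)
    times r^(\<alpha>/p), so that their powers are exactly the two functions in (ii).\<close>
  have young1: "r y powr (- b) * q y powr (p - 1) \<le> q y powr p * r y powr (\<alpha> - p) + r y powr \<alpha>" if "r y > 0" for y
  proof -
    have "(q y * r y powr ((\<alpha> - p) / p)) powr (p - 1) * r y powr (\<alpha> / p)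
      \<le> 1 powr p * (q y * r y powr ((\<alpha> - p) / p)) powr p + 1 powr (p * (1 - p)) * (r y powr (\<alpha> / p)) powr p"
      using q0 by (intro powr_mult_le_add[OF p]) auto
    also have "(q y * r y powr ((\<alpha> - p) / p)) powr p = q y powr p * r y powr (\<alpha> - p)"
      using p q0[of y] by (simp add: powr_mult powr_powr)
    also have "(r y powr (\<alpha> / p)) powr p = r y powr \<alpha>" using p by (simp add: powr_powr)
    also have "(q y * r y powr ((\<alpha> - p) / p)) powr (p - 1) * r y powr (\<alpha> / p)
      = q y powr (p - 1) * r y powr ((\<alpha> - p) / p * (p - 1) + \<alpha> / p)"
      using q0[of y] by (simp add: powr_mult powr_powr powr_add)
    also have "(\<alpha> - p) / p * (p - 1) + \<alpha> / p = - b" unfolding b(1) using p by (simp add: field_simps)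
    finally show ?thesis by (simp add: mult.commute)
  qed
  have young2: "q y powr (p - 1) \<le> q y powr p + 1" for y
    using powr_mult_le_add[OF p q0[of y], of 1 1] by simp
  have pow_le: "\<bar>c * (A y \<bullet> Dw y)\<bar> \<le> C * Cw * (c * q y powr (p - 1))" if "y \<in> K" "c \<ge> 0" for c y
  proof -
    have "\<bar>A y \<bullet> Dw y\<bar> \<le> norm (A y) * norm (Dw y)" by (rule Cauchy_Schwarz_ineq2)
    also have "\<dots> \<le> (C * q y powr (p - 1)) * Cw" using C that Cw by (intro mult_mono) auto
    finally have "c * \<bar>A y \<bullet> Dw y\<bar> \<le> c * ((C * q y powr (p - 1)) * Cw)" using that by (intro mult_left_mono)
    then show ?thesis using that by (simp add: abs_mult mult_ac)
  qed
  \<comment> \<open>At r = 0 the sign of b matters: for b > 0 the power F_n(0) blows up, but A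
    vanishes there almost everywhere; for b < 0 it is at most 1 and tends to 0, in accordance with
    the value of \<open>powr\<close> at 0.\<close>
  have Xdom: "AE y in lebesgue. norm (X n y) \<le> dom y" for n
    using rpos A0
  proof eventually_elim
    case (elim y)
    show ?case
    proof (cases "y \<in> K")
      case True
      consider "r y > 0" | "r y = 0" "b > 0" | "r y = 0" "b < 0" using elim True b by force
      then show ?thesis
      proof cases
        case 1
        have "F n (r y) * q y powr (p - 1) \<le> (r y powr (- b) + 1) * q y powr (p - 1)"
          unfolding F_def using squash_powr_le[OF E less_imp_le[OF 1] 1] by (intro mult_right_mono) auto
        also have "\<dots> \<le> q y powr p * r y powr (\<alpha> - p) + r y powr \<alpha> + q y powr p + 1"
          using young1[OF 1] young2[of y] by (simp add: distrib_right)
        finally have "C * Cw * (F n (r y) * q y powr (p - 1)) \<le> C * Cw * (q y powr p * r y powr (\<alpha> - p) + r y powr \<alpha> + q y powr p + 1)"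
          using C Cw by (intro mult_left_mono) auto
        then show ?thesis using pow_le[OF True F0(1)[of "r y" n]] True K 1 by (auto simp: X_def dom_def)
      next
        case 2
        then have "X n y = 0" using elim True by (simp add: X_def)
        then show ?thesis using C Cw by (auto simp: dom_def)
      next
        case 3
        have "F n (r y) \<le> 1" using 3 E[of n] by (simp add: F_def squash_def powr_le1)
        then have "F n (r y) * q y powr (p - 1) \<le> 1 * q y powr (p - 1)" by (intro mult_right_mono) auto
        also have "\<dots> \<le> q y powr p * r y powr (\<alpha> - p) + r y powr \<alpha> + q y powr p + 1"
        proof -
          have "0 \<le> q y powr p * r y powr (\<alpha> - p)" "0 \<le> r y powr \<alpha>" by simp_all
          then show ?thesis using young2[of y] by linarith
        qed
        finally have "C * Cw * (F n (r y) * q y powr (p - 1)) \<le> C * Cw * (q y powr p * r y powr (\<alpha> - p) + r y powr \<alpha> + q y powr p + 1)"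
          using C Cw by (intro mult_left_mono) auto
        then show ?thesis using pow_le[OF True F0(1)[of "r y" n]] True K 3 by (auto simp: X_def dom_def)
      qed
    next
      case False
      then show ?thesis using Dw0 by (simp add: X_def dom_def)
    qed
  qed
  have Xlim: "AE y in lebesgue. (\<lambda>n. X n y) \<longlonglongrightarrow> X0 y"
    using rpos A0
  proof eventually_elim
    case (elim y)
    show ?case
    proof (cases "y \<in> K")
      case True
      consider "r y > 0" | "r y = 0" "b > 0" | "r y = 0" "b < 0" using elim True b by force
      then show ?thesis
      proof cases
        case 1
        then show ?thesis unfolding X_def X0_def F_def
          by (intro tendsto_intros squash_tendsto E0) auto
      next
        case 2
        then show ?thesis using elim True by (simp add: X_def X0_def)
      next
        case 3
        have "(\<lambda>n. F n (r y)) \<longlonglongrightarrow> 0"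
          unfolding F_def 3 using squash_tendsto[OF E0, of 0] 3
          by (intro tendsto_zero_powrI[where b = "- b"]) (auto simp: squash_def less_imp_le[OF E(1)])
        then have "(\<lambda>n. X n y) \<longlonglongrightarrow> indicator W y * (0 * (A y \<bullet> Dw y))"
          unfolding X_def by (intro tendsto_intros)
        then show ?thesis using 3 by (simp add: X0_def)
      qed
    next
      case False
      then show ?thesis using Dw0 by (simp add: X_def X0_def)
    qed
  qed
  have Xi: "integrable lebesgue (X n)" for n
    by (rule Bochner_Integration.integrable_bound[OF domi Xm(1)])
      (use Xdom[of n] in \<open>auto elim!: eventually_mono\<close>)
  show "integrable lebesgue (\<lambda>y. indicator W y * (r y powr (- b) * (A y \<bullet> Dw y)))"
    unfolding X0_def[symmetric, abs_def]
    by (rule integrable_dominated_convergence[OF Xm(2,1) domi Xlim Xdom])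
  have Xint: "(\<lambda>n. \<integral>y. X n y \<partial>lebesgue) \<longlonglongrightarrow> (\<integral>y. X0 y \<partial>lebesgue)"
    by (rule integral_dominated_convergence[OF Xm(2,1) domi Xlim Xdom])
  have Ynn: "AE y in lebesgue. 0 \<le> Y n y" for n
    using rpos
  proof eventually_elim
    case (elim y)
    then show ?case using K AG[of y] V0[of "r y" n] w(2)[of y] by (cases "y \<in> K") (auto simp: Y_def)
  qed
  \<comment> \<open>The bound on \<open>V n\<close> depends on n. It only serves to split the
    integral in the weak inequality for each fixed n.\<close>
  have Yi: "integrable lebesgue (Y n)" for n
  proof (rule Bochner_Integration.integrable_bound[OF _ Xm(3), where f = "\<lambda>y. Cw * E n powr (- \<bar>- b - 1\<bar>) * C * C * (indicator K y * q y powr p)"])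
    show "AE y in lebesgue. norm (Y n y) \<le> norm (Cw * E n powr (- \<bar>- b - 1\<bar>) * C * C * (indicator K y * q y powr p))"
      using rpos
    proof eventually_elim
      case (elim y)
      show ?case
      proof (cases "y \<in> K")
        case True
        have "\<bar>A y \<bullet> G y\<bar> \<le> norm (A y) * norm (G y)" by (rule Cauchy_Schwarz_ineq2)
        also have "\<dots> \<le> (C * q y powr (p - 1)) * (C * q y)" using C True by (intro mult_mono) auto
        also have "\<dots> = C * C * q y powr p"
          using q0[of y] p by (cases "q y = 0") (auto simp: powr_diff)
        finally have 1: "\<bar>A y \<bullet> G y\<bar> \<le> C * C * q y powr p" .
        have "\<bar>w y\<bar> * \<bar>V n (r y)\<bar> * \<bar>A y \<bullet> G y\<bar> \<le> Cw * E n powr (- \<bar>- b - 1\<bar>) * (C * C * q y powr p)"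
          using elim True V0[of "r y" n] Cw 1 by (intro mult_mono) auto
        then show ?thesis using True K C Cw by (auto simp: Y_def abs_mult mult_ac)
      next
        case False
        then show ?thesis using K by (simp add: Y_def)
      qed
    qed
  qed (use i3 in auto)
  have YX: "(\<integral>y. b\<^sup>2 * Y n y \<partial>lebesgue) \<le> b * (\<integral>y. X n y \<partial>lebesgue)" for n
  proof -
    have "(LINT y:W|lebesgue. F n (r y) * (A y \<bullet> Dw y) + w y * (- b * V n (r y)) * (A y \<bullet> G y))
        = (\<integral>y. X n y - b * Y n y \<partial>lebesgue)"
      unfolding set_lebesgue_integral_def X_def Y_def
      by (intro Bochner_Integration.integral_cong) (auto simp: algebra_simps)
    also have "\<dots> = (\<integral>y. X n y \<partial>lebesgue) - b * (\<integral>y. Y n y \<partial>lebesgue)"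
      using Xi Yi by simp
    finally show ?thesis using step1[of n] by (simp add: right_diff_distrib power2_eq_square mult.assoc)
  qed
  have "0 \<le> b * (\<integral>y. X n y \<partial>lebesgue)" for n
  proof -
    have "0 \<le> (\<integral>y. b\<^sup>2 * Y n y \<partial>lebesgue)"
    proof (rule integral_nonneg_AE)
      show "AE y in lebesgue. 0 \<le> b\<^sup>2 * Y n y"
        using Ynn[of n] by eventually_elim simp
    qed
    with YX[of n] show ?thesis by linarith
  qed
  then have "0 \<le> b * (\<integral>y. X0 y \<partial>lebesgue)"
    by (intro LIMSEQ_le_const[OF tendsto_mult_left[OF Xint]]) auto
  then show "0 \<le> b * (\<integral>y. indicator W y * (r y powr (- b) * (A y \<bullet> Dw y)) \<partial>lebesgue)"
    unfolding X0_def .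
  have "(\<integral>\<^sup>+y. ennreal (b\<^sup>2 * Y n y) \<partial>lebesgue) = ennreal (\<integral>y. b\<^sup>2 * Y n y \<partial>lebesgue)" for n
  proof (rule nn_integral_eq_integral)
    show "AE y in lebesgue. 0 \<le> b\<^sup>2 * Y n y"
      using Ynn[of n] by eventually_elim simp
  qed (use Yi in simp)
  then have Yle: "(\<integral>\<^sup>+y. ennreal (b\<^sup>2 * Y n y) \<partial>lebesgue) \<le> ennreal (b * (\<integral>y. X n y \<partial>lebesgue))" for n
    using YX[of n] by (simp add: ennreal_leI)
  have "(\<integral>\<^sup>+y. ennreal (b\<^sup>2 * (indicator W y * (w y * r y powr (\<alpha> - p) * (A y \<bullet> G y)))) \<partial>lebesgue)
      \<le> (\<integral>\<^sup>+y. liminf (\<lambda>n. ennreal (b\<^sup>2 * Y n y)) \<partial>lebesgue)"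
  proof (rule nn_integral_mono_AE)
    show "AE y in lebesgue. ennreal (b\<^sup>2 * (indicator W y * (w y * r y powr (\<alpha> - p) * (A y \<bullet> G y)))) \<le> liminf (\<lambda>n. ennreal (b\<^sup>2 * Y n y))"
      using rpos
    proof eventually_elim
      case (elim y)
      show ?case
      proof (cases "y \<in> K \<and> r y > 0")
        case True
        have e: "- b - 1 = \<alpha> - p" using b by simp
        have "(\<lambda>n. V n (r y)) \<longlonglongrightarrow> r y powr (- b - 1) * 1"
          unfolding V_def using True by (intro tendsto_intros squash_tendsto E0) auto
        then have "(\<lambda>n. ennreal (b\<^sup>2 * Y n y)) \<longlonglongrightarrow> ennreal (b\<^sup>2 * (indicator W y * (w y * r y powr (\<alpha> - p) * (A y \<bullet> G y))))"
          unfolding Y_def e by (intro tendsto_ennrealI tendsto_intros) simp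
        then show ?thesis by (simp add: lim_imp_Liminf)
      next
        \<comment> \<open>Where r = 0 the real power is 0 by convention, so only points with r > 0
          need the pointwise limit.\<close>
        case False
        then have "b\<^sup>2 * (indicator W y * (w y * r y powr (\<alpha> - p) * (A y \<bullet> G y))) = 0"
          using K(3)[of y] elim by (cases "y \<in> K") auto
        then show ?thesis by (simp only: ennreal_0 zero_le)
      qed
    qed
  qed
  \<comment> \<open>Fatou's lemma.\<close>
  also have "\<dots> \<le> liminf (\<lambda>n. \<integral>\<^sup>+y. ennreal (b\<^sup>2 * Y n y) \<partial>lebesgue)"
    using Xm by (intro nn_integral_liminf) auto
  also have "\<dots> \<le> liminf (\<lambda>n. ennreal (b * (\<integral>y. X n y \<partial>lebesgue)))"
    by (intro Liminf_mono) (use Yle in auto)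
  also have "\<dots> = ennreal (b * (\<integral>y. X0 y \<partial>lebesgue))"
    by (intro lim_imp_Liminf tendsto_ennrealI tendsto_intros Xint) auto
  finally show "(\<integral>\<^sup>+y. ennreal (b\<^sup>2 * (indicator W y * (w y * r y powr (\<alpha> - p) * (A y \<bullet> G y)))) \<partial>lebesgue)
      \<le> ennreal (b * (\<integral>y. indicator W y * (r y powr (- b) * (A y \<bullet> Dw y)) \<partial>lebesgue))"
    unfolding X0_def .
qed

end

text \<open>Along the segment from the identity to \<open>A\<close> every matrix is positive
  definite, hence injective, so the determinant cannot vanish on the way from its value 1. This
  makes the volume density positive.\<close>

lemma det_pos_if_positive_definite:
  fixes A :: "real ^ 'n::finite ^ 'n"
  assumes pd: "\<And>\<xi>. \<xi> \<noteq> 0 \<Longrightarrow> \<xi> \<bullet> (A *v \<xi>) > 0"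
  shows "det A > 0"
proof (rule ccontr)
  assume "\<not> det A > 0"
  define B where "B t = (\<chi> i j. (1 - t) * (mat 1 :: real ^ 'n ^ 'n) $ i $ j + t * A $ i $ j)" for t :: real
  have "continuous_on {0..1} (\<lambda>t. det (B t))"
    unfolding det_def B_def by (auto intro!: continuous_intros)
  moreover have "det (B 0) = 1" "det (B 1) \<le> 0"
  proof -
    have "B 0 = mat 1" "B 1 = A" by (simp_all add: B_def vec_eq_iff)
    then show "det (B 0) = 1" "det (B 1) \<le> 0" using \<open>\<not> det A > 0\<close> by simp_all
  qed
  ultimately obtain t where t: "0 \<le> t" "t \<le> 1" "det (B t) = 0"
    using IVT2'[of "\<lambda>t. det (B t)" 1 0 0] by auto
  then obtain \<xi> where \<xi>: "\<xi> \<noteq> 0" "B t *v \<xi> = 0"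
    using invertible_det_nz[of "B t"] invertible_left_inverse[of "B t"] matrix_left_invertible_ker[of "B t"] by auto
  have "B t *v \<xi> = (1 - t) *\<^sub>R \<xi> + t *\<^sub>R (A *v \<xi>)"
  proof -
    have "B t = (1 - t) *\<^sub>R mat 1 + t *\<^sub>R A" by (simp add: B_def vec_eq_iff)
    then show ?thesis
      by (simp add: matrix_vector_mult_add_rdistrib scaleR_matrix_vector_assoc[symmetric])
  qed
  then have "0 = (1 - t) * (\<xi> \<bullet> \<xi>) + t * (\<xi> \<bullet> (A *v \<xi>))"
    using \<xi> by (metis inner_add_right inner_scaleR_right inner_zero_right)
  moreover have "\<xi> \<bullet> \<xi> > 0" "\<xi> \<bullet> (A *v \<xi>) > 0" using \<xi> pd by auto
  ultimately show False using t
    by (smt (verit) mult_nonneg_nonneg mult_pos_pos)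
qed

section \<open>Riemannian metrics in coordinates\<close>

locale riem_mfd =
  fixes M :: "('m::{t2_space, second_countable_topology}, 'n::finite) rmanifold"
  assumes riem: "riemannian_manifold M"
begin

lemma atlas: "smooth_atlas (charts M)"
  using riem by (simp add: riemannian_manifold_def)

lemma chart_exists: obtains c where "c \<in> charts_at M x"
proof -
  have "x \<in> (\<Union>c\<in>charts M. fst c)" using atlas by (simp add: smooth_atlas_def)
  then show ?thesis using that by (elim UN_E) (simp add: charts_at_def)
qed

lemma chart_open: "c \<in> charts M \<Longrightarrow> open (fst c)" "c \<in> charts M \<Longrightarrow> open (snd c ` fst c)"
  using atlas by (auto simp: smooth_atlas_def)

lemma chart_homeomorphism:
  "c \<in> charts M \<Longrightarrow> homeomorphism (fst c) (snd c ` fst c) (snd c) (chart_inv c)"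
  using atlas by (auto simp: smooth_atlas_def)

lemma chart_inv_chart: "c \<in> charts M \<Longrightarrow> x \<in> fst c \<Longrightarrow> chart_inv c (snd c x) = x"
  using chart_homeomorphism by (simp add: homeomorphism_def)

lemma chart_chart_inv: "c \<in> charts M \<Longrightarrow> y \<in> snd c ` fst c \<Longrightarrow> snd c (chart_inv c y) = y"
  by (erule imageE) (simp add: chart_inv_chart)

lemma chart_inv_in: "c \<in> charts M \<Longrightarrow> y \<in> snd c ` fst c \<Longrightarrow> chart_inv c y \<in> fst c"
  by (erule imageE) (simp add: chart_inv_chart)

lemma chart_continuous: "c \<in> charts M \<Longrightarrow> continuous_on (fst c) (snd c)"
  "c \<in> charts M \<Longrightarrow> continuous_on (snd c ` fst c) (chart_inv c)"
  using chart_homeomorphism by (simp_all add: homeomorphism_def)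

lemma chart_image_eq:
  assumes "c \<in> charts M" shows "snd c ` (fst c \<inter> S) = (snd c ` fst c) \<inter> chart_inv c -` S"
  using chart_inv_chart[OF assms] by (auto simp: image_iff)

lemma chart_image_open:
  assumes "c \<in> charts M" "open S" shows "open (snd c ` (fst c \<inter> S))"
  unfolding chart_image_eq[OF assms(1)]
  by (rule continuous_open_preimage[OF chart_continuous(2) chart_open(2)]) (use assms in auto)

lemma transition_smooth:
  "c \<in> charts M \<Longrightarrow> c' \<in> charts M \<Longrightarrow> smooth_on (snd c ` (fst c \<inter> fst c')) (transition c c')"
  using atlas by (auto simp: smooth_atlas_def)

lemma transition_apply:
  "c \<in> charts M \<Longrightarrow> x \<in> fst c \<Longrightarrow> transition c c' (snd c x) = snd c' x"
  by (simp add: transition_def chart_inv_chart)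

definition tder where "tder c c' x = frechet_derivative (transition c c') (at (snd c x))"

lemma transition_has_derivative:
  assumes "c \<in> charts_at M x" "c' \<in> charts_at M x"
  shows "(transition c c' has_derivative tder c c' x) (at (snd c x))"
proof -
  have "Ck_on 1 (snd c ` (fst c \<inter> fst c')) (transition c c')"
    using transition_smooth[of c c'] assms unfolding charts_at_def smooth_on_def by blast
  moreover have "snd c x \<in> snd c ` (fst c \<inter> fst c')" using assms by (auto simp: charts_at_def)
  ultimately show ?thesis
    unfolding tder_def frechet_derivative_works[symmetric] One_nat_def Ck_on.simps by blast
qed

lemma tder_linear:
  assumes "c \<in> charts_at M x" "c' \<in> charts_at M x"
  shows "bounded_linear (tder c c' x)"
  using transition_has_derivative[OF assms] by (rule has_derivative_bounded_linear)

lemma chart_change_has_derivative: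
  assumes c: "c \<in> charts_at M x" "c' \<in> charts_at M x"
    and f: "(f \<circ> chart_inv c' has_derivative D) (at (snd c' x))"
  shows "(f \<circ> chart_inv c has_derivative D \<circ> tder c c' x) (at (snd c x))"
proof (rule has_derivative_transform_within_open)
  have cM: "c \<in> charts M" "c' \<in> charts M" "x \<in> fst c" "x \<in> fst c'" using c by (auto simp: charts_at_def)
  show "((f \<circ> chart_inv c') \<circ> transition c c' has_derivative D \<circ> tder c c' x) (at (snd c x))"
    by (rule diff_chain_at[OF transition_has_derivative[OF c]]) (use f cM in \<open>simp add: transition_apply\<close>)
  show "open (snd c ` (fst c \<inter> fst c'))" using cM by (intro chart_image_open chart_open)
  show "snd c x \<in> snd c ` (fst c \<inter> fst c')" using cM by auto
  fix y assume "y \<in> snd c ` (fst c \<inter> fst c')"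
  then obtain z where z: "z \<in> fst c" "z \<in> fst c'" "y = snd c z" by auto
  then show "((f \<circ> chart_inv c') \<circ> transition c c') y = (f \<circ> chart_inv c) y"
    using cM by (simp add: transition_apply chart_inv_chart)
qed

lemma tder_chain:
  assumes c: "c \<in> charts_at M x" "c' \<in> charts_at M x" "c'' \<in> charts_at M x"
  shows "tder c c'' x v = tder c' c'' x (tder c c' x v)"
proof -
  have "(snd c'' \<circ> chart_inv c' has_derivative tder c' c'' x) (at (snd c' x))"
    using transition_has_derivative[OF c(2,3)] by (simp add: transition_def)
  from chart_change_has_derivative[OF c(1,2) this] transition_has_derivative[OF c(1,3)]
  have "tder c' c'' x \<circ> tder c c' x = tder c c'' x"
    unfolding transition_def by (rule has_derivative_unique)
  then show ?thesis by (metis comp_apply)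
qed

lemma tder_id:
  assumes c: "c \<in> charts_at M x" shows "tder c c x v = v"
proof -
  have "((\<lambda>y. y) has_derivative (\<lambda>v. v)) (at (snd c x))" by (rule has_derivative_ident)
  then have "(transition c c has_derivative (\<lambda>v. v)) (at (snd c x))"
    by (rule has_derivative_transform_within_open[of _ _ _ _ "snd c ` fst c"])
      (use c chart_open(2) in \<open>auto simp: charts_at_def transition_apply\<close>)
  from has_derivative_unique[OF this transition_has_derivative[OF c c]] show ?thesis by metis
qed

text \<open>The tangent vector with coordinates \<xi> in the chart \<open>c\<close>: its entries in
  the other charts are forced by the differentials of the transition maps, and 0 off
  \<open>charts_at\<close> is the normalisation of the representation.\<close>

definition tvec_of where
  "tvec_of c x \<xi> = (\<lambda>c'. if c' \<in> charts_at M x then tder c c' x \<xi> else 0)"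

lemma tvec_of_in:
  assumes c: "c \<in> charts_at M x"
  shows "tvec_of c x \<xi> \<in> tangent_space M x"
  unfolding tangent_space_def mem_Collect_eq tder_def[symmetric]
proof (intro conjI ballI allI impI)
  fix c1 c2 assume "c1 \<in> charts_at M x" "c2 \<in> charts_at M x"
  with tder_chain[OF c this, of \<xi>] show "tvec_of c x \<xi> c2 = tder c1 c2 x (tvec_of c x \<xi> c1)"
    by (simp only: tvec_of_def if_True)
qed (simp add: tvec_of_def)

lemma tangent_apply:
  assumes "v \<in> tangent_space M x" "c \<in> charts_at M x" "c' \<in> charts_at M x"
  shows "v c' = tder c c' x (v c)"
  using assms unfolding tangent_space_def mem_Collect_eq tder_def by blast

lemma tvec_of_apply: "c \<in> charts_at M x \<Longrightarrow> tvec_of c x \<xi> c = \<xi>"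
  by (simp add: tvec_of_def tder_id)

lemma tvec_of_eq:
  assumes c: "c \<in> charts_at M x" and v: "v \<in> tangent_space M x"
  shows "tvec_of c x (v c) = v"
proof
  fix c'
  show "tvec_of c x (v c) c' = v c'"
  proof (cases "c' \<in> charts_at M x")
    case True
    then show ?thesis using tangent_apply[OF v c True] by (simp only: tvec_of_def if_True)
  next
    case False
    moreover have "v c' = 0" using False v unfolding tangent_space_def by blast
    ultimately show ?thesis by (simp only: tvec_of_def if_False)
  qed
qed

lemma coord_vec_eq: "coord_vec M c i x = tvec_of c x (axis i 1)"
  unfolding coord_vec_def tvec_of_def tder_def ..

lemma tvec_of_lin:
  assumes c: "c \<in> charts_at M x"
  shows "tvec_of c x (a *\<^sub>R \<xi> + b *\<^sub>R \<eta>) = (\<lambda>c'. a *\<^sub>R tvec_of c x \<xi> c' + b *\<^sub>R tvec_of c x \<eta> c')"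
  using tder_linear[OF c] by (auto simp: tvec_of_def fun_eq_iff linear_simps)

lemma metric_sym: "u \<in> tangent_space M x \<Longrightarrow> v \<in> tangent_space M x \<Longrightarrow> metric M x u v = metric M x v u"
  using riem unfolding riemannian_manifold_def by blast

lemma metric_lin:
  "u \<in> tangent_space M x \<Longrightarrow> v \<in> tangent_space M x \<Longrightarrow> w \<in> tangent_space M x \<Longrightarrow>
    metric M x (\<lambda>c. a *\<^sub>R u c + b *\<^sub>R v c) w = a * metric M x u w + b * metric M x v w"
  using riem unfolding riemannian_manifold_def by blast

lemma metric_pos: "u \<in> tangent_space M x \<Longrightarrow> u \<noteq> (\<lambda>_. 0) \<Longrightarrow> metric M x u u > 0"
  using riem unfolding riemannian_manifold_def by blast

lemma metric_tvec_linear: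
  assumes c: "c \<in> charts_at M x" and w: "w \<in> tangent_space M x"
  shows "linear (\<lambda>\<xi>. metric M x (tvec_of c x \<xi>) w)"
proof (rule linearI)
  fix \<xi> \<eta> show "metric M x (tvec_of c x (\<xi> + \<eta>)) w = metric M x (tvec_of c x \<xi>) w + metric M x (tvec_of c x \<eta>) w"
    using tvec_of_lin[OF c, of 1 \<xi> 1 \<eta>] metric_lin[OF tvec_of_in[OF c] tvec_of_in[OF c] w, of 1 \<xi> 1 \<eta>] by simp
next
  fix a \<xi> show "metric M x (tvec_of c x (a *\<^sub>R \<xi>)) w = a *\<^sub>R metric M x (tvec_of c x \<xi>) w"
    using tvec_of_lin[OF c, of a \<xi> 0 0] metric_lin[OF tvec_of_in[OF c] tvec_of_in[OF c] w, of a \<xi> 0 0] by simp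
qed

lemma metric_tvec_basis:
  assumes c: "c \<in> charts_at M x" and w: "w \<in> tangent_space M x"
  shows "metric M x (tvec_of c x \<xi>) w = (\<Sum>i\<in>UNIV. \<xi> $ i * metric M x (coord_vec M c i x) w)"
proof -
  interpret linear "\<lambda>\<xi>. metric M x (tvec_of c x \<xi>) w" by (rule metric_tvec_linear[OF assms])
  have "metric M x (tvec_of c x \<xi>) w = metric M x (tvec_of c x (\<Sum>i\<in>UNIV. \<xi> $ i *\<^sub>R axis i 1)) w"
    using basis_expansion[of \<xi>] by (simp add: scalar_mult_eq_scaleR)
  also have "\<dots> = (\<Sum>i\<in>UNIV. \<xi> $ i * metric M x (coord_vec M c i x) w)"
    by (simp only: sum scale) (simp add: coord_vec_eq)
  finally show ?thesis .
qed

abbreviation "gm c y \<equiv> metric_coeff M c y"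

lemma gm_eq:
  assumes c: "c \<in> charts_at M x"
  shows "gm c (snd c x) $ i $ j = metric M x (coord_vec M c i x) (coord_vec M c j x)"
  using c by (simp add: metric_coeff_def chart_inv_chart charts_at_def)

lemma coord_vec_in: "c \<in> charts_at M x \<Longrightarrow> coord_vec M c i x \<in> tangent_space M x"
  by (simp add: coord_vec_eq tvec_of_in)

lemma metric_coord_vec:
  assumes c: "c \<in> charts_at M x" and v: "v \<in> tangent_space M x"
  shows "metric M x v (coord_vec M c i x) = (gm c (snd c x) *v v c) $ i"
proof -
  have "metric M x v (coord_vec M c i x) = (\<Sum>j\<in>UNIV. v c $ j * metric M x (coord_vec M c j x) (coord_vec M c i x))"
    using metric_tvec_basis[OF c coord_vec_in[OF c], of "v c" i] tvec_of_eq[OF c v] by simp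
  also have "\<dots> = (\<Sum>j\<in>UNIV. gm c (snd c x) $ i $ j * v c $ j)"
    using gm_eq[OF c] metric_sym[OF coord_vec_in[OF c] coord_vec_in[OF c]] by (auto intro!: sum.cong)
  finally show ?thesis by (simp add: matrix_vector_mult_def)
qed

lemma metric_coords:
  assumes c: "c \<in> charts_at M x" and v: "v \<in> tangent_space M x" and w: "w \<in> tangent_space M x"
  shows "metric M x v w = v c \<bullet> (gm c (snd c x) *v w c)"
proof -
  have "metric M x v w = (\<Sum>i\<in>UNIV. v c $ i * metric M x (coord_vec M c i x) w)"
    using metric_tvec_basis[OF c w, of "v c"] tvec_of_eq[OF c v] by simp
  also have "\<dots> = (\<Sum>i\<in>UNIV. v c $ i * (gm c (snd c x) *v w c) $ i)"
    using metric_coord_vec[OF c w] metric_sym[OF coord_vec_in[OF c] w] by simp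
  finally show ?thesis by (simp add: inner_vec_def)
qed

lemma gm_positive_definite:
  assumes c: "c \<in> charts M" "y \<in> snd c ` fst c" and "\<xi> \<noteq> 0"
  shows "\<xi> \<bullet> (gm c y *v \<xi>) > 0"
proof -
  obtain x where x: "x \<in> fst c" "y = snd c x" using c by auto
  have cx: "c \<in> charts_at M x" using c x by (simp add: charts_at_def)
  have "tvec_of c x \<xi> \<noteq> (\<lambda>_. 0)" using tvec_of_apply[OF cx, of \<xi>] \<open>\<xi> \<noteq> 0\<close> by metis
  from metric_pos[OF tvec_of_in[OF cx] this] show ?thesis
    using metric_coords[OF cx tvec_of_in[OF cx] tvec_of_in[OF cx], of \<xi> \<xi>] x tvec_of_apply[OF cx] by simp
qed

lemma gm_det_pos: "c \<in> charts M \<Longrightarrow> y \<in> snd c ` fst c \<Longrightarrow> det (gm c y) > 0"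
  by (rule det_pos_if_positive_definite) (rule gm_positive_definite)

lemma gm_continuous: "c \<in> charts M \<Longrightarrow> continuous_on (snd c ` fst c) (\<lambda>y. gm c y $ i $ j)"
proof -
  assume "c \<in> charts M"
  then have "smooth_on (snd c ` fst c) (\<lambda>y. gm c y $ i $ j)"
    using riem unfolding riemannian_manifold_def by blast
  then show ?thesis unfolding smooth_on_def by (metis Ck_on.simps(1))
qed

lemma metric_nonneg: "v \<in> tangent_space M x \<Longrightarrow> metric M x v v \<ge> 0"
proof -
  assume v: "v \<in> tangent_space M x"
  obtain c where c: "c \<in> charts_at M x" by (rule chart_exists)
  show ?thesis
  proof (cases "v = (\<lambda>_. 0)")
    case True
    then show ?thesis using metric_coords[OF c v v] by simp
  next
    case False
    then show ?thesis using metric_pos[OF v] by simp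
  qed
qed

lemma tnorm_square: "v \<in> tangent_space M x \<Longrightarrow> (tnorm M x v)\<^sup>2 = metric M x v v"
  by (simp add: tnorm_def metric_nonneg)

text \<open>With a = g(w, w) and b = g(v, w), the vector a v - b w has squared length a (a g(v, v) -
  b^2), which must be nonnegative.\<close>

lemma metric_Cauchy_Schwarz:
  assumes v: "v \<in> tangent_space M x" and w: "w \<in> tangent_space M x"
  shows "\<bar>metric M x v w\<bar> \<le> tnorm M x v * tnorm M x w"
proof (cases "w = (\<lambda>_. 0)")
  case True
  obtain c where c: "c \<in> charts_at M x" by (rule chart_exists)
  then show ?thesis using True metric_coords[OF c v w] metric_coords[OF c w w] by (simp add: tnorm_def)
next
  case False
  obtain c where c: "c \<in> charts_at M x" by (rule chart_exists)
  define a where "a = metric M x w w"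
  define b where "b = metric M x v w"
  have a: "a > 0" using metric_pos[OF w False] by (simp add: a_def)
  define u where "u = tvec_of c x (a *\<^sub>R v c + (- b) *\<^sub>R w c)"
  have u: "u \<in> tangent_space M x" unfolding u_def by (rule tvec_of_in[OF c])
  have ue: "u = (\<lambda>c'. a *\<^sub>R v c' + (- b) *\<^sub>R w c')"
    unfolding u_def tvec_of_lin[OF c] tvec_of_eq[OF c v] tvec_of_eq[OF c w] ..
  have "metric M x u z = a * metric M x v z + (- b) * metric M x w z" if "z \<in> tangent_space M x" for z
    unfolding ue by (rule metric_lin[OF v w that])
  note uz = this
  have uu: "metric M x u u = a * metric M x v u - b * metric M x w u" using uz[OF u] by simp
  have "metric M x v u = a * metric M x v v - b * b"
    using uz[OF v] metric_sym[OF v u] metric_sym[OF w v] by (simp add: b_def)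
  moreover have "metric M x w u = a * b - b * a"
    using uz[OF w] metric_sym[OF w u] by (simp add: a_def b_def)
  ultimately have "metric M x u u = a * (a * metric M x v v - b * b)" using uu by simp
  then have "0 \<le> a * (a * metric M x v v - b * b)" using metric_nonneg[OF u] by simp
  then have "b\<^sup>2 \<le> (tnorm M x v * tnorm M x w)\<^sup>2"
    using a unfolding power_mult_distrib tnorm_square[OF v] tnorm_square[OF w]
    by (simp add: zero_le_mult_iff a_def power2_eq_square mult.commute)
  then have "\<bar>b\<bar> \<le> \<bar>tnorm M x v * tnorm M x w\<bar>" by (simp add: abs_le_square_iff)
  then show ?thesis by (simp add: b_def abs_mult tnorm_def metric_nonneg v w)
qed

text \<open>Makes the definite description in \<open>grad\<close> usable. Existence: the matrix of
  the metric has nonzero determinant, so the differential is represented by a vector. Uniqueness: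
  the difference of two representing vectors has length 0.\<close>

lemma grad_spec:
  assumes c0: "c0 \<in> charts_at M x" and f: "(f \<circ> chart_inv c0) differentiable (at (snd c0 x))"
  shows "grad M f x \<in> tangent_space M x"
    and "\<And>c v. c \<in> charts_at M x \<Longrightarrow> v \<in> tangent_space M x \<Longrightarrow>
      metric M x (grad M f x) v = frechet_derivative (f \<circ> chart_inv c) (at (snd c x)) (v c)"
proof -
  define D where "D = frechet_derivative (f \<circ> chart_inv c0) (at (snd c0 x))"
  have D: "(f \<circ> chart_inv c0 has_derivative D) (at (snd c0 x))"
    using f unfolding D_def frechet_derivative_works .
  \<comment> \<open>The differential evaluated on a tangent vector does not depend on the chart, so
    solving the linear system in one chart serves all of them.\<close>
  have dc: "frechet_derivative (f \<circ> chart_inv c) (at (snd c x)) (v c) = D (v c0)"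
    if "c \<in> charts_at M x" "v \<in> tangent_space M x" for c v
  proof -
    have "frechet_derivative (f \<circ> chart_inv c) (at (snd c x)) = D \<circ> tder c c0 x"
      using frechet_derivative_at[OF chart_change_has_derivative[OF that(1) c0 D]] by simp
    moreover have "tder c c0 x (v c) = v c0"
      using tangent_apply[OF that(2,1) c0] by (rule sym)
    ultimately show ?thesis by simp
  qed
  define g where "g = gm c0 (snd c0 x)"
  have cM: "c0 \<in> charts M" "snd c0 x \<in> snd c0 ` fst c0" using c0 by (auto simp: charts_at_def)
  have "det g \<noteq> 0" using gm_det_pos[OF cM] by (simp add: g_def)
  then have "\<exists>\<xi>. g *v \<xi> = (\<chi> i. D (axis i 1))"
    using cramer[of g] by blast
  then obtain \<xi> where \<xi>: "g *v \<xi> = (\<chi> i. D (axis i 1))" by blast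
  have Dv: "D v = (\<chi> i. D (axis i 1)) \<bullet> v" for v
  proof -
    interpret bounded_linear D using D by (rule has_derivative_bounded_linear)
    have "D v = D (\<Sum>i\<in>UNIV. v $ i *\<^sub>R axis i 1)" using basis_expansion[of v] by (simp add: scalar_mult_eq_scaleR)
    then show ?thesis by (simp only: sum scaleR) (simp add: inner_vec_def mult.commute)
  qed
  define X where "X = tvec_of c0 x \<xi>"
  have X: "X \<in> tangent_space M x" unfolding X_def by (rule tvec_of_in[OF c0])
  have mX: "metric M x X v = D (v c0)" if v: "v \<in> tangent_space M x" for v
  proof -
    have "metric M x X v = metric M x v X" by (rule metric_sym[OF X v])
    also have "\<dots> = v c0 \<bullet> (g *v \<xi>)"
      using metric_coords[OF c0 v X] tvec_of_apply[OF c0] by (simp add: X_def g_def)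
    also have "\<dots> = D (v c0)" unfolding \<xi> Dv[of "v c0"] by (rule inner_commute)
    finally show ?thesis .
  qed
  have uniq: "Y = X" if Y: "Y \<in> tangent_space M x" "\<And>v. v \<in> tangent_space M x \<Longrightarrow> metric M x Y v = D (v c0)" for Y
  proof (rule ccontr)
    assume "Y \<noteq> X"
    define Z where "Z = tvec_of c0 x (1 *\<^sub>R Y c0 + (- 1) *\<^sub>R X c0)"
    have Ze: "Z = (\<lambda>c'. 1 *\<^sub>R Y c' + (- 1) *\<^sub>R X c')"
      unfolding Z_def tvec_of_lin[OF c0] tvec_of_eq[OF c0 Y(1)] tvec_of_eq[OF c0 X] ..
    have Z: "Z \<in> tangent_space M x" unfolding Z_def by (rule tvec_of_in[OF c0])
    have "Z \<noteq> (\<lambda>_. 0)" using \<open>Y \<noteq> X\<close> by (auto simp: Ze fun_eq_iff)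
    then have "metric M x Z Z > 0" by (rule metric_pos[OF Z])
    moreover have "metric M x Z Z = 1 * metric M x Y Z + (- 1) * metric M x X Z"
      by (subst (1) Ze) (rule metric_lin[OF Y(1) X Z])
    ultimately show False using Y(2)[OF Z] mX[OF Z] by simp
  qed
  have g: "grad M f x = X"
    unfolding grad_def
  proof (rule the_equality)
    show "X \<in> tangent_space M x \<and> (\<forall>c\<in>charts_at M x. \<forall>v\<in>tangent_space M x.
        metric M x X v = frechet_derivative (f \<circ> chart_inv c) (at (snd c x)) (v c))"
      using X mX dc by simp
    fix Y assume "Y \<in> tangent_space M x \<and> (\<forall>c\<in>charts_at M x. \<forall>v\<in>tangent_space M x.
        metric M x Y v = frechet_derivative (f \<circ> chart_inv c) (at (snd c x)) (v c))"
    then show "Y = X" using dc[OF c0] c0 by (intro uniq) simp_all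
  qed
  show "grad M f x \<in> tangent_space M x" using g X by simp
  show "metric M x (grad M f x) v = frechet_derivative (f \<circ> chart_inv c) (at (snd c x)) (v c)"
    if "c \<in> charts_at M x" "v \<in> tangent_space M x" for c v
    using g mX dc that by simp
qed

end

section \<open>The Riemannian volume in a chart\<close>

locale riem_vol = riem_mfd M for M :: "('m::{t2_space, second_countable_topology}, 'n::finite) rmanifold" +
  fixes vol :: "'m measure"
  assumes vol: "riemannian_volume M vol"
begin

definition dens where "dens c y = sqrt (det (gm c y))"

lemma dens_pos: "c \<in> charts M \<Longrightarrow> y \<in> snd c ` fst c \<Longrightarrow> dens c y > 0"
  by (simp add: dens_def gm_det_pos)

lemma dens_continuous: "c \<in> charts M \<Longrightarrow> continuous_on (snd c ` fst c) (dens c)"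
  unfolding dens_def[abs_def] det_def by (intro continuous_intros gm_continuous)

lemma sets_vol_iff: "B \<in> sets vol \<longleftrightarrow> (\<forall>c\<in>charts M. snd c ` (B \<inter> fst c) \<in> sets lebesgue)"
  using vol by (simp add: riemannian_volume_def)

lemma sets_vol_open: "open B \<Longrightarrow> B \<in> sets vol"
  unfolding sets_vol_iff using chart_image_open by (simp add: Int_commute)

lemma space_vol [simp]: "space vol = UNIV"
  using sets.sets_into_space[OF sets_vol_open[OF open_UNIV]] by auto

lemma sets_vol_closed: "closed B \<Longrightarrow> B \<in> sets vol"
  using sets.compl_sets[OF sets_vol_open[of "- B"]] by (simp add: Diff_eq open_Compl)

lemma continuous_measurable_vol:
  fixes f :: "'m \<Rightarrow> real"
  assumes "continuous_on UNIV f" shows "f \<in> borel_measurable vol"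
  by (rule borel_measurableI) (use assms in \<open>auto intro: sets_vol_open open_vimage\<close>)

lemma chart_image_sets:
  "c \<in> charts M \<Longrightarrow> B \<in> sets vol \<Longrightarrow> snd c ` (fst c \<inter> B) \<in> sets lebesgue"
  using sets_vol_iff[of B] by (simp add: Int_commute)

text \<open>Membership in \<open>sets vol\<close> is tested in every chart. A transition map is
  differentiable between spaces of equal dimension and therefore maps Lebesgue sets to Lebesgue
  sets.\<close>

lemma chart_inv_image_sets:
  assumes c: "c \<in> charts M" and S: "S \<in> sets lebesgue" "S \<subseteq> snd c ` fst c"
  shows "chart_inv c ` S \<in> sets vol"
  unfolding sets_vol_iff
proof
  fix c' assume c': "c' \<in> charts M"
  have "snd c' ` (chart_inv c ` S \<inter> fst c') = transition c c' ` (S \<inter> snd c ` (fst c \<inter> fst c'))"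
  proof (intro set_eqI iffI)
    fix z assume "z \<in> snd c' ` (chart_inv c ` S \<inter> fst c')"
    then obtain y where y: "y \<in> S" "chart_inv c y \<in> fst c'" "z = snd c' (chart_inv c y)" by blast
    have "y \<in> snd c ` fst c" using y S by blast
    then have "y = snd c (chart_inv c y)" "chart_inv c y \<in> fst c"
      using chart_chart_inv[OF c] chart_inv_in[OF c] by simp_all
    then show "z \<in> transition c c' ` (S \<inter> snd c ` (fst c \<inter> fst c'))"
      using y by (intro image_eqI[of _ _ y]) (auto simp: transition_def)
  next
    fix z assume "z \<in> transition c c' ` (S \<inter> snd c ` (fst c \<inter> fst c'))"
    then obtain x where x: "x \<in> fst c" "x \<in> fst c'" "snd c x \<in> S" "z = transition c c' (snd c x)" by blast
    then show "z \<in> snd c' ` (chart_inv c ` S \<inter> fst c')"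
      using chart_inv_chart[OF c x(1)] by (intro image_eqI[of _ _ x]) (auto simp: transition_apply[OF c] intro!: image_eqI[of _ _ "snd c x"])
  qed
  also have "\<dots> \<in> sets lebesgue"
  proof (rule differentiable_image_in_sets_lebesgue)
    have "open (snd c ` (fst c \<inter> fst c'))" using c c' by (intro chart_image_open chart_open)
    then show "S \<inter> snd c ` (fst c \<inter> fst c') \<in> sets lebesgue" using S(1) by (intro sets.Int) auto
    show "transition c c' differentiable_on S \<inter> snd c ` (fst c \<inter> fst c')"
      unfolding differentiable_on_def
    proof
      fix y assume "y \<in> S \<inter> snd c ` (fst c \<inter> fst c')"
      then obtain x where x: "x \<in> fst c" "x \<in> fst c'" "y = snd c x" by blast
      have "(transition c c' has_derivative tder c c' x) (at (snd c x))"
        using x c c' by (intro transition_has_derivative) (simp_all add: charts_at_def)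
      then show "transition c c' differentiable at y within S \<inter> snd c ` (fst c \<inter> fst c')"
        unfolding x(3) by (meson differentiable_def has_derivative_at_withinI)
    qed
  qed simp
  finally show "snd c' ` (chart_inv c ` S \<inter> fst c') \<in> sets lebesgue" .
qed

context
  fixes c :: "('m, 'n) chart" and \<Omega> :: "'m set"
  assumes c: "c \<in> charts M" and \<Omega>: "open \<Omega>"
begin

abbreviation (input) "W \<equiv> snd c ` (fst c \<inter> \<Omega>)"

lemma W_open: "open W" by (rule chart_image_open[OF c \<Omega>])

lemma W_lebesgue: "W \<in> sets lebesgue" using W_open by auto

lemma chart_inv_W: "y \<in> W \<Longrightarrow> chart_inv c y \<in> fst c \<inter> \<Omega>" "y \<in> W \<Longrightarrow> snd c (chart_inv c y) = y"
  "y \<in> W \<Longrightarrow> y \<in> snd c ` fst c"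
  using chart_inv_chart[OF c] by auto

lemma chart_inv_measurable: "chart_inv c \<in> measurable (lebesgue_on W) (restrict_space vol (fst c \<inter> \<Omega>))"
proof (rule measurable_restrict_space2)
  show "chart_inv c \<in> space (lebesgue_on W) \<rightarrow> fst c \<inter> \<Omega>"
    using chart_inv_W by auto
  show "chart_inv c \<in> measurable (lebesgue_on W) vol"
  proof (rule measurableI)
    fix B assume B: "B \<in> sets vol"
    have "chart_inv c -` B \<inter> space (lebesgue_on W) = W \<inter> snd c ` (fst c \<inter> B)"
      using chart_inv_W chart_inv_chart[OF c] by (auto simp: space_restrict_space)
    also have "\<dots> \<in> sets (lebesgue_on W)"
      using W_lebesgue chart_image_sets[OF c B] by (auto simp: sets_restrict_space)
    finally show "chart_inv c -` B \<inter> space (lebesgue_on W) \<in> sets (lebesgue_on W)" .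
  qed simp
qed

lemma chart_measurable: "snd c \<in> measurable (restrict_space vol (fst c \<inter> \<Omega>)) (lebesgue_on W)"
proof (rule measurable_restrict_space2)
  show "snd c \<in> space (restrict_space vol (fst c \<inter> \<Omega>)) \<rightarrow> W" by (auto simp: space_restrict_space)
  show "snd c \<in> measurable (restrict_space vol (fst c \<inter> \<Omega>)) lebesgue"
  proof (rule measurableI)
    fix S :: "(real ^ 'n) set" assume S: "S \<in> sets lebesgue"
    have "snd c -` S \<inter> space (restrict_space vol (fst c \<inter> \<Omega>)) = (fst c \<inter> \<Omega>) \<inter> chart_inv c ` (S \<inter> W)"
    proof (intro set_eqI iffI)
      fix x assume x: "x \<in> snd c -` S \<inter> space (restrict_space vol (fst c \<inter> \<Omega>))"
      then have "snd c x \<in> S \<inter> W" "x = chart_inv c (snd c x)"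
        using chart_inv_chart[OF c] by (auto simp: space_restrict_space)
      then show "x \<in> (fst c \<inter> \<Omega>) \<inter> chart_inv c ` (S \<inter> W)" using x by (auto simp: space_restrict_space)
    next
      fix x assume "x \<in> (fst c \<inter> \<Omega>) \<inter> chart_inv c ` (S \<inter> W)"
      then show "x \<in> snd c -` S \<inter> space (restrict_space vol (fst c \<inter> \<Omega>))"
        using chart_inv_W(2) by (auto simp: space_restrict_space)
    qed
    also have "\<dots> \<in> sets (restrict_space vol (fst c \<inter> \<Omega>))"
      using S W_lebesgue chart_inv_image_sets[OF c, of "S \<inter> W"] by (auto simp: sets_restrict_space)
    finally show "snd c -` S \<inter> space (restrict_space vol (fst c \<inter> \<Omega>)) \<in> sets (restrict_space vol (fst c \<inter> \<Omega>))" .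
  qed simp
qed

lemma fst_\<Omega>_sets: "fst c \<inter> \<Omega> \<in> sets vol" using chart_open(1)[OF c] \<Omega> by (intro sets_vol_open) auto

lemma dens_measurable: "dens c \<in> borel_measurable (lebesgue_on W)"
  by (rule continuous_imp_measurable_on_sets_lebesgue[OF continuous_on_subset[OF dens_continuous[OF c]] W_lebesgue]) auto

text \<open>Turns the defining formula for volumes of subsets of a chart into an identity of
  measures, from which the change of variables for both kinds of integral follows.\<close>

lemma vol_chart_eq:
  "restrict_space vol (fst c \<inter> \<Omega>) =
    distr (density (lebesgue_on W) (\<lambda>y. ennreal (dens c y))) (restrict_space vol (fst c \<inter> \<Omega>)) (chart_inv c)"
  (is "?L = distr ?D ?L _")
proof (rule measure_eqI)
  fix A assume "A \<in> sets ?L"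
  then have A: "A \<in> sets vol" "A \<subseteq> fst c \<inter> \<Omega>" using fst_\<Omega>_sets by (auto simp: sets_restrict_space_iff)
  have im: "chart_inv c \<in> measurable ?D ?L"
    using chart_inv_measurable by simp
  have sA: "snd c ` A \<in> sets lebesgue" using chart_image_sets[OF c A(1)] A(2) by (simp add: inf.absorb2)
  have "emeasure (distr ?D ?L (chart_inv c)) A = emeasure ?D (chart_inv c -` A \<inter> space ?D)"
    by (rule emeasure_distr[OF im]) fact
  also have "chart_inv c -` A \<inter> space ?D = snd c ` A"
    using A chart_inv_W chart_inv_chart[OF c] by (auto simp: space_restrict_space)
  also have "emeasure ?D (snd c ` A) = (\<integral>\<^sup>+y. ennreal (dens c y) * indicator (snd c ` A) y \<partial>lebesgue_on W)"
    using sA A dens_measurable W_lebesgue by (intro emeasure_density) (auto simp: sets_restrict_space_iff)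
  also have "\<dots> = (\<integral>\<^sup>+y. ennreal (dens c y) * indicator (snd c ` A) y \<partial>lebesgue)"
  proof -
    have "snd c ` A \<subseteq> W" using A by auto
    then have "indicator (snd c ` A) y * indicator W y = (indicator (snd c ` A) y :: ennreal)" for y
      by (cases "y \<in> snd c ` A") (auto dest: subsetD)
    then show ?thesis
      using W_lebesgue by (simp add: nn_integral_restrict_space mult.assoc)
  qed
  also have "\<dots> = emeasure vol A"
    using vol c A unfolding riemannian_volume_def dens_def by auto
  also have "\<dots> = emeasure ?L A"
    using A fst_\<Omega>_sets by (subst emeasure_restrict_space) auto
  finally show "emeasure ?L A = emeasure (distr ?D ?L (chart_inv c)) A" by simp
qed simp

lemma nn_integral_chart:
  fixes f :: "'m \<Rightarrow> ennreal"
  assumes f: "f \<in> borel_measurable (restrict_space vol (fst c \<inter> \<Omega>))"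
  shows "(\<integral>\<^sup>+x\<in>fst c \<inter> \<Omega>. f x \<partial>vol) = (\<integral>\<^sup>+y\<in>W. ennreal (dens c y) * f (chart_inv c y) \<partial>lebesgue)"
proof -
  let ?D = "density (lebesgue_on W) (\<lambda>y. ennreal (dens c y))"
  have "(\<integral>\<^sup>+x\<in>fst c \<inter> \<Omega>. f x \<partial>vol) = (\<integral>\<^sup>+x. f x \<partial>restrict_space vol (fst c \<inter> \<Omega>))"
    using fst_\<Omega>_sets by (simp add: nn_integral_restrict_space)
  also have "\<dots> = (\<integral>\<^sup>+y. f (chart_inv c y) \<partial>?D)"
    using chart_inv_measurable f by (subst vol_chart_eq, subst nn_integral_distr) auto
  also have "\<dots> = (\<integral>\<^sup>+y. ennreal (dens c y) * f (chart_inv c y) \<partial>lebesgue_on W)"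
    using dens_measurable measurable_compose[OF chart_inv_measurable f] by (intro nn_integral_density) auto
  also have "\<dots> = (\<integral>\<^sup>+y\<in>W. ennreal (dens c y) * f (chart_inv c y) \<partial>lebesgue)"
    using W_lebesgue by (simp add: nn_integral_restrict_space)
  finally show ?thesis .
qed

lemma integral_chart:
  fixes f :: "'m \<Rightarrow> real"
  assumes f: "f \<in> borel_measurable (restrict_space vol (fst c \<inter> \<Omega>))"
  shows "integrable vol (\<lambda>x. indicator (fst c \<inter> \<Omega>) x * f x)
      \<longleftrightarrow> integrable lebesgue (\<lambda>y. indicator W y * (dens c y * f (chart_inv c y)))" (is ?A)
    and "(\<integral>x. indicator (fst c \<inter> \<Omega>) x * f x \<partial>vol) = (\<integral>y. indicator W y * (dens c y * f (chart_inv c y)) \<partial>lebesgue)" (is ?B)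
proof -
  let ?D = "density (lebesgue_on W) (\<lambda>y. ennreal (dens c y))"
  have im: "chart_inv c \<in> measurable ?D (restrict_space vol (fst c \<inter> \<Omega>))" using chart_inv_measurable by simp
  have fm: "(\<lambda>y. f (chart_inv c y)) \<in> borel_measurable (lebesgue_on W)"
    by (rule measurable_compose[OF chart_inv_measurable f])
  have nn: "AE y in lebesgue_on W. 0 \<le> dens c y"
    using dens_pos[OF c] by (auto simp: space_restrict_space intro!: AE_I2 less_imp_le)
  have "integrable vol (\<lambda>x. indicator (fst c \<inter> \<Omega>) x * f x) \<longleftrightarrow> integrable (restrict_space vol (fst c \<inter> \<Omega>)) f"
    using fst_\<Omega>_sets by (simp add: integrable_restrict_space)
  also have "\<dots> \<longleftrightarrow> integrable ?D (\<lambda>y. f (chart_inv c y))"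
    by (subst vol_chart_eq) (rule integrable_distr_eq[OF im f])
  also have "\<dots> \<longleftrightarrow> integrable (lebesgue_on W) (\<lambda>y. dens c y * f (chart_inv c y))"
    using integrable_density[OF fm dens_measurable nn] by simp
  also have "\<dots> \<longleftrightarrow> integrable lebesgue (\<lambda>y. indicator W y * (dens c y * f (chart_inv c y)))"
    using W_lebesgue by (simp add: integrable_restrict_space)
  finally show ?A .
  have "(\<integral>x. indicator (fst c \<inter> \<Omega>) x * f x \<partial>vol) = (\<integral>x. f x \<partial>restrict_space vol (fst c \<inter> \<Omega>))"
    using fst_\<Omega>_sets by (simp add: integral_restrict_space)
  also have "\<dots> = (\<integral>y. f (chart_inv c y) \<partial>?D)"
    by (subst vol_chart_eq) (rule integral_distr[OF im f])
  also have "\<dots> = (\<integral>y. dens c y * f (chart_inv c y) \<partial>lebesgue_on W)"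
    using integral_density[OF fm dens_measurable nn] by simp
  also have "\<dots> = (\<integral>y. indicator W y * (dens c y * f (chart_inv c y)) \<partial>lebesgue)"
    using W_lebesgue by (simp add: integral_restrict_space)
  finally show ?B .
qed

lemma measurable_from_chart:
  assumes "f \<circ> chart_inv c \<in> measurable (lebesgue_on W) N"
  shows "f \<in> measurable (restrict_space vol (fst c \<inter> \<Omega>)) N"
proof -
  have "(\<lambda>x. (f \<circ> chart_inv c) (snd c x)) \<in> measurable (restrict_space vol (fst c \<inter> \<Omega>)) N"
    by (rule measurable_compose[OF chart_measurable assms])
  then show ?thesis
    by (rule measurable_cong[THEN iffD1, rotated]) (auto simp: space_restrict_space chart_inv_chart[OF c])
qed

lemma measurable_to_chart:
  assumes "f \<in> measurable (restrict_space vol \<Omega>) N"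
  shows "(\<lambda>y. f (chart_inv c y)) \<in> measurable (lebesgue_on W) N"
proof (rule measurable_compose[OF chart_inv_measurable])
  have "restrict_space (restrict_space vol \<Omega>) (fst c) = restrict_space vol (fst c \<inter> \<Omega>)"
    using sets_vol_open[OF \<Omega>] by (subst restrict_restrict_space) (auto simp: sets_vol_open chart_open[OF c] Int_commute)
  with measurable_restrict_space1[OF assms, of "fst c"]
  show "f \<in> measurable (restrict_space vol (fst c \<inter> \<Omega>)) N" by simp
qed

text \<open>The density is strictly positive on the chart, so a set of volume zero has a Lebesgue
  null image.\<close>

lemma AE_chart:
  assumes "AE x in vol. x \<in> \<Omega> \<longrightarrow> P x"
  shows "AE y in lebesgue. y \<in> W \<longrightarrow> P (chart_inv c y)"
proof -
  obtain N where N: "N \<in> null_sets vol" "{x \<in> space vol. \<not> (x \<in> \<Omega> \<longrightarrow> P x)} \<subseteq> N"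
    using assms unfolding eventually_ae_filter by auto
  have m: "(indicator N :: 'm \<Rightarrow> ennreal) \<in> borel_measurable (restrict_space vol (fst c \<inter> \<Omega>))"
    using N(1) by (intro measurable_restrict_space1) auto
  have "0 = (\<integral>\<^sup>+x\<in>fst c \<inter> \<Omega>. indicator N x \<partial>vol)"
  proof -
    have "(\<integral>\<^sup>+x\<in>fst c \<inter> \<Omega>. indicator N x \<partial>vol) \<le> (\<integral>\<^sup>+x. indicator N x \<partial>vol)"
      by (intro nn_integral_mono) (auto simp: indicator_def)
    also have "\<dots> = 0" using N(1) by (simp add: null_setsD1 null_setsD2)
    finally show ?thesis by simp
  qed
  also have "\<dots> = (\<integral>\<^sup>+y\<in>W. ennreal (dens c y) * indicator N (chart_inv c y) \<partial>lebesgue)"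
    by (rule nn_integral_chart[OF m])
  finally have "(\<integral>\<^sup>+y. ennreal (dens c y) * indicator N (chart_inv c y) * indicator W y \<partial>lebesgue) = 0" by simp
  moreover have "(\<lambda>y. ennreal (dens c y) * indicator N (chart_inv c y) * indicator W y) \<in> borel_measurable lebesgue"
    using dens_measurable measurable_compose[OF chart_inv_measurable m] W_lebesgue
    by (subst borel_measurable_restrict_space_iff_ennreal[symmetric]) auto
  ultimately have "AE y in lebesgue. ennreal (dens c y) * indicator N (chart_inv c y) * indicator W y = 0"
    by (simp add: nn_integral_0_iff_AE)
  then show ?thesis
  proof eventually_elim
    case (elim y)
    show ?case
    proof
      assume y: "y \<in> W"
      then have "chart_inv c y \<notin> N"
        using elim dens_pos[OF c chart_inv_W(3)[OF y]] by (auto simp: indicator_def split: if_splits)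
      then show "P (chart_inv c y)" using N(2) chart_inv_W(1)[OF y] by auto
    qed
  qed
qed

lemma chart_inv_compact:
  assumes "compact K" "K \<subseteq> W"
  shows "compact (chart_inv c ` K)" "chart_inv c ` K \<subseteq> fst c \<inter> \<Omega>"
proof -
  show "compact (chart_inv c ` K)"
    using assms chart_inv_W(3) by (intro compact_continuous_image continuous_on_subset[OF chart_continuous(2)[OF c]]) auto
  show "chart_inv c ` K \<subseteq> fst c \<inter> \<Omega>" using assms chart_inv_W(1) by blast
qed

text \<open>On a compact set the density attains a positive minimum m, so m times the coordinate
  integral is at most the integral with respect to the volume.\<close>

lemma local_integrability_chart:
  fixes f :: "'m \<Rightarrow> ennreal"
  assumes f: "f \<in> borel_measurable (restrict_space vol \<Omega>)"
    and fin: "\<And>K. compact K \<Longrightarrow> K \<subseteq> \<Omega> \<Longrightarrow> (\<integral>\<^sup>+x\<in>K. f x \<partial>vol) < \<infinity>"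
    and K: "compact K" "K \<subseteq> W"
  shows "(\<integral>\<^sup>+y\<in>K. f (chart_inv c y) \<partial>lebesgue) < \<infinity>"
proof (cases "K = {}")
  case False
  let ?K = "chart_inv c ` K"
  have Kc: "compact ?K" "?K \<subseteq> fst c \<inter> \<Omega>" using chart_inv_compact[OF K] by auto
  obtain y0 where y0: "y0 \<in> K" "\<And>y. y \<in> K \<Longrightarrow> dens c y0 \<le> dens c y"
    using continuous_attains_inf[OF K(1) False continuous_on_subset[OF dens_continuous[OF c]]] K chart_inv_W(3) by blast
  define m where "m = dens c y0"
  have m: "m > 0" using dens_pos[OF c] y0(1) K chart_inv_W(3) by (auto simp: m_def)
  have fm: "(\<lambda>y. f (chart_inv c y)) \<in> borel_measurable (lebesgue_on W)"
    by (rule measurable_to_chart[OF f])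
  have KL: "K \<in> sets lebesgue" using borel_closed[OF compact_imp_closed[OF K(1)]] by auto
  have fKm: "(\<lambda>y. f (chart_inv c y) * indicator K y) \<in> borel_measurable lebesgue"
  proof -
    have "(\<lambda>y. f (chart_inv c y) * indicator W y * indicator K y) \<in> borel_measurable lebesgue"
      using fm W_lebesgue KL by (subst (asm) borel_measurable_restrict_space_iff_ennreal) auto
    also have "(\<lambda>y. f (chart_inv c y) * indicator W y * indicator K y) = (\<lambda>y. f (chart_inv c y) * indicator K y)"
      by (intro ext) (use K in \<open>auto simp: indicator_def\<close>)
    finally show ?thesis .
  qed
  have "ennreal m * (\<integral>\<^sup>+y\<in>K. f (chart_inv c y) \<partial>lebesgue) = (\<integral>\<^sup>+y. ennreal m * (f (chart_inv c y) * indicator K y) \<partial>lebesgue)"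
    using fKm by (simp add: nn_integral_cmult)
  also have "\<dots> \<le> (\<integral>\<^sup>+y\<in>W. ennreal (dens c y) * (f (chart_inv c y) * indicator ?K (chart_inv c y)) \<partial>lebesgue)"
  proof (rule nn_integral_mono)
    fix y
    show "ennreal m * (f (chart_inv c y) * indicator K y) \<le> ennreal (dens c y) * (f (chart_inv c y) * indicator ?K (chart_inv c y)) * indicator W y"
    proof (cases "y \<in> K")
      case True
      then have "ennreal m \<le> ennreal (dens c y)" using y0(2) by (auto simp: m_def intro: ennreal_leI)
      moreover have "y \<in> W" using True K by blast
      ultimately show ?thesis using True by (auto intro!: mult_right_mono)
    qed simp
  qed
  also have "\<dots> = (\<integral>\<^sup>+x\<in>fst c \<inter> \<Omega>. f x * indicator ?K x \<partial>vol)"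
  proof (rule nn_integral_chart[symmetric])
    have "f \<in> borel_measurable (restrict_space vol (fst c \<inter> \<Omega>))"
      using measurable_restrict_space1[OF f, of "fst c"] sets_vol_open[OF \<Omega>]
      by (subst (asm) restrict_restrict_space) (auto simp: sets_vol_open chart_open[OF c] Int_commute)
    then show "(\<lambda>x. f x * indicator ?K x) \<in> borel_measurable (restrict_space vol (fst c \<inter> \<Omega>))"
      using sets_vol_closed[OF compact_imp_closed[OF Kc(1)]]
      by (intro borel_measurable_times_ennreal measurable_restrict_space1[of "indicator ?K"]) auto
  qed
  also have "\<dots> = (\<integral>\<^sup>+x\<in>?K. f x \<partial>vol)"
    using Kc by (intro nn_integral_cong) (auto simp: indicator_def)
  also have "\<dots> < \<infinity>" using Kc by (intro fin) auto
  finally show ?thesis using m by (auto simp: ennreal_mult_less_top)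
qed simp

end

end

section \<open>Functions of class $C^1$\<close>

lemma Ck1_I:
  assumes "\<And>y. y \<in> S \<Longrightarrow> (f has_derivative D y) (at y)" "\<And>v. continuous_on S (\<lambda>y. D y v)"
  shows "Ck_on 1 S f"
proof -
  have "frechet_derivative f (at y) v = D y v" if "y \<in> S" for y v
    using frechet_derivative_at[OF assms(1)[OF that]] by simp
  then have "continuous_on S (\<lambda>y. frechet_derivative f (at y) v)" for v
    using assms(2)[of v] by (simp cong: continuous_on_cong)
  moreover have "\<forall>y\<in>S. f differentiable (at y)" using assms(1) unfolding differentiable_def by blast
  ultimately show ?thesis unfolding One_nat_def Ck_on.simps by blast
qed

lemma Ck1_D:
  assumes "Ck_on 1 S f"
  shows "\<And>y. y \<in> S \<Longrightarrow> (f has_derivative frechet_derivative f (at y)) (at y)"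
    and "\<And>v. continuous_on S (\<lambda>y. frechet_derivative f (at y) v)"
    and "continuous_on S f"
proof -
  show *: "(f has_derivative frechet_derivative f (at y)) (at y)" if "y \<in> S" for y
    using assms that unfolding One_nat_def Ck_on.simps frechet_derivative_works by blast
  show "continuous_on S (\<lambda>y. frechet_derivative f (at y) v)" for v
    using assms unfolding One_nat_def Ck_on.simps by blast
  show "continuous_on S f"
    by (intro continuous_at_imp_continuous_on ballI has_derivative_continuous[OF *])
qed

lemma Ck1_cong:
  assumes "open S" "Ck_on 1 S f" "\<And>y. y \<in> S \<Longrightarrow> f y = g y"
  shows "Ck_on 1 S g"
proof (rule Ck1_I)
  show "(g has_derivative frechet_derivative f (at y)) (at y)" if "y \<in> S" for y
    by (rule has_derivative_transform_within_open[OF Ck1_D(1)[OF assms(2) that] assms(1) that assms(3)])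
qed (rule Ck1_D(2)[OF assms(2)])

text \<open>Gluing over open sets. It is used to show that extensions by zero are C^1: one open set
  contains the support, on the other the function is 0.\<close>

lemma Ck1_Un:
  assumes "open S" "open T" "Ck_on 1 S f" "Ck_on 1 T f"
  shows "Ck_on 1 (S \<union> T) f"
  by (rule Ck1_I[where D = "\<lambda>y. frechet_derivative f (at y)"])
    (use assms Ck1_D in \<open>auto intro!: continuous_on_open_Un\<close>)

lemma Ck1_subset: "Ck_on 1 S f \<Longrightarrow> T \<subseteq> S \<Longrightarrow> Ck_on 1 T f"
  unfolding One_nat_def Ck_on.simps by (meson continuous_on_subset subsetD)

lemma Ck1_const: "Ck_on 1 S (\<lambda>_. c)"
  by (rule Ck1_I[where D = "\<lambda>_ _. 0"]) auto

lemma Ck1_sum: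
  fixes f :: "'i \<Rightarrow> 'a::euclidean_space \<Rightarrow> real"
  assumes "\<And>i. i \<in> I \<Longrightarrow> Ck_on 1 S (f i)"
  shows "Ck_on 1 S (\<lambda>y. \<Sum>i\<in>I. f i y)"
  by (rule Ck1_I[where D = "\<lambda>y v. \<Sum>i\<in>I. frechet_derivative (f i) (at y) v"])
    (intro has_derivative_sum continuous_on_sum Ck1_D[OF assms]; assumption)+

lemma Ck1_mult:
  fixes f g :: "'a::euclidean_space \<Rightarrow> real"
  assumes "Ck_on 1 S f" "Ck_on 1 S g"
  shows "Ck_on 1 S (\<lambda>y. f y * g y)"
  by (rule Ck1_I[where D = "\<lambda>y v. f y * frechet_derivative g (at y) v + frechet_derivative f (at y) v * g y"])
    (intro has_derivative_mult continuous_intros Ck1_D(1,2,3)[OF assms(1)] Ck1_D(1,2,3)[OF assms(2)]; assumption)+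

lemma Ck1_compose_real:
  fixes f :: "'a::euclidean_space \<Rightarrow> real"
  assumes f: "Ck_on 1 S f" and h: "\<And>t. t \<in> T \<Longrightarrow> (h has_real_derivative h' t) (at t)"
    "continuous_on T h'" "\<And>y. y \<in> S \<Longrightarrow> f y \<in> T"
  shows "Ck_on 1 S (\<lambda>y. h (f y))"
proof (rule Ck1_I)
  show "((\<lambda>y. h (f y)) has_derivative (\<lambda>v. frechet_derivative f (at y) v * h' (f y))) (at y)" if "y \<in> S" for y
    by (rule DERIV_compose_FDERIV[OF h(1)[OF h(3)[OF that]] Ck1_D(1)[OF f that]])
  show "continuous_on S (\<lambda>y. frechet_derivative f (at y) v * h' (f y))" for v
    using h(3) by (intro continuous_on_mult Ck1_D(2)[OF f] continuous_on_compose2[OF h(2) Ck1_D(3)[OF f]]) auto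
qed

lemma Ck1_inverse:
  fixes f :: "'a::euclidean_space \<Rightarrow> real"
  assumes "Ck_on 1 S f" "\<And>y. y \<in> S \<Longrightarrow> f y \<noteq> 0"
  shows "Ck_on 1 S (\<lambda>y. inverse (f y))"
  by (rule Ck1_compose_real[OF assms(1), where T = "- {0}" and h' = "\<lambda>t. - (inverse t * inverse t)"])
    (use assms(2) in \<open>auto intro!: derivative_eq_intros continuous_intros simp: power2_eq_square\<close>)

text \<open>At 0 the difference quotient has absolute value |h|^(p-1), which tends to 0 because p >
  1. Elsewhere |t| = t sgn t with locally constant sign.\<close>

lemma abs_powr_DERIV:
  assumes "p > 1"
  shows "((\<lambda>t::real. \<bar>t\<bar> powr p) has_real_derivative p * \<bar>t\<bar> powr (p - 1) * sgn t) (at t)"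
proof (cases "t = 0")
  case True
  have "((\<lambda>h::real. \<bar>h\<bar> powr (p - 1)) \<longlongrightarrow> 0) (at 0)"
    by (rule tendsto_zero_powrI[where b = "p - 1"]) (use assms in \<open>auto intro!: tendsto_eq_intros\<close>)
  moreover have "\<bar>h\<bar> powr (p - 1) = norm ((\<bar>h\<bar> powr p) / h)" if "h \<noteq> 0" for h :: real
    using that by (simp add: powr_diff)
  ultimately have "((\<lambda>h::real. norm ((\<bar>h\<bar> powr p) / h)) \<longlongrightarrow> 0) (at 0)"
    by (elim Lim_transform_eventually) (auto simp: eventually_at_filter)
  then have "((\<lambda>h::real. (\<bar>h\<bar> powr p) / h) \<longlongrightarrow> 0) (at 0)" by (rule tendsto_norm_zero_cancel)
  then show ?thesis using True assms by (simp add: DERIV_def)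
next
  case False
  have "((\<lambda>t::real. (t * sgn t) powr p) has_real_derivative p * \<bar>t\<bar> powr (p - 1) * sgn t) (at t)" if "t \<noteq> 0" for t
  proof -
    have "((\<lambda>s. (s * sgn t) powr p) has_real_derivative p * (t * sgn t) powr (p - 1) * sgn t) (at t)"
      using that by (auto intro!: derivative_eq_intros simp: sgn_if)
    then have "((\<lambda>s. (s * sgn t) powr p) has_real_derivative p * \<bar>t\<bar> powr (p - 1) * sgn t) (at t)"
      by (simp add: abs_sgn)
    then show ?thesis
    proof (rule DERIV_cong_ev[OF refl _ refl, THEN iffD1, rotated])
      show "\<forall>\<^sub>F s in nhds t. (s * sgn t) powr p = (s * sgn s) powr p"
      proof -
        have "\<forall>\<^sub>F s in nhds t. s \<in> (if t > 0 then {0<..} else {..<0})"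
          by (rule eventually_nhds_in_open) (use that in auto)
        then show ?thesis by eventually_elim (use that in \<open>auto simp: sgn_if split: if_splits\<close>)
      qed
    qed
  qed
  from this[OF False] show ?thesis by (simp add: abs_sgn[symmetric])
qed

lemma Ck1_abs_powr:
  fixes f :: "'a::euclidean_space \<Rightarrow> real"
  assumes "Ck_on 1 S f" "p > 1"
  shows "Ck_on 1 S (\<lambda>y. \<bar>f y\<bar> powr p)"
proof (rule Ck1_compose_real[OF assms(1) abs_powr_DERIV[OF assms(2)], where T = UNIV])
  \<comment> \<open>The sign function is discontinuous, but the signed power is a difference of
    powers of the positive and negative parts, which are continuous.\<close>
  have "p * \<bar>t\<bar> powr (p - 1) * sgn t = p * (max 0 t powr (p - 1) - max 0 (- t) powr (p - 1))" for t :: real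
    by (cases t "0::real" rule: linorder_cases) auto
  then show "continuous_on UNIV (\<lambda>t::real. p * \<bar>t\<bar> powr (p - 1) * sgn t)"
    using assms(2) by (simp only:) (intro continuous_on_mult continuous_on_diff continuous_on_powr' continuous_intros, auto)
qed auto

lemma real_derivative_gradient:
  fixes f :: "real ^ 'n::finite \<Rightarrow> real"
  assumes "(f has_derivative D) F"
  shows "D v = (\<chi> i. D (axis i 1)) \<bullet> v"
proof -
  interpret bounded_linear D using assms by (rule has_derivative_bounded_linear)
  have "D v = D (\<Sum>i\<in>UNIV. v $ i *\<^sub>R axis i 1)" using basis_expansion[of v] by (simp add: scalar_mult_eq_scaleR)
  then show ?thesis by (simp only: sum scaleR) (simp add: inner_vec_def mult.commute)
qed

definition grad_vec :: "(real ^ 'n::finite \<Rightarrow> real) \<Rightarrow> real ^ 'n \<Rightarrow> real ^ 'n" where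
  "grad_vec f y = (\<chi> i. frechet_derivative f (at y) (axis i 1))"

lemma C1c_grad_vec:
  assumes f: "Ck_on 1 UNIV f" and K: "compact K" "K \<subseteq> W" "\<And>y. y \<notin> K \<Longrightarrow> f y = 0"
  shows "C1c W f (grad_vec f)"
  unfolding C1c_def
proof (intro conjI allI)
  fix y
  have "frechet_derivative f (at y) = (\<lambda>v. grad_vec f y \<bullet> v)"
    unfolding grad_vec_def by (intro ext real_derivative_gradient[OF Ck1_D(1)[OF f UNIV_I]])
  then show "(f has_derivative (\<lambda>v. grad_vec f y \<bullet> v)) (at y)"
    using Ck1_D(1)[OF f UNIV_I, of y] by simp
  show "continuous_on UNIV (grad_vec f)"
    unfolding grad_vec_def[abs_def] by (intro continuous_on_vec_lambda Ck1_D(2)[OF f])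
qed (use K in blast)

lemma compactly_supported_inI:
  fixes f :: "'a::t2_space \<Rightarrow> real"
  assumes "compact K" "K \<subseteq> S" "\<And>x. x \<notin> K \<Longrightarrow> f x = 0"
  shows "compactly_supported_in S f"
proof -
  have "closure {x. f x \<noteq> 0} \<subseteq> K"
    using assms by (intro closure_minimal compact_imp_closed) auto
  moreover from this have "compact (closure {x. f x \<noteq> 0})"
    using closed_Int_compact[OF closed_closure assms(1), of "{x. f x \<noteq> 0}"] by (simp add: inf.absorb1)
  ultimately show ?thesis using assms(2) by (auto simp: compactly_supported_in_def)
qed

section \<open>Test functions supported in one chart\<close>

context riem_mfd
begin

lemma chart_preimage_open: "c \<in> charts M \<Longrightarrow> open S \<Longrightarrow> open (snd c ` fst c \<inter> chart_inv c -` S)"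
  using chart_image_open by (simp add: chart_image_eq)

definition from_chart where "from_chart c f x = (if x \<in> fst c then f (snd c x) else (0::real))"

text \<open>The support is compact, hence closed in a Hausdorff space. Any other chart is therefore
  covered by its overlap with \<open>c\<close>, where a transition map gives C^1, and by the
  complement of the support, where the function is 0.\<close>

lemma from_chart_C0k:
  assumes c: "c \<in> charts M" and f: "C1c (snd c ` (fst c \<inter> \<Omega>)) f D"
  shows "from_chart c f \<in> C0k M 1 \<Omega>"
proof -
  obtain K where K: "compact K" "K \<subseteq> snd c ` (fst c \<inter> \<Omega>)" "\<And>y. y \<notin> K \<Longrightarrow> f y = 0"
    and D: "\<And>y. (f has_derivative (\<lambda>v. D y \<bullet> v)) (at y)" "continuous_on UNIV D"
    using f unfolding C1c_def by blast
  let ?K = "chart_inv c ` K"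
  have Kc: "compact ?K"
    by (intro compact_continuous_image K continuous_on_subset[OF chart_continuous(2)[OF c]]) (use K in blast)
  have KO: "?K \<subseteq> fst c \<inter> \<Omega>" using K(2) chart_inv_chart[OF c] by auto
  have z: "from_chart c f x = 0" if "x \<notin> ?K" for x
  proof (cases "x \<in> fst c")
    case True
    have "snd c x \<notin> K" using that chart_inv_chart[OF c True] by (metis image_eqI)
    then show ?thesis using K by (simp add: from_chart_def)
  qed (simp add: from_chart_def)
  have "Ck_on 1 (snd c' ` fst c') (from_chart c f \<circ> chart_inv c')" if c': "c' \<in> charts M" for c'
  proof -
    let ?S = "snd c' ` (fst c' \<inter> fst c)" and ?T = "snd c' ` fst c' \<inter> chart_inv c' -` (- ?K)"
    have S: "open ?S" "open ?T"
      using c c' Kc by (auto intro!: chart_image_open chart_open chart_preimage_open open_Compl compact_imp_closed)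
    have "Ck_on 1 ?S (f \<circ> transition c' c)"
    proof (rule Ck1_I)
      have t: "Ck_on 1 ?S (transition c' c)" using transition_smooth[OF c' c] unfolding smooth_on_def by blast
      show "(f \<circ> transition c' c has_derivative (\<lambda>v. D (transition c' c y) \<bullet> frechet_derivative (transition c' c) (at y) v)) (at y)" if "y \<in> ?S" for y
        using diff_chain_at[OF Ck1_D(1)[OF t that] D(1)] by (simp add: o_def)
      show "continuous_on ?S (\<lambda>y. D (transition c' c y) \<bullet> frechet_derivative (transition c' c) (at y) v)" for v
        by (intro continuous_on_inner Ck1_D(2)[OF t] continuous_on_compose2[OF D(2) Ck1_D(3)[OF t]]) auto
    qed
    then have 1: "Ck_on 1 ?S (from_chart c f \<circ> chart_inv c')"
      by (rule Ck1_cong[OF S(1)]) (auto simp: transition_apply[OF c'] chart_inv_chart[OF c'] from_chart_def)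
    have 2: "Ck_on 1 ?T (from_chart c f \<circ> chart_inv c')"
      by (rule Ck1_cong[OF S(2) Ck1_const[of _ 0]]) (use z in auto)
    have "snd c' ` fst c' = ?S \<union> ?T"
      using chart_inv_chart[OF c'] KO by auto
    then show ?thesis using Ck1_Un[OF S 1 2] by simp
  qed
  moreover have "compactly_supported_in \<Omega> (from_chart c f)"
    by (rule compactly_supported_inI[OF Kc]) (use KO z in auto)
  ultimately show ?thesis by (simp add: C0k_def)
qed

lemma C0k_differentiable:
  assumes "u \<in> C0k M 1 \<Omega>" "c \<in> charts_at M x"
  shows "(u \<circ> chart_inv c) differentiable (at (snd c x))"
proof -
  have "Ck_on 1 (snd c ` fst c) (u \<circ> chart_inv c)" "snd c x \<in> snd c ` fst c"
    using assms by (auto simp: C0k_def charts_at_def)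
  from Ck1_D(1)[OF this] show ?thesis unfolding differentiable_def by blast
qed

lemma grad_C0k:
  assumes u: "u \<in> C0k M 1 \<Omega>" and v: "v \<in> tangent_space M x" and c: "c \<in> charts_at M x"
  shows "grad M u x \<in> tangent_space M x"
    "metric M x v (grad M u x) = frechet_derivative (u \<circ> chart_inv c) (at (snd c x)) (v c)"
proof -
  note g = grad_spec[OF c C0k_differentiable[OF u c]]
  show "grad M u x \<in> tangent_space M x" by (rule g(1))
  show "metric M x v (grad M u x) = frechet_derivative (u \<circ> chart_inv c) (at (snd c x)) (v c)"
    using g(2)[OF c v] metric_sym[OF v g(1)] by simp
qed

lemma C0k_continuous:
  assumes u: "u \<in> C0k M 1 \<Omega>" shows "continuous_on UNIV u"
proof (intro continuous_at_imp_continuous_on ballI)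
  fix x
  obtain c where "c \<in> charts_at M x" by (rule chart_exists)
  then have c: "c \<in> charts M" "x \<in> fst c" by (auto simp: charts_at_def)
  have "continuous_on (snd c ` fst c) (u \<circ> chart_inv c)"
    using u c by (intro Ck1_D(3)) (simp add: C0k_def)
  then have "continuous_on (fst c) (\<lambda>x. (u \<circ> chart_inv c) (snd c x))"
    by (rule continuous_on_compose2[OF _ chart_continuous(1)[OF c(1)]]) simp
  then have "continuous_on (fst c) u"
    by (rule continuous_on_eq) (simp add: chart_inv_chart[OF c(1)])
  then show "isCont u x" using c chart_open(1)[OF c(1)] by (simp add: continuous_on_eq_continuous_at)
qed

definition to_chart where
  "to_chart c u y = (if y \<in> snd c ` fst c then u (chart_inv c y) else (0::real))"

lemma to_chart_C1c:
  assumes c: "c \<in> charts M" and u: "u \<in> C0k M 1 \<Omega>"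
    and K: "compact K" "K \<subseteq> fst c \<inter> \<Omega>" "\<And>x. x \<notin> K \<Longrightarrow> u x = 0"
  shows "C1c (snd c ` (fst c \<inter> \<Omega>)) (to_chart c u) (grad_vec (to_chart c u))"
proof (rule C1c_grad_vec)
  have Kc: "compact (snd c ` K)"
    using K by (intro compact_continuous_image continuous_on_subset[OF chart_continuous(1)[OF c]]) auto
  then show "compact (snd c ` K)" .
  show "snd c ` K \<subseteq> snd c ` (fst c \<inter> \<Omega>)" using K by blast
  show z: "to_chart c u y = 0" if "y \<notin> snd c ` K" for y
  proof (cases "y \<in> snd c ` fst c")
    case True
    then have "chart_inv c y \<notin> K" using that chart_chart_inv[OF c True] by (metis image_eqI)
    then show ?thesis using K by (simp add: to_chart_def)
  qed (simp add: to_chart_def)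
  have o: "open (snd c ` fst c)" "open (- (snd c ` K))"
    using chart_open(2)[OF c] compact_imp_closed[OF Kc] by (auto simp: open_Compl)
  have 1: "Ck_on 1 (snd c ` fst c) (to_chart c u)"
  proof (rule Ck1_cong[OF o(1)])
    show "Ck_on 1 (snd c ` fst c) (u \<circ> chart_inv c)" using u c by (simp add: C0k_def)
  qed (simp add: to_chart_def)
  have 2: "Ck_on 1 (- (snd c ` K)) (to_chart c u)"
    by (rule Ck1_cong[OF o(2) Ck1_const[of _ 0]]) (use z in auto)
  have "snd c ` fst c \<union> - (snd c ` K) = UNIV" using K by blast
  then show "Ck_on 1 UNIV (to_chart c u)" using Ck1_Un[OF o 1 2] by simp
qed

text \<open>Pairing a vector with a gradient is applying the differential, so the metric cancels and
  only the Euclidean gradient in coordinates is left.\<close>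

lemma to_chart_grad:
  assumes c: "c \<in> charts_at M x" and u: "u \<in> C0k M 1 \<Omega>" and v: "v \<in> tangent_space M x"
  shows "metric M x v (grad M u x) = grad_vec (to_chart c u) (snd c x) \<bullet> v c"
proof -
  have cM: "c \<in> charts M" "snd c x \<in> snd c ` fst c" using c by (auto simp: charts_at_def)
  have d: "(u \<circ> chart_inv c has_derivative frechet_derivative (u \<circ> chart_inv c) (at (snd c x))) (at (snd c x))"
    using C0k_differentiable[OF u c] frechet_derivative_works by blast
  have "(to_chart c u has_derivative frechet_derivative (u \<circ> chart_inv c) (at (snd c x))) (at (snd c x))"
    by (rule has_derivative_transform_within_open[OF d chart_open(2)[OF cM(1)] cM(2)]) (simp add: to_chart_def)
  then have "frechet_derivative (to_chart c u) (at (snd c x)) = frechet_derivative (u \<circ> chart_inv c) (at (snd c x))"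
    by (rule frechet_derivative_at[symmetric])
  then show ?thesis
    using grad_C0k(2)[OF u v c] real_derivative_gradient[OF d, of "v c"] by (simp add: grad_vec_def)
qed

end

context riem_mfd
begin

lemma metric_grad_eq_0:
  assumes u: "u \<in> C0k M 1 \<Omega>" and K: "compact K" "\<And>x. x \<notin> K \<Longrightarrow> u x = 0" and x: "x \<notin> K"
    and v: "v \<in> tangent_space M x"
  shows "metric M x v (grad M u x) = 0"
proof -
  obtain c where cx: "c \<in> charts_at M x" by (rule chart_exists)
  then have c: "c \<in> charts M" "x \<in> fst c" by (auto simp: charts_at_def)
  have "open (snd c ` fst c \<inter> chart_inv c -` (- K))"
    using c K by (intro chart_preimage_open open_Compl compact_imp_closed)
  moreover have "snd c x \<in> snd c ` fst c \<inter> chart_inv c -` (- K)"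
    using c x by (simp add: chart_inv_chart)
  ultimately have "(u \<circ> chart_inv c has_derivative (\<lambda>_. 0)) (at (snd c x))"
    by (rule has_derivative_transform_within_open[of "\<lambda>_. 0", OF has_derivative_const]) (use K in auto)
  from frechet_derivative_at[OF this] have "frechet_derivative (u \<circ> chart_inv c) (at (snd c x)) = (\<lambda>_. 0)" by simp
  then show ?thesis using grad_C0k(2)[OF u v cx] by simp
qed

text \<open>The quadratic form attains a positive minimum on the compact product of \<open>K\<close>
  with the unit sphere; homogeneity extends the bound to all vectors.\<close>

lemma gm_elliptic:
  assumes c: "c \<in> charts M" and K: "compact K" "K \<subseteq> snd c ` fst c"
  obtains l where "l > 0" "\<And>y \<xi>. y \<in> K \<Longrightarrow> l * (norm \<xi>)\<^sup>2 \<le> \<xi> \<bullet> (gm c y *v \<xi>)"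
proof (cases "K = {}")
  case False
  define f where "f z = snd z \<bullet> (gm c (fst z) *v snd z)" for z :: "(real ^ 'n) \<times> (real ^ 'n)"
  let ?S = "K \<times> sphere (0 :: real ^ 'n) 1"
  have gmc: "continuous_on ?S (\<lambda>z. gm c (fst z) $ i $ j)" for i j
    by (rule continuous_on_compose2[OF continuous_on_subset[OF gm_continuous[OF c] K(2)]]) (auto intro!: continuous_intros)
  have "continuous_on ?S f"
    unfolding f_def[abs_def] inner_vec_def matrix_vector_mult_def vec_lambda_beta inner_real_def
    by (intro continuous_on_sum continuous_on_mult gmc continuous_on_component continuous_on_snd continuous_on_id)
  moreover have "compact ?S" using K by (intro compact_Times compact_sphere)
  moreover have "?S \<noteq> {}"
  proof -
    have "axis undefined 1 \<in> sphere (0 :: real ^ 'n) 1" by (simp add: norm_axis_1)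
    then show ?thesis using False by blast
  qed
  ultimately obtain z where z: "z \<in> ?S" "\<And>z'. z' \<in> ?S \<Longrightarrow> f z \<le> f z'"
    using continuous_attains_inf[of ?S f] by blast
  show ?thesis
  proof (rule that[of "f z"])
    have "snd z \<noteq> 0" using z(1) by auto
    then show "f z > 0" unfolding f_def using z(1) K by (intro gm_positive_definite[OF c]) auto
    fix y \<xi> assume y: "y \<in> K"
    show "f z * (norm \<xi>)\<^sup>2 \<le> \<xi> \<bullet> (gm c y *v \<xi>)"
    proof (cases "\<xi> = 0")
      case False
      define \<eta> where "\<eta> = (1 / norm \<xi>) *\<^sub>R \<xi>"
      have "f z \<le> f (y, \<eta>)" using y False by (intro z(2)) (simp add: \<eta>_def)
      also have "f (y, \<eta>) = (\<xi> \<bullet> (gm c y *v \<xi>)) / (norm \<xi>)\<^sup>2"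
        by (simp add: f_def \<eta>_def matrix_vector_mult_scaleR power2_eq_square)
      finally show ?thesis using False by (simp add: field_simps)
    qed simp
  qed
qed (auto intro: that[of 1])

end

lemma borel_measurable_vecI:
  fixes f :: "'a \<Rightarrow> real ^ 'n::finite"
  assumes "\<And>i. (\<lambda>x. f x $ i) \<in> borel_measurable N"
  shows "f \<in> borel_measurable N"
  using assms by (subst borel_measurable_euclidean_space) (auto simp: Basis_vec_def inner_axis)

section \<open>The hypotheses of the theorem in one chart\<close>

locale hardy = riem_vol M vol
  for M :: "('m::{t2_space, second_countable_topology}, 'n::finite) rmanifold" and vol :: "'m measure" +
  fixes p \<alpha> :: real and \<Omega> :: "'m set" and \<rho> :: "'m \<Rightarrow> real" and X :: "'m \<Rightarrow> ('m, 'n) tvec"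
  assumes p: "p > 1" and \<Omega>: "open \<Omega>" and \<rho>: "W1p_loc M vol p \<Omega> \<rho> X"
    and nonneg: "AE x in vol. x \<in> \<Omega> \<longrightarrow> 0 \<le> \<rho> x"
    and weak: "weak_p_Laplace_ineq M vol p \<Omega> (p - 1 - \<alpha>) X"
    and ii1: "L1_loc_nonneg vol \<Omega> (\<lambda>x. ennreal (tnorm M x (X x) powr p) / epowr (\<rho> x) (p - \<alpha>))"
    and ii2: "L1_loc_nonneg vol \<Omega> (\<lambda>x. epowr (\<rho> x) \<alpha>)"
begin

abbreviation "tX x \<equiv> tnorm M x (X x)"

abbreviation "dX u x \<equiv> metric M x (X x) (grad M u x)"

lemma X_tangent: "x \<in> \<Omega> \<Longrightarrow> X x \<in> tangent_space M x"
  using \<rho> by (simp add: W1p_loc_def weak_gradient_def)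

lemma tX_nonneg: "x \<in> \<Omega> \<Longrightarrow> tX x \<ge> 0"
  using metric_nonneg[OF X_tangent] by (simp add: tnorm_def)

lemma tX_square: "x \<in> \<Omega> \<Longrightarrow> (tX x)\<^sup>2 = metric M x (X x) (X x)"
  by (rule tnorm_square[OF X_tangent])

lemma \<rho>_measurable: "\<rho> \<in> borel_measurable (restrict_space vol \<Omega>)"
  and tX_measurable: "tX \<in> borel_measurable (restrict_space vol \<Omega>)"
  using \<rho> by (auto simp: W1p_loc_def Lp_loc_def)

context
  fixes c :: "('m, 'n) chart"
  assumes c: "c \<in> charts M"
begin

abbreviation (input) "Wc \<equiv> snd c ` (fst c \<inter> \<Omega>)"

definition "rc = \<rho> \<circ> chart_inv c"

definition "Gc = (\<lambda>y. let x = chart_inv c y in \<chi> i. metric M x (X x) (coord_vec M c i x))"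

text \<open>Set to 0 outside the chart image because \<open>chart_supersolution\<close> asks for
  nonnegativity everywhere, whereas \<open>X\<close> is tangent only over \<Omega>.\<close>

definition "qc y = (if y \<in> Wc then tX (chart_inv c y) else 0)"

definition "Ac y = (if y \<in> Wc then (dens c y * qc y powr (p - 2)) *\<^sub>R X (chart_inv c y) c else 0)"

lemma in_Wc:
  assumes "y \<in> Wc"
  shows "c \<in> charts_at M (chart_inv c y)" "snd c (chart_inv c y) = y" "chart_inv c y \<in> \<Omega>" "y \<in> snd c ` fst c"
  using chart_inv_W[OF c \<Omega> assms] c by (auto simp: charts_at_def)

lemma Gc_eq: "y \<in> Wc \<Longrightarrow> Gc y = gm c y *v X (chart_inv c y) c"
  using metric_coord_vec[OF in_Wc(1) X_tangent[OF in_Wc(3)]]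
  by (simp add: Gc_def Let_def in_Wc(2) vec_eq_iff)

lemma qc_square: "y \<in> Wc \<Longrightarrow> (qc y)\<^sup>2 = X (chart_inv c y) c \<bullet> (gm c y *v X (chart_inv c y) c)"
  using metric_coords[OF in_Wc(1) X_tangent[OF in_Wc(3)] X_tangent[OF in_Wc(3)]] in_Wc(2)[of y]
    tX_square[OF in_Wc(3)] by (simp add: qc_def)

lemma qc_nonneg: "qc y \<ge> 0"
  using tX_nonneg[OF in_Wc(3)] by (simp add: qc_def)

lemma Ac_Gc:
  assumes y: "y \<in> Wc"
  shows "Ac y \<bullet> Gc y = dens c y * qc y powr p"
proof -
  have "Ac y \<bullet> Gc y = dens c y * (qc y powr (p - 2) * (qc y)\<^sup>2)"
    using y qc_square[OF y] by (simp add: Ac_def Gc_eq)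
  also have "qc y powr (p - 2) * (qc y)\<^sup>2 = qc y powr p"
    using qc_nonneg[of y] p by (cases "qc y = 0") (auto simp: powr_diff)
  finally show ?thesis .
qed

lemma qc_measurable: "qc \<in> borel_measurable (lebesgue_on Wc)"
  using measurable_to_chart[OF c \<Omega> tX_measurable]
  by (rule measurable_cong[THEN iffD1, rotated]) (auto simp: qc_def space_restrict_space)

lemma weak_partials_c: "weak_partials Wc rc Gc"
  using \<rho> c unfolding W1p_loc_def weak_gradient_def rc_def Gc_def by blast

lemma gm_measurable: "(\<lambda>y. gm c y $ i $ j) \<in> borel_measurable (lebesgue_on Wc)"
  by (rule continuous_imp_measurable_on_sets_lebesgue[OF continuous_on_subset[OF gm_continuous[OF c]] W_lebesgue[OF c \<Omega>]]) auto

text \<open>Only the differential is measurable by hypothesis; Cramer's rule recovers the gradient from it.\<close>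

lemma X_measurable: "(\<lambda>y. X (chart_inv c y) c) \<in> borel_measurable (lebesgue_on Wc)"
proof (rule borel_measurable_vecI)
  fix k
  have "Gc \<in> borel_measurable (lebesgue_on Wc)"
    using weak_partials_c by (simp add: weak_partials_def Lp_loc_def)
  then have G: "(\<lambda>y. Gc y $ i) \<in> borel_measurable (lebesgue_on Wc)" for i
    by (rule measurable_compose[OF _ borel_measurable_nth])
  have e: "(\<lambda>y. if j = k then Gc y $ i else gm c y $ i $ j) \<in> borel_measurable (lebesgue_on Wc)" for i j
    using G gm_measurable by (cases "j = k") simp_all
  have "(\<lambda>y. det (\<chi> i j. if j = k then Gc y $ i else gm c y $ i $ j) / det (gm c y)) \<in> borel_measurable (lebesgue_on Wc)"
    unfolding det_def vec_lambda_beta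
    by (intro borel_measurable_divide borel_measurable_sum borel_measurable_times borel_measurable_const borel_measurable_prod e gm_measurable)
  then show "(\<lambda>y. X (chart_inv c y) c $ k) \<in> borel_measurable (lebesgue_on Wc)"
  proof (rule measurable_cong[THEN iffD1, rotated])
    fix y assume "y \<in> space (lebesgue_on Wc)"
    then have y: "y \<in> Wc" by (simp add: space_restrict_space)
    have "det (gm c y) \<noteq> 0" using gm_det_pos[OF c in_Wc(4)[OF y]] by simp
    then have "X (chart_inv c y) c = (\<chi> k. det (\<chi> i j. if j = k then Gc y $ i else gm c y $ i $ j) / det (gm c y))"
      by (rule cramer[THEN iffD1]) (rule Gc_eq[OF y, symmetric])
    from arg_cong[OF this, of "\<lambda>v. v $ k"]
    show "det (\<chi> i j. if j = k then Gc y $ i else gm c y $ i $ j) / det (gm c y) = X (chart_inv c y) c $ k"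
      by (simp only: vec_lambda_beta)
  qed
qed

lemma Ac_measurable: "Ac \<in> borel_measurable (lebesgue_on Wc)"
proof -
  note [measurable] = X_measurable qc_measurable dens_measurable[OF c \<Omega>]
  have "(\<lambda>y. (dens c y * qc y powr (p - 2)) *\<^sub>R X (chart_inv c y) c) \<in> borel_measurable (lebesgue_on Wc)"
    by measurable
  then show ?thesis
    by (rule measurable_cong[THEN iffD1, rotated]) (auto simp: Ac_def space_restrict_space)
qed

text \<open>\<open>Gc\<close> pairs the gradient with coordinate vectors, so Cauchy-Schwarz bounds
  it by qc times their lengths. For \<open>Ac\<close> the coordinate vector of the gradient is
  bounded by qc through ellipticity. Continuity on the compact set makes the constants
  uniform.\<close>

lemma coefficient_bounds:
  assumes K: "compact K" "K \<subseteq> Wc"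
  shows "\<exists>C\<ge>0. \<forall>y\<in>K. norm (Ac y) \<le> C * qc y powr (p - 1) \<and> norm (Gc y) \<le> C * qc y"
proof -
  have KV: "K \<subseteq> snd c ` fst c" using K by blast
  obtain l where l: "l > 0" "\<And>y \<xi>. y \<in> K \<Longrightarrow> l * (norm \<xi>)\<^sup>2 \<le> \<xi> \<bullet> (gm c y *v \<xi>)"
    using gm_elliptic[OF c K(1) KV] by blast
  have "bounded ((\<lambda>y. \<Sum>i\<in>UNIV. sqrt (gm c y $ i $ i)) ` K)" "bounded (dens c ` K)"
    by (intro compact_imp_bounded compact_continuous_image K continuous_intros
        continuous_on_subset[OF gm_continuous[OF c] KV] continuous_on_subset[OF dens_continuous[OF c] KV])+
  then obtain C1 C2 where C1: "\<And>y. y \<in> K \<Longrightarrow> \<bar>\<Sum>i\<in>UNIV. sqrt (gm c y $ i $ i)\<bar> \<le> C1" and C2: "\<And>y. y \<in> K \<Longrightarrow> \<bar>dens c y\<bar> \<le> C2"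
    by (auto simp: bounded_iff)
  define C where "C = \<bar>C1\<bar> + \<bar>C2\<bar> / sqrt l"
  show ?thesis
  proof (intro exI[of _ C] conjI ballI)
    show "C \<ge> 0" using l by (simp add: C_def)
    fix y assume yK: "y \<in> K"
    then have y: "y \<in> Wc" using K by blast
    let ?V = "X (chart_inv c y) c"
    note cx = in_Wc(1)[OF y] and T = X_tangent[OF in_Wc(3)[OF y]]
    have "\<bar>Gc y $ i\<bar> \<le> qc y * sqrt (gm c y $ i $ i)" for i
      using metric_Cauchy_Schwarz[OF T coord_vec_in[OF cx]] gm_eq[OF cx, of i i] in_Wc(2)[OF y] y
      by (simp add: Gc_def Let_def qc_def tnorm_def)
    then have "(\<Sum>i\<in>UNIV. \<bar>Gc y $ i\<bar>) \<le> (\<Sum>i\<in>UNIV. qc y * sqrt (gm c y $ i $ i))" by (intro sum_mono)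
    also have "\<dots> = qc y * (\<Sum>i\<in>UNIV. sqrt (gm c y $ i $ i))" by (simp add: sum_distrib_left)
    also have "\<dots> \<le> qc y * C"
      using C1[OF yK] qc_nonneg l by (intro mult_left_mono) (auto simp: C_def intro: add_increasing2)
    finally show "norm (Gc y) \<le> C * qc y" using norm_le_l1_cart[of "Gc y"] by (simp add: mult.commute)
    have "(sqrt l * norm ?V)\<^sup>2 \<le> (qc y)\<^sup>2"
      using l(2)[OF yK, of ?V] qc_square[OF y] l(1) by (simp add: power_mult_distrib)
    then have "sqrt l * norm ?V \<le> qc y" using qc_nonneg by (rule power2_le_imp_le)
    then have V: "norm ?V \<le> qc y / sqrt l" using l by (simp add: pos_le_divide_eq mult.commute)
    have "norm (Ac y) = \<bar>dens c y\<bar> * (qc y powr (p - 2) * norm ?V)" using y by (simp add: Ac_def abs_mult)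
    also have "\<dots> \<le> \<bar>C2\<bar> * (qc y powr (p - 2) * (qc y / sqrt l))"
      using C2[OF yK] V by (intro mult_mono mult_left_mono) auto
    also have "\<dots> = \<bar>C2\<bar> / sqrt l * qc y powr (p - 1)"
      using qc_nonneg[of y] p by (cases "qc y = 0") (auto simp: powr_diff power2_eq_square)
    also have "\<dots> \<le> C * qc y powr (p - 1)" by (intro mult_right_mono) (auto simp: C_def)
    finally show "norm (Ac y) \<le> C * qc y powr (p - 1)" .
  qed
qed

text \<open>The test function, extended by zero, is admissible on the manifold. Its pairing with
  \<open>X\<close> is the differential applied to \<open>X\<close>, and the change of variables
  moves the density into \<open>Ac\<close>.\<close>

lemma weak_ineq_chart:
  assumes f: "C1c Wc f D" "\<And>y. f y \<ge> 0"
  shows "0 \<le> (p - 1 - \<alpha>) * (LINT y:Wc|lebesgue. Ac y \<bullet> D y)"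
proof -
  define \<phi> where "\<phi> = from_chart c f"
  have \<phi>: "\<phi> \<in> C0k M 1 \<Omega>" "\<And>x. \<phi> x \<ge> 0"
    using from_chart_C0k[OF c f(1)] f(2) by (auto simp: \<phi>_def from_chart_def)
  obtain K where K: "compact K" "K \<subseteq> Wc" "\<And>y. y \<notin> K \<Longrightarrow> f y = 0"
    and D: "\<And>y. (f has_derivative (\<lambda>v. D y \<bullet> v)) (at y)" "continuous_on UNIV D"
    using f unfolding C1c_def by blast
  let ?K = "chart_inv c ` K"
  have Kc: "compact ?K" "?K \<subseteq> fst c \<inter> \<Omega>" using chart_inv_compact[OF c \<Omega> K(1,2)] by auto
  have z: "\<phi> x = 0" if "x \<notin> ?K" for x
  proof (cases "x \<in> fst c")
    case True
    have "snd c x \<notin> K" using that chart_inv_chart[OF c True] by (metis image_eqI)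
    then show ?thesis using K by (simp add: \<phi>_def from_chart_def)
  qed (simp add: \<phi>_def from_chart_def)
  define h where "h x = tX x powr (p - 2) * (D (snd c x) \<bullet> X x c)" for x
  have eq: "indicator \<Omega> x *\<^sub>R (tX x powr (p - 2) * dX \<phi> x) = indicator (fst c \<inter> \<Omega>) x * h x" for x
  proof (cases "x \<in> \<Omega>"; cases "x \<in> fst c")
    assume x: "x \<in> \<Omega>" "x \<in> fst c"
    then have cx: "c \<in> charts_at M x" and y: "snd c x \<in> snd c ` fst c" using c by (auto simp: charts_at_def)
    have "(\<phi> \<circ> chart_inv c has_derivative (\<lambda>v. D (snd c x) \<bullet> v)) (at (snd c x))"
      by (rule has_derivative_transform_within_open[OF D(1) chart_open(2)[OF c] y])
        (auto simp: \<phi>_def from_chart_def chart_inv_chart[OF c])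
    from frechet_derivative_at[OF this] have "dX \<phi> x = D (snd c x) \<bullet> X x c"
      using grad_C0k(2)[OF \<phi>(1) X_tangent[OF x(1)] cx] by metis
    then show ?thesis using x by (simp add: h_def)
  next
    assume x: "x \<in> \<Omega>" "x \<notin> fst c"
    then have "x \<notin> ?K" using Kc by blast
    then show ?thesis using x metric_grad_eq_0[OF \<phi>(1) Kc(1) z _ X_tangent[OF x(1)]] by simp
  qed auto
  have hm: "h \<in> borel_measurable (restrict_space vol (fst c \<inter> \<Omega>))"
  proof (rule measurable_from_chart[OF c \<Omega>])
    have [measurable]: "D \<in> borel_measurable (lebesgue_on Wc)"
      by (rule continuous_measurable_restrict_lebesgue[OF D(2)])
    note [measurable] = X_measurable qc_measurable
    have "(\<lambda>y. qc y powr (p - 2) * (D y \<bullet> X (chart_inv c y) c)) \<in> borel_measurable (lebesgue_on Wc)"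
      by measurable
    then show "h \<circ> chart_inv c \<in> borel_measurable (lebesgue_on Wc)"
      by (rule measurable_cong[THEN iffD1, rotated]) (auto simp: h_def qc_def space_restrict_space chart_inv_chart[OF c])
  qed
  have "0 \<le> (p - 1 - \<alpha>) * (LINT x:\<Omega>|vol. tX x powr (p - 2) * dX \<phi> x)"
    using weak \<phi> unfolding weak_p_Laplace_ineq_def by blast
  also have "(LINT x:\<Omega>|vol. tX x powr (p - 2) * dX \<phi> x) = (\<integral>x. indicator (fst c \<inter> \<Omega>) x * h x \<partial>vol)"
    unfolding set_lebesgue_integral_def by (intro Bochner_Integration.integral_cong refl eq)
  also have "\<dots> = (\<integral>y. indicator Wc y * (dens c y * h (chart_inv c y)) \<partial>lebesgue)"
    by (rule integral_chart(2)[OF c \<Omega> hm])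
  also have "\<dots> = (LINT y:Wc|lebesgue. Ac y \<bullet> D y)"
    unfolding set_lebesgue_integral_def
    by (intro Bochner_Integration.integral_cong refl)
      (auto simp: h_def Ac_def qc_def indicator_def chart_inv_chart[OF c] inner_commute)
  finally show ?thesis .
qed

lemma chart_supersolution_c: "chart_supersolution Wc rc Gc Ac qc p (p - 1 - \<alpha>)"
proof
  show "open Wc" by (rule W_open[OF c \<Omega>])
  show "(\<integral>\<^sup>+y\<in>K. ennreal (qc y powr p) \<partial>lebesgue) < \<infinity>" if K: "compact K" "K \<subseteq> Wc" for K
  proof -
    have "(\<integral>\<^sup>+y\<in>K. ennreal (norm (tX (chart_inv c y)) powr p) \<partial>lebesgue) < \<infinity>"
    proof (rule local_integrability_chart[OF c \<Omega> _ _ K])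
      note [measurable] = tX_measurable
      show "(\<lambda>x. ennreal (norm (tX x) powr p)) \<in> borel_measurable (restrict_space vol \<Omega>)" by measurable
      show "(\<integral>\<^sup>+x\<in>K. ennreal (norm (tX x) powr p) \<partial>vol) < \<infinity>" if "compact K" "K \<subseteq> \<Omega>" for K
        using \<rho> that by (simp add: W1p_loc_def Lp_loc_def)
    qed
    also have "(\<integral>\<^sup>+y\<in>K. ennreal (norm (tX (chart_inv c y)) powr p) \<partial>lebesgue) = (\<integral>\<^sup>+y\<in>K. ennreal (qc y powr p) \<partial>lebesgue)"
      using K tX_nonneg[OF in_Wc(3)] by (intro nn_integral_cong) (auto simp: indicator_def qc_def)
    finally show ?thesis .
  qed
  show "AE y in lebesgue. y \<in> Wc \<longrightarrow> 0 \<le> rc y"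
    using AE_chart[OF c \<Omega> nonneg] by (simp add: rc_def)
  show "0 \<le> (p - 1 - \<alpha>) * (LINT y:Wc|lebesgue. Ac y \<bullet> D y)" if "C1c Wc f D" "\<And>y. f y \<ge> 0" for f D
    using that by (rule weak_ineq_chart)
qed (use p weak_partials_c Ac_measurable qc_measurable qc_nonneg coefficient_bounds in auto)

text \<open>The estimate \<open>caccioppoli\<close> transported back to the manifold. Since
  \<open>w\<close> is supported inside one chart, both integrals reduce to that chart, and A . G
  becomes the density times |grad \<rho>|^p.\<close>

lemma caccioppoli_vol:
  assumes b: "p - 1 - \<alpha> \<noteq> 0" and w: "w \<in> C0k M 1 \<Omega>" "\<And>x. w x \<ge> 0"
    and K: "compact K" "K \<subseteq> fst c \<inter> \<Omega>" "\<And>x. x \<notin> K \<Longrightarrow> w x = 0"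
  defines "k \<equiv> \<lambda>x. indicator \<Omega> x * (\<rho> x powr (- (p - 1 - \<alpha>)) * (tX x powr (p - 2) * dX w x))"
  shows "integrable vol k"
    "(\<integral>\<^sup>+x. ennreal ((p - 1 - \<alpha>)\<^sup>2 * (indicator \<Omega> x * (w x * \<rho> x powr (\<alpha> - p) * tX x powr p))) \<partial>vol) \<le> ennreal ((p - 1 - \<alpha>) * (\<integral>x. k x \<partial>vol))"
    "0 \<le> (p - 1 - \<alpha>) * (\<integral>x. k x \<partial>vol)"
proof -
  interpret chart_supersolution Wc rc Gc Ac qc p "p - 1 - \<alpha>" by (rule chart_supersolution_c)
  define b where "b = p - 1 - \<alpha>"
  define f where "f = to_chart c w"
  define D where "D = grad_vec (to_chart c w)"
  have f: "C1c Wc f D" "\<And>y. f y \<ge> 0"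
    using to_chart_C1c[OF c w(1) K] w(2) by (auto simp: f_def D_def to_chart_def)
  have AG: "Ac y \<bullet> Gc y \<ge> 0" if "y \<in> Wc" for y
    using Ac_Gc[OF that] dens_pos[OF c in_Wc(4)[OF that]] by simp
  have f1: "(\<integral>\<^sup>+y\<in>L. ennreal (qc y powr p) / epowr (rc y) (p - \<alpha>) \<partial>lebesgue) < \<infinity>" if L: "compact L" "L \<subseteq> Wc" for L
  proof -
    have "(\<integral>\<^sup>+y\<in>L. ennreal (tX (chart_inv c y) powr p) / epowr (\<rho> (chart_inv c y)) (p - \<alpha>) \<partial>lebesgue) < \<infinity>"
      using ii1 unfolding L1_loc_nonneg_def by (intro local_integrability_chart[OF c \<Omega> _ _ L]) auto
    also have "(\<integral>\<^sup>+y\<in>L. ennreal (tX (chart_inv c y) powr p) / epowr (\<rho> (chart_inv c y)) (p - \<alpha>) \<partial>lebesgue)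
      = (\<integral>\<^sup>+y\<in>L. ennreal (qc y powr p) / epowr (rc y) (p - \<alpha>) \<partial>lebesgue)"
      using L by (intro nn_integral_cong) (auto simp: indicator_def qc_def rc_def)
    finally show ?thesis .
  qed
  have f2: "(\<integral>\<^sup>+y\<in>L. epowr (rc y) \<alpha> \<partial>lebesgue) < \<infinity>" if L: "compact L" "L \<subseteq> Wc" for L
    unfolding rc_def comp_def
    using ii2 unfolding L1_loc_nonneg_def by (intro local_integrability_chart[OF c \<Omega> _ _ L]) auto
  note cacc = caccioppoli[OF refl b AG f1 f2 f]
  define h where "h x = \<rho> x powr (- b) * (tX x powr (p - 2) * (D (snd c x) \<bullet> X x c))" for x
  have keq: "k = (\<lambda>x. indicator (fst c \<inter> \<Omega>) x * h x)"
  proof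
    fix x
    show "k x = indicator (fst c \<inter> \<Omega>) x * h x"
    proof (cases "x \<in> \<Omega>"; cases "x \<in> fst c")
      assume x: "x \<in> \<Omega>" "x \<in> fst c"
      then have cx: "c \<in> charts_at M x" using c by (auto simp: charts_at_def)
      show ?thesis using x to_chart_grad[OF cx w(1) X_tangent[OF x(1)]] by (simp add: k_def h_def D_def b_def)
    next
      assume x: "x \<in> \<Omega>" "x \<notin> fst c"
      then have "x \<notin> K" using K by blast
      then show ?thesis using x metric_grad_eq_0[OF w(1) K(1,3) _ X_tangent[OF x(1)]] by (simp add: k_def)
    qed (auto simp: k_def)
  qed
  have [measurable]: "D \<in> borel_measurable (lebesgue_on Wc)"
    using f(1) unfolding C1c_def by (intro continuous_measurable_restrict_lebesgue) blast
  note [measurable] = X_measurable qc_measurable rm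
  have hm: "h \<in> borel_measurable (restrict_space vol (fst c \<inter> \<Omega>))"
  proof (rule measurable_from_chart[OF c \<Omega>])
    have "(\<lambda>y. rc y powr (- b) * (qc y powr (p - 2) * (D y \<bullet> X (chart_inv c y) c))) \<in> borel_measurable (lebesgue_on Wc)"
      by measurable
    then show "h \<circ> chart_inv c \<in> borel_measurable (lebesgue_on Wc)"
      by (rule measurable_cong[THEN iffD1, rotated])
        (auto simp: h_def qc_def rc_def space_restrict_space chart_inv_chart[OF c])
  qed
  have heq: "indicator Wc y * (dens c y * h (chart_inv c y)) = indicator Wc y * (rc y powr (- b) * (Ac y \<bullet> D y))" for y
    by (auto simp: h_def Ac_def qc_def rc_def indicator_def chart_inv_chart[OF c] inner_commute)
  have int: "(\<integral>x. k x \<partial>vol) = (\<integral>y. indicator Wc y * (rc y powr (- b) * (Ac y \<bullet> D y)) \<partial>lebesgue)"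
    unfolding keq integral_chart(2)[OF c \<Omega> hm] heq ..
  show "integrable vol k"
    unfolding keq integral_chart(1)[OF c \<Omega> hm] heq using cacc(1) by (simp add: b_def)
  show "0 \<le> (p - 1 - \<alpha>) * (\<integral>x. k x \<partial>vol)"
    using cacc(3) int by (simp add: b_def)
  define g where "g x = ennreal (b\<^sup>2 * (w x * \<rho> x powr (\<alpha> - p) * tX x powr p))" for x
  have gm: "g \<in> borel_measurable (restrict_space vol (fst c \<inter> \<Omega>))"
  proof (rule measurable_from_chart[OF c \<Omega>])
    have "continuous_on UNIV f" using f(1) unfolding C1c_def
      by (intro continuous_at_imp_continuous_on ballI) (blast intro: has_derivative_continuous)
    then have [measurable]: "f \<in> borel_measurable (lebesgue_on Wc)"
      by (rule continuous_measurable_restrict_lebesgue)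
    have "(\<lambda>y. ennreal (b\<^sup>2 * (f y * rc y powr (\<alpha> - p) * qc y powr p))) \<in> borel_measurable (lebesgue_on Wc)"
      by measurable
    then show "g \<circ> chart_inv c \<in> borel_measurable (lebesgue_on Wc)"
      by (rule measurable_cong[THEN iffD1, rotated])
        (auto simp: g_def qc_def rc_def f_def to_chart_def space_restrict_space chart_inv_chart[OF c])
  qed
  have "(\<integral>\<^sup>+x. ennreal ((p - 1 - \<alpha>)\<^sup>2 * (indicator \<Omega> x * (w x * \<rho> x powr (\<alpha> - p) * tX x powr p))) \<partial>vol)
     = (\<integral>\<^sup>+x\<in>fst c \<inter> \<Omega>. g x \<partial>vol)"
  proof (rule nn_integral_cong)
    fix x
    have "w x = 0" if "x \<notin> fst c" using that K by blast
    then show "ennreal ((p - 1 - \<alpha>)\<^sup>2 * (indicator \<Omega> x * (w x * \<rho> x powr (\<alpha> - p) * tX x powr p))) = g x * indicator (fst c \<inter> \<Omega>) x"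
      by (cases "x \<in> fst c"; cases "x \<in> \<Omega>") (simp_all add: g_def b_def)
  qed
  also have "\<dots> = (\<integral>\<^sup>+y\<in>Wc. ennreal (dens c y) * g (chart_inv c y) \<partial>lebesgue)"
    by (rule nn_integral_chart[OF c \<Omega> gm])
  also have "\<dots> = (\<integral>\<^sup>+y. ennreal (b\<^sup>2 * (indicator Wc y * (f y * rc y powr (\<alpha> - p) * (Ac y \<bullet> Gc y)))) \<partial>lebesgue)"
  proof (rule nn_integral_cong)
    fix y
    show "ennreal (dens c y) * g (chart_inv c y) * indicator Wc y
        = ennreal (b\<^sup>2 * (indicator Wc y * (f y * rc y powr (\<alpha> - p) * (Ac y \<bullet> Gc y))))"
    proof (cases "y \<in> Wc")
      case True
      have "ennreal (dens c y) * g (chart_inv c y) = ennreal (dens c y * (b\<^sup>2 * (w (chart_inv c y) * \<rho> (chart_inv c y) powr (\<alpha> - p) * tX (chart_inv c y) powr p)))"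
        unfolding g_def using dens_pos[OF c in_Wc(4)[OF True]] w(2) by (simp add: ennreal_mult)
      also have "\<dots> = ennreal (b\<^sup>2 * (f y * rc y powr (\<alpha> - p) * (Ac y \<bullet> Gc y)))"
        using True Ac_Gc[OF True] in_Wc(4)[OF True] by (simp add: f_def to_chart_def rc_def qc_def mult_ac)
      finally show ?thesis using True by simp
    qed simp
  qed
  also have "\<dots> \<le> ennreal (b * (\<integral>y. indicator Wc y * (rc y powr (- b) * (Ac y \<bullet> D y)) \<partial>lebesgue))"
    using cacc(2) by (simp add: b_def)
  finally show "(\<integral>\<^sup>+x. ennreal ((p - 1 - \<alpha>)\<^sup>2 * (indicator \<Omega> x * (w x * \<rho> x powr (\<alpha> - p) * tX x powr p))) \<partial>vol) \<le> ennreal ((p - 1 - \<alpha>) * (\<integral>x. k x \<partial>vol))"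
    using int by (simp add: b_def)
qed

end

end

section \<open>From charts to the manifold: decomposition, summation and absorption\<close>

context hardy
begin

text \<open>The function, its chart and its compact support are packed into one tuple, so that a
  single application of choice selects them together for every point.\<close>

lemma chart_bump:
  assumes x: "x \<in> \<Omega>"
  shows "\<exists>t. fst (snd t) \<in> charts M \<and> fst t \<in> C0k M 1 \<Omega> \<and> (\<forall>z. fst t z \<ge> 0) \<and>
    compact (snd (snd t)) \<and> snd (snd t) \<subseteq> fst (fst (snd t)) \<inter> \<Omega> \<and>
    (\<forall>z. z \<notin> snd (snd t) \<longrightarrow> fst t z = 0) \<and> fst t x > 0"
proof -
  obtain c where "c \<in> charts_at M x" by (rule chart_exists)
  then have c: "c \<in> charts M" "x \<in> fst c" by (auto simp: charts_at_def)
  let ?y = "snd c x" and ?W = "snd c ` (fst c \<inter> \<Omega>)"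
  have "open ?W" "?y \<in> ?W" using c x \<Omega> by (auto intro: chart_image_open)
  then obtain r where r: "r > 0" "cball ?y r \<subseteq> ?W" using open_contains_cball by blast
  have "C1c ?W (bump ?y r) (grad_vec (bump ?y r))"
    by (rule C1c_grad_vec[OF _ compact_cball r(2) bump_support[OF r(1)]])
      (use smooth_on_bump[of ?y r] in \<open>simp add: smooth_on_def\<close>)
  then have C0: "from_chart c (bump ?y r) \<in> C0k M 1 \<Omega>" by (rule from_chart_C0k[OF c(1)])
  note K = chart_inv_compact[OF c(1) \<Omega> compact_cball r(2)]
  have z: "from_chart c (bump ?y r) z = 0" if "z \<notin> chart_inv c ` cball ?y r" for z
  proof (cases "z \<in> fst c")
    case True
    have "snd c z \<notin> cball ?y r" using that chart_inv_chart[OF c(1) True] by (metis image_eqI)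
    from bump_support[OF r(1) this] show ?thesis by (simp add: from_chart_def)
  qed (simp add: from_chart_def)
  have "from_chart c (bump ?y r) x > 0" using bump_pos_iff[OF r(1), of ?y ?y] r c by (simp add: from_chart_def)
  moreover have "from_chart c (bump ?y r) z \<ge> 0" for z by (simp add: from_chart_def bump_nonneg)
  ultimately show ?thesis using c C0 K z
    by (intro exI[of _ "(from_chart c (bump ?y r), c, chart_inv c ` cball ?y r)"]) simp
qed

text \<open>Finitely many bumps cover the support of \<open>u\<close>; dividing by their sum S gives
  w_j = |u|^p \<beta>_j / S. Where S may vanish so does \<open>u\<close>. The power is C^1 because p
  > 1, which is all the regularity that the test functions need.\<close>

lemma abs_powr_decomposition:
  assumes u: "u \<in> C0k M 1 \<Omega>"
  obtains J :: "'m set" and w c K where "finite J"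
    "\<And>j. j \<in> J \<Longrightarrow> c j \<in> charts M" "\<And>j. j \<in> J \<Longrightarrow> w j \<in> C0k M 1 \<Omega>" "\<And>j x. w j x \<ge> 0"
    "\<And>j. j \<in> J \<Longrightarrow> compact (K j)" "\<And>j. j \<in> J \<Longrightarrow> K j \<subseteq> fst (c j) \<inter> \<Omega>"
    "\<And>j x. j \<in> J \<Longrightarrow> x \<notin> K j \<Longrightarrow> w j x = 0" "\<And>x. (\<Sum>j\<in>J. w j x) = \<bar>u x\<bar> powr p"
proof -
  define Z where "Z = closure {x. u x \<noteq> 0}"
  have Z: "compact Z" "Z \<subseteq> \<Omega>" using u by (auto simp: C0k_def compactly_supported_in_def Z_def)
  have uZ: "u x = 0" if "x \<notin> Z" for x using that closure_subset[of "{x. u x \<noteq> 0}"] by (auto simp: Z_def)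
  have "\<forall>x\<in>\<Omega>. \<exists>t. fst (snd t) \<in> charts M \<and> fst t \<in> C0k M 1 \<Omega> \<and> (\<forall>z. fst t z \<ge> 0) \<and>
    compact (snd (snd t)) \<and> snd (snd t) \<subseteq> fst (fst (snd t)) \<inter> \<Omega> \<and>
    (\<forall>z. z \<notin> snd (snd t) \<longrightarrow> fst t z = 0) \<and> fst t x > 0"
    by (intro ballI chart_bump)
  from bchoice[OF this] obtain T where T: "\<forall>x\<in>\<Omega>. fst (snd (T x)) \<in> charts M \<and> fst (T x) \<in> C0k M 1 \<Omega> \<and>
    (\<forall>z. fst (T x) z \<ge> 0) \<and> compact (snd (snd (T x))) \<and> snd (snd (T x)) \<subseteq> fst (fst (snd (T x))) \<inter> \<Omega> \<and>
    (\<forall>z. z \<notin> snd (snd (T x)) \<longrightarrow> fst (T x) z = 0) \<and> fst (T x) x > 0"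
    by (elim exE) (rule that)
  define \<beta> where "\<beta> x = fst (T x)" for x
  define c where "c x = fst (snd (T x))" for x
  define K where "K x = snd (snd (T x))" for x
  have t: "c x \<in> charts M" "\<beta> x \<in> C0k M 1 \<Omega>" "\<And>z. \<beta> x z \<ge> 0" "compact (K x)" "K x \<subseteq> fst (c x) \<inter> \<Omega>"
    "\<And>z. z \<notin> K x \<Longrightarrow> \<beta> x z = 0" "\<beta> x x > 0" if "x \<in> \<Omega>" for x
    unfolding \<beta>_def c_def K_def using bspec[OF T that] by blast+
  have "open {z. \<beta> x z > 0}" if "x \<in> Z" for x
    by (rule open_Collect_less[OF continuous_on_const C0k_continuous[OF t(2)]]) (use that Z in blast)
  moreover have "Z \<subseteq> (\<Union>x\<in>Z. {z. \<beta> x z > 0})" using t(7) Z by blast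
  ultimately obtain J where J: "J \<subseteq> Z" "finite J" "Z \<subseteq> (\<Union>x\<in>J. {z. \<beta> x z > 0})"
    using compactE_image[OF Z(1)] by metis
  then have JO: "j \<in> J \<Longrightarrow> j \<in> \<Omega>" for j using Z by blast
  define S where "S z = (\<Sum>j\<in>J. \<beta> j z)" for z
  have S: "S z > 0" if "z \<in> Z" for z
  proof -
    have "z \<in> (\<Union>x\<in>J. {z. \<beta> x z > 0})" using J(3) that by (rule subsetD)
    then obtain j where "j \<in> J" "\<beta> j z > 0" by auto
    then show ?thesis unfolding S_def using J(2) t(3)[OF JO] by (intro sum_pos2[of J j]) auto
  qed
  have Sc: "continuous_on UNIV S"
    unfolding S_def[abs_def] by (intro continuous_on_sum C0k_continuous[OF t(2)[OF JO]])
  define w where "w j z = (if j \<in> J then \<bar>u z\<bar> powr p * \<beta> j z * inverse (S z) else 0)" for j z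
  have wK: "w j x = 0" if "j \<in> J" "x \<notin> K j" for j x using t(6)[OF JO] that by (simp add: w_def)
  have "w j \<in> C0k M 1 \<Omega>" if j: "j \<in> J" for j
    unfolding C0k_def mem_Collect_eq
  proof (intro conjI ballI)
    show "compactly_supported_in \<Omega> (w j)"
      by (rule compactly_supported_inI[OF t(4)[OF JO[OF j]]]) (use t(5)[OF JO[OF j]] wK[OF j] in auto)
    fix d assume d: "d \<in> charts M"
    \<comment> \<open>In each chart: on ?A the quotient is C^1 because S > 0, on ?B it is 0 because
      \<open>u\<close> is, and S > 0 on the support of \<open>u\<close> makes the two sets
      cover.\<close>
    let ?A = "snd d ` fst d \<inter> chart_inv d -` {z. S z > 0}" and ?B = "snd d ` fst d \<inter> chart_inv d -` (- Z)"
    have oS: "open {z. S z > 0}" "open (- Z)"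
      by (rule open_Collect_less[OF continuous_on_const Sc]) (rule open_Compl[OF compact_imp_closed[OF Z(1)]])
    note o = oS[THEN chart_preimage_open[OF d]]
    have Ck: "Ck_on 1 ?A (f \<circ> chart_inv d)" if "f \<in> C0k M 1 \<Omega>" for f
      by (rule Ck1_subset[of "snd d ` fst d"]) (use that d in \<open>auto simp: C0k_def\<close>)
    have "Ck_on 1 ?A (\<lambda>y. \<Sum>j\<in>J. (\<beta> j \<circ> chart_inv d) y)" by (intro Ck1_sum Ck t JO)
    then have "Ck_on 1 ?A (\<lambda>y. \<bar>(u \<circ> chart_inv d) y\<bar> powr p * (\<beta> j \<circ> chart_inv d) y * inverse (\<Sum>j\<in>J. (\<beta> j \<circ> chart_inv d) y))"
      using p by (intro Ck1_mult Ck1_inverse Ck1_abs_powr Ck u t JO j) (auto simp: S_def)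
    then have 1: "Ck_on 1 ?A (w j \<circ> chart_inv d)"
      by (rule Ck1_cong[OF o(1)]) (simp add: w_def S_def j)
    have 2: "Ck_on 1 ?B (w j \<circ> chart_inv d)"
      by (rule Ck1_cong[OF o(2) Ck1_const[of _ 0]]) (use uZ p in \<open>simp add: w_def\<close>)
    have "snd d ` fst d = ?A \<union> ?B" using S by blast
    then show "Ck_on 1 (snd d ` fst d) (w j \<circ> chart_inv d)" using Ck1_Un[OF o 1 2] by simp
  qed
  moreover have "w j x \<ge> 0" for j x
    unfolding w_def S_def using t(3)[OF JO] by (auto intro!: mult_nonneg_nonneg sum_nonneg)
  moreover have "(\<Sum>j\<in>J. w j x) = \<bar>u x\<bar> powr p" for x
  proof (cases "x \<in> Z")
    case True
    have "(\<Sum>j\<in>J. w j x) = \<bar>u x\<bar> powr p * S x * inverse (S x)"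
      unfolding S_def sum_distrib_left sum_distrib_right by (simp add: w_def S_def)
    then show ?thesis using S[OF True] by simp
  next
    case False
    then show ?thesis using uZ by (simp add: w_def)
  qed
  ultimately show thesis using that[of J c w K] J(2) t(1,4,5) JO wK by blast
qed

lemma restrict_indicator_measurable:
  fixes f :: "'m \<Rightarrow> real"
  assumes "f \<in> borel_measurable (restrict_space vol \<Omega>)"
  shows "(\<lambda>x. indicator \<Omega> x * f x) \<in> borel_measurable vol"
  using assms sets_vol_open[OF \<Omega>] by (subst (asm) borel_measurable_restrict_space_iff) auto

text \<open>Differentiation is linear and the \<open>w j\<close> add up to |u|^p, so the cutoffs
  leave no trace and the sum is given by the chain rule for |u|^p.\<close>

lemma dX_sum:
  assumes u: "u \<in> C0k M 1 \<Omega>" and w: "\<And>j. j \<in> J \<Longrightarrow> w j \<in> C0k M 1 \<Omega>"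
    and sum: "\<And>x. (\<Sum>j\<in>J. w j x) = \<bar>u x\<bar> powr p" and x: "x \<in> \<Omega>"
  shows "(\<Sum>j\<in>J. dX (w j) x) = p * \<bar>u x\<bar> powr (p - 1) * sgn (u x) * dX u x"
proof -
  obtain c where cx: "c \<in> charts_at M x" by (rule chart_exists)
  then have c: "c \<in> charts M" "x \<in> fst c" by (auto simp: charts_at_def)
  let ?y = "snd c x"
  have d: "(f \<circ> chart_inv c has_derivative frechet_derivative (f \<circ> chart_inv c) (at ?y)) (at ?y)" if "f \<in> C0k M 1 \<Omega>" for f
    using C0k_differentiable[OF that cx] frechet_derivative_works by blast
  have "((\<lambda>y. \<Sum>j\<in>J. (w j \<circ> chart_inv c) y) has_derivative (\<lambda>v. \<Sum>j\<in>J. frechet_derivative (w j \<circ> chart_inv c) (at ?y) v)) (at ?y)"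
    by (intro has_derivative_sum d w)
  moreover have "(\<lambda>y. \<Sum>j\<in>J. (w j \<circ> chart_inv c) y) = (\<lambda>y. \<bar>(u \<circ> chart_inv c) y\<bar> powr p)" using sum by simp
  moreover have "((\<lambda>y. \<bar>(u \<circ> chart_inv c) y\<bar> powr p) has_derivative
      (\<lambda>v. frechet_derivative (u \<circ> chart_inv c) (at ?y) v * (p * \<bar>(u \<circ> chart_inv c) ?y\<bar> powr (p - 1) * sgn ((u \<circ> chart_inv c) ?y)))) (at ?y)"
    by (rule DERIV_compose_FDERIV[OF abs_powr_DERIV[OF p] d[OF u]])
  ultimately have "(\<lambda>v. \<Sum>j\<in>J. frechet_derivative (w j \<circ> chart_inv c) (at ?y) v)
     = (\<lambda>v. frechet_derivative (u \<circ> chart_inv c) (at ?y) v * (p * \<bar>(u \<circ> chart_inv c) ?y\<bar> powr (p - 1) * sgn ((u \<circ> chart_inv c) ?y)))"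
    using has_derivative_unique by metis
  from fun_cong[OF this, of "X x c"] show ?thesis
    using grad_C0k(2)[OF u X_tangent[OF x] cx] grad_C0k(2)[OF w X_tangent[OF x] cx] chart_inv_chart[OF c]
    by (simp add: mult_ac)
qed

text \<open>With A = |m| t r^((\<alpha>-p)/p) and B = r^(\<alpha>/p) g, the exponents of r in
  A^(p-1) B add up to -b, so the left side is at most |b| p A^(p-1) B. Young's inequality with
  weight s then splits it into the Hardy term and the energy term. At r = 0 every real power of r is
  0.\<close>

lemma young_pointwise:
  fixes b s r t m d g :: real
  assumes b: "b = p - 1 - \<alpha>" "b \<noteq> 0" and s: "s = \<bar>b\<bar> / p"
    and nn: "r \<ge> 0" "t \<ge> 0" "g \<ge> 0" and d: "\<bar>d\<bar> \<le> t * g"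
  shows "b * (r powr (- b) * (t powr (p - 2) * (p * \<bar>m\<bar> powr (p - 1) * sgn m * d)))
    \<le> \<bar>b\<bar> * ((p - 1) * s * (\<bar>m\<bar> powr p * r powr (\<alpha> - p) * t powr p) + s powr (1 - p) * (r powr \<alpha> * g powr p))"
proof (cases "r = 0")
  case True
  then show ?thesis by simp
next
  case False
  then have r: "r > 0" using nn by simp
  have s0: "s > 0" using b p s by simp
  define A where "A = \<bar>m\<bar> * t * r powr ((\<alpha> - p) / p)"
  define B where "B = r powr (\<alpha> / p) * g"
  have A: "A \<ge> 0" and B: "B \<ge> 0" using nn by (auto simp: A_def B_def)
  have Ap: "A powr p = \<bar>m\<bar> powr p * r powr (\<alpha> - p) * t powr p"
    using nn p by (simp add: A_def powr_mult powr_powr)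
  have Bp: "B powr p = r powr \<alpha> * g powr p" using nn p by (simp add: B_def powr_mult powr_powr)
  have "(\<alpha> - p) / p * (p - 1) + \<alpha> / p = - b" unfolding b(1) using p by (simp add: field_simps)
  then have AB: "A powr (p - 1) * B = r powr (- b) * (t powr (p - 1) * (\<bar>m\<bar> powr (p - 1) * g))"
    using nn by (simp add: A_def B_def powr_mult powr_powr powr_add[symmetric])
  have "b * (r powr (- b) * (t powr (p - 2) * (p * \<bar>m\<bar> powr (p - 1) * sgn m * d)))
     \<le> \<bar>b * (r powr (- b) * (t powr (p - 2) * (p * \<bar>m\<bar> powr (p - 1) * sgn m * d)))\<bar>" by (rule abs_ge_self)
  also have "\<dots> \<le> \<bar>b\<bar> * (r powr (- b) * (t powr (p - 2) * (p * \<bar>m\<bar> powr (p - 1) * (t * g))))"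
  proof -
    have "\<bar>sgn m * d\<bar> \<le> t * g" using d nn by (cases "m = 0") (auto simp: abs_mult abs_sgn_eq)
    then show ?thesis using p unfolding abs_mult
      by (intro mult_left_mono) (auto simp: abs_mult mult.assoc intro!: mult_left_mono)
  qed
  also have "\<dots> = \<bar>b\<bar> * (p * (A powr (p - 1) * B))"
  proof -
    have "t powr (p - 2) * t = t powr (p - 1)"
      using nn p by (cases "t = 0") (auto simp: powr_diff power2_eq_square)
    then have "t powr (p - 2) * (p * \<bar>m\<bar> powr (p - 1) * (t * g)) = t powr (p - 1) * (p * \<bar>m\<bar> powr (p - 1) * g)"
      by (metis (no_types, opaque_lifting) mult.assoc mult.commute)
    then show ?thesis unfolding AB by (auto simp: mult_ac)
  qed
  also have "p * (A powr (p - 1) * B) \<le> (p - 1) * s * A powr p + s powr (1 - p) * B powr p"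
  proof -
    \<comment> \<open>The scaling by \<sigma> and \<sigma>^(1-p) leaves A^(p-1) B unchanged;
      \<sigma>^p = s puts exactly the weight s on A^p.\<close>
    define \<sigma> where "\<sigma> = s powr (1 / p)"
    have \<sigma>: "\<sigma> > 0" "\<sigma> powr p = s" using s0 p by (auto simp: \<sigma>_def powr_powr)
    have 1: "(\<sigma> * A) powr (p - 1) * (\<sigma> powr (1 - p) * B) = A powr (p - 1) * B"
    proof -
      have "(\<sigma> * A) powr (p - 1) * (\<sigma> powr (1 - p) * B) = (\<sigma> powr (p - 1) * \<sigma> powr (1 - p)) * (A powr (p - 1) * B)"
        using A \<sigma> by (simp add: powr_mult)
      also have "\<sigma> powr (p - 1) * \<sigma> powr (1 - p) = 1" using \<sigma> by (simp flip: powr_add)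
      finally show ?thesis by simp
    qed
    have 2: "(\<sigma> * A) powr p = s * A powr p" using A \<sigma> by (simp add: powr_mult)
    have "(\<sigma> powr (1 - p)) powr p = (\<sigma> powr p) powr (1 - p)" by (simp add: powr_powr mult.commute)
    then have 3: "(\<sigma> powr (1 - p) * B) powr p = s powr (1 - p) * B powr p" using B \<sigma> by (simp add: powr_mult)
    show ?thesis
      using young_powr[of p "\<sigma> * A" "\<sigma> powr (1 - p) * B"] p A B \<sigma> unfolding 2 3 mult.assoc[of p] 1 by (simp add: mult.assoc)
  qed
  finally show ?thesis unfolding Ap Bp by (simp add: mult_left_mono)
qed

text \<open>At a zero of \<rho> the quotient in (ii) is infinite unless the gradient vanishes, and
  an integrable function is finite almost everywhere.\<close>

lemma gradient_zero_AE:
  assumes K: "compact K" "K \<subseteq> \<Omega>" and \<alpha>: "\<alpha> < p"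
  shows "AE x in vol. x \<in> K \<and> \<rho> x = 0 \<longrightarrow> tX x = 0"
proof -
  let ?f = "\<lambda>x. ennreal (tX x powr p) / epowr (\<rho> x) (p - \<alpha>)"
  have "?f \<in> borel_measurable (restrict_space vol \<Omega>)" using ii1 by (simp add: L1_loc_nonneg_def)
  then have "(\<lambda>x. ?f x * indicator \<Omega> x) \<in> borel_measurable vol"
    using sets_vol_open[OF \<Omega>] by (subst (asm) borel_measurable_restrict_space_iff_ennreal) auto
  then have "(\<lambda>x. ?f x * indicator \<Omega> x * indicator K x) \<in> borel_measurable vol"
    using sets_vol_closed[OF compact_imp_closed[OF K(1)]] by (rule borel_measurable_times_ennreal[OF _ borel_measurable_indicator])
  also have "(\<lambda>x. ?f x * indicator \<Omega> x * indicator K x) = (\<lambda>x. ?f x * indicator K x)"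
    by (intro ext) (use K in \<open>auto simp: indicator_def\<close>)
  finally have m: "(\<lambda>x. ?f x * indicator K x) \<in> borel_measurable vol" .
  have "(\<integral>\<^sup>+x\<in>K. ?f x \<partial>vol) < \<infinity>" using ii1 K by (simp add: L1_loc_nonneg_def)
  then have "AE x in vol. ?f x * indicator K x \<noteq> \<infinity>" using m by (intro nn_integral_noteq_infinite) auto
  then show ?thesis
  proof eventually_elim
    case (elim x)
    show ?case
    proof (intro impI)
      assume x: "x \<in> K \<and> \<rho> x = 0"
      then have "ennreal (tX x powr p) = 0" using elim \<alpha> by (auto simp: epowr_def split: if_splits)
      then show "tX x = 0" using tX_nonneg[of x] x K by (auto simp: ennreal_eq_0_iff powr_eq_0_iff)
    qed
  qed
qed

text \<open>Summing the chart estimates gives b^2 times the integral of L at most b times the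
  integral of E. Young bounds b E pointwise by a multiple of L plus the energy density, and that
  multiple is absorbed on the left. For b = 0 the constant is 0.\<close>

lemma hardy_inequality:
  assumes u: "u \<in> C0k M 1 \<Omega>"
  shows "ennreal ((\<bar>p - 1 - \<alpha>\<bar> / p) powr p) *
      (\<integral>\<^sup>+x\<in>\<Omega>. epowr (\<rho> x) \<alpha> * (ennreal (\<bar>u x\<bar> powr p) / epowr (\<rho> x) p) * ennreal (tX x powr p) \<partial>vol)
    \<le> (\<integral>\<^sup>+x\<in>\<Omega>. epowr (\<rho> x) \<alpha> * ennreal (tnorm M x (grad M u x) powr p) \<partial>vol)"
proof (cases "p - 1 - \<alpha> = 0")
  case True
  then show ?thesis by simp
next
  case bn: False
  define b where "b = p - 1 - \<alpha>"
  define s where "s = \<bar>b\<bar> / p"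
  have b: "b \<noteq> 0" using bn by (simp add: b_def)
  have s: "s > 0" using b p by (simp add: s_def)
  obtain J :: "'m set" and w c K where J: "finite J"
    and c: "\<And>j. j \<in> J \<Longrightarrow> c j \<in> charts M" and w: "\<And>j. j \<in> J \<Longrightarrow> w j \<in> C0k M 1 \<Omega>" "\<And>j x. w j x \<ge> 0"
    and K: "\<And>j. j \<in> J \<Longrightarrow> compact (K j)" "\<And>j. j \<in> J \<Longrightarrow> K j \<subseteq> fst (c j) \<inter> \<Omega>"
      "\<And>j x. j \<in> J \<Longrightarrow> x \<notin> K j \<Longrightarrow> w j x = 0"
    and sum: "\<And>x. (\<Sum>j\<in>J. w j x) = \<bar>u x\<bar> powr p"
    by (rule abs_powr_decomposition[OF u]) (rule that; assumption)
  define k where "k j x = indicator \<Omega> x * (\<rho> x powr (- b) * (tX x powr (p - 2) * dX (w j) x))" for j x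
  define l where "l j x = indicator \<Omega> x * (w j x * \<rho> x powr (\<alpha> - p) * tX x powr p)" for j x
  note cacc = caccioppoli_vol[OF c bn w(1) w(2) K, folded b_def, folded k_def l_def]
  \<comment> \<open>\<open>E\<close> is the cross term with the gradient of |u|^p written out, and
    \<open>L\<close> is the Hardy integrand in real powers.\<close>
  define E where "E x = indicator \<Omega> x * (\<rho> x powr (- b) * (tX x powr (p - 2) * (p * \<bar>u x\<bar> powr (p - 1) * sgn (u x) * dX u x)))" for x
  define L where "L x = indicator \<Omega> x * (\<bar>u x\<bar> powr p * \<rho> x powr (\<alpha> - p) * tX x powr p)" for x
  have Ek: "E x = (\<Sum>j\<in>J. k j x)" for x
  proof (cases "x \<in> \<Omega>")
    case True
    have "(\<Sum>j\<in>J. dX (w j) x) = p * \<bar>u x\<bar> powr (p - 1) * sgn (u x) * dX u x"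
      by (rule dX_sum[OF u _ sum True]) (rule w(1))
    then show ?thesis
      unfolding E_def k_def by (simp add: sum_distrib_left[symmetric])
  qed (simp add: E_def k_def)
  have Ll: "L x = (\<Sum>j\<in>J. l j x)" for x
    unfolding L_def l_def sum[symmetric] by (simp add: sum_distrib_left sum_distrib_right)
  note [measurable] = \<rho>_measurable tX_measurable
  have lm: "l j \<in> borel_measurable vol" if "j \<in> J" for j
    unfolding l_def[abs_def]
  proof (rule restrict_indicator_measurable)
    have [measurable]: "w j \<in> borel_measurable (restrict_space vol \<Omega>)"
      by (intro measurable_restrict_space1 continuous_measurable_vol C0k_continuous[OF w(1)[OF that]])
    show "(\<lambda>x. w j x * \<rho> x powr (\<alpha> - p) * tX x powr p) \<in> borel_measurable (restrict_space vol \<Omega>)" by measurable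
  qed
  have l0: "l j x \<ge> 0" for j x using w(2) by (simp add: l_def)
  have L0: "L x \<ge> 0" for x by (simp add: L_def)
  have Lm: "L \<in> borel_measurable vol" unfolding Ll[abs_def] by (intro borel_measurable_sum lm)
  have ki: "integrable vol (k j)" if "j \<in> J" for j using cacc(1)[OF that that that that that] by simp
  have Ei: "integrable vol E" unfolding Ek[abs_def] by (intro Bochner_Integration.integrable_sum ki)
  have "(\<integral>\<^sup>+x. ennreal (b\<^sup>2 * L x) \<partial>vol) = (\<integral>\<^sup>+x. (\<Sum>j\<in>J. ennreal (b\<^sup>2 * l j x)) \<partial>vol)"
    unfolding Ll sum_distrib_left by (subst sum_ennreal) (auto simp: l0)
  also have "\<dots> = (\<Sum>j\<in>J. \<integral>\<^sup>+x. ennreal (b\<^sup>2 * l j x) \<partial>vol)"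
    using lm by (intro nn_integral_sum) auto
  also have "\<dots> \<le> (\<Sum>j\<in>J. ennreal (b * (\<integral>x. k j x \<partial>vol)))"
    using cacc(2) by (intro sum_mono) simp
  also have "\<dots> = ennreal (b * (\<integral>x. E x \<partial>vol))"
    using cacc(3) ki by (simp add: sum_ennreal Ek sum_distrib_left)
  finally have main: "(\<integral>\<^sup>+x. ennreal (b\<^sup>2 * L x) \<partial>vol) \<le> ennreal (b * (\<integral>x. E x \<partial>vol))" .
  \<comment> \<open>The right-hand side of \<open>main\<close> is a real number because
    \<open>E\<close> is integrable; this is the finiteness that absorption needs.\<close>
  have Li: "integrable vol L"
  proof -
    have "integrable vol (\<lambda>x. b\<^sup>2 * L x)"
      using main Lm L0 by (intro integrableI_nonneg) (auto intro: order.strict_trans1)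
    then show ?thesis using b by simp
  qed
  have "ennreal (b\<^sup>2 * (\<integral>x. L x \<partial>vol)) \<le> ennreal (b * (\<integral>x. E x \<partial>vol))"
    using main nn_integral_eq_integral[of vol "\<lambda>x. b\<^sup>2 * L x"] Li L0 by simp
  moreover have "0 \<le> b * (\<integral>x. E x \<partial>vol)"
    using cacc(3) ki by (simp add: Ek sum_distrib_left sum_nonneg)
  ultimately have LE: "b\<^sup>2 * (\<integral>x. L x \<partial>vol) \<le> b * (\<integral>x. E x \<partial>vol)"
    by (simp add: ennreal_le_iff)
  \<comment> \<open>Normalises the energy term of Young's inequality: d |b| s^(1-p) = 1. Because b^2
    = |b| p s, the coefficient of L left by absorption is d |b| s = s^p.\<close>
  define d where "d = s powr (p - 1) / \<bar>b\<bar>"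
  have d: "d > 0" using s b by (simp add: d_def)
  \<comment> \<open>What remains of the cross term after the Hardy part is subtracted. It is
    integrable and lies pointwise below the energy density, so the energy integral enters only
    through a comparison and may be infinite.\<close>
  define f where "f x = d * (b * E x - \<bar>b\<bar> * ((p - 1) * s) * L x)" for x
  have fi: "integrable vol f" unfolding f_def[abs_def] using Ei Li by auto
  have "s powr p * (\<integral>x. L x \<partial>vol) = d * (b\<^sup>2 * (\<integral>x. L x \<partial>vol) - \<bar>b\<bar> * ((p - 1) * s) * (\<integral>x. L x \<partial>vol))"
  proof -
    have "b\<^sup>2 - \<bar>b\<bar> * ((p - 1) * s) = \<bar>b\<bar> * s"
    proof -
      have "b\<^sup>2 = \<bar>b\<bar> * (p * s)" using p by (simp add: s_def power2_eq_square)
      then show ?thesis by (simp add: algebra_simps)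
    qed
    moreover have "d * (\<bar>b\<bar> * s) = s powr p" using b s by (simp add: d_def powr_diff)
    ultimately show ?thesis by (metis left_diff_distrib mult.assoc)
  qed
  also have "\<dots> \<le> d * (b * (\<integral>x. E x \<partial>vol) - \<bar>b\<bar> * ((p - 1) * s) * (\<integral>x. L x \<partial>vol))"
    using LE d by (intro mult_left_mono) auto
  also have "\<dots> = (\<integral>x. f x \<partial>vol)" unfolding f_def using Ei Li by simp
  finally have fL: "s powr p * (\<integral>x. L x \<partial>vol) \<le> (\<integral>x. f x \<partial>vol)" .
  have fR: "AE x in vol. ennreal (f x) \<le> epowr (\<rho> x) \<alpha> * ennreal (tnorm M x (grad M u x) powr p) * indicator \<Omega> x"
    using nonneg
  proof eventually_elim
    case (elim x)
    show ?case
    proof (cases "x \<in> \<Omega>")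
      case True
      define g where "g = tnorm M x (grad M u x)"
      have gT: "grad M u x \<in> tangent_space M x"
        using chart_exists[of x] grad_C0k(1)[OF u X_tangent[OF True]] by blast
      have g: "g \<ge> 0" using metric_nonneg[OF gT] by (simp add: g_def tnorm_def)
      have "b * E x \<le> \<bar>b\<bar> * ((p - 1) * s * L x + s powr (1 - p) * (\<rho> x powr \<alpha> * g powr p))"
        using young_pointwise[OF b_def b s_def _ tX_nonneg[OF True] g, of "\<rho> x" "dX u x" "u x"]
          metric_Cauchy_Schwarz[OF X_tangent[OF True] gT] elim True by (simp add: E_def L_def g_def)
      then have "b * E x - \<bar>b\<bar> * ((p - 1) * s) * L x \<le> \<bar>b\<bar> * (s powr (1 - p) * (\<rho> x powr \<alpha> * g powr p))"
        by (simp add: algebra_simps)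
      then have "f x \<le> d * (\<bar>b\<bar> * (s powr (1 - p) * (\<rho> x powr \<alpha> * g powr p)))"
        unfolding f_def using d by (intro mult_left_mono) auto
      also have "\<dots> = \<rho> x powr \<alpha> * g powr p"
      proof -
        have "s powr (p - 1) * s powr (1 - p) = 1" using s by (simp flip: powr_add)
        then have "d * (\<bar>b\<bar> * s powr (1 - p)) = 1" using b by (simp add: d_def)
        then show ?thesis by (metis mult.assoc mult_1)
      qed
      finally have "ennreal (f x) \<le> ennreal (\<rho> x powr \<alpha>) * ennreal (g powr p)"
        by (simp add: ennreal_leI ennreal_mult[symmetric])
      also have "\<dots> \<le> epowr (\<rho> x) \<alpha> * ennreal (g powr p)"
        using elim True by (intro mult_right_mono ennreal_powr_le_epowr) auto
      finally show ?thesis using True by (simp add: g_def)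
    qed (simp add: f_def E_def L_def)
  qed
  define Z where "Z = closure {x. u x \<noteq> 0}"
  have Z: "compact Z" "Z \<subseteq> \<Omega>" using u by (auto simp: C0k_def compactly_supported_in_def Z_def)
  have uZ: "u x = 0" if "x \<notin> Z" for x using that closure_subset[of "{x. u x \<noteq> 0}"] by (auto simp: Z_def)
  \<comment> \<open>At a zero of \<rho> the extended quotient |u|^p / \<rho>^p is infinite if u is
    nonzero. For \<alpha> > 0 the factor \<rho>^\<alpha> = 0 removes it; for \<alpha> \<le> 0 that
    factor is 1 or infinite, and only the vanishing of the gradient helps.\<close>
  have zero: "AE x in vol. x \<in> Z \<and> \<rho> x = 0 \<and> \<alpha> \<le> 0 \<longrightarrow> tX x = 0"
  proof (cases "\<alpha> \<le> 0")
    case True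
    have "AE x in vol. x \<in> Z \<and> \<rho> x = 0 \<longrightarrow> tX x = 0" using True p by (intro gradient_zero_AE Z) simp
    then show ?thesis by eventually_elim blast
  qed simp
  have "(\<integral>\<^sup>+x\<in>\<Omega>. epowr (\<rho> x) \<alpha> * (ennreal (\<bar>u x\<bar> powr p) / epowr (\<rho> x) p) * ennreal (tX x powr p) \<partial>vol)
      \<le> (\<integral>\<^sup>+x. ennreal (L x) \<partial>vol)"
  proof (rule nn_integral_mono_AE)
    show "AE x in vol. epowr (\<rho> x) \<alpha> * (ennreal (\<bar>u x\<bar> powr p) / epowr (\<rho> x) p) * ennreal (tX x powr p) * indicator \<Omega> x \<le> ennreal (L x)"
      using nonneg zero
    proof eventually_elim
      case (elim x)
      show ?case
      proof (cases "x \<in> \<Omega>")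
        case True
        consider "\<rho> x > 0" | "\<rho> x = 0" "\<alpha> > 0" | "\<rho> x = 0" "\<alpha> \<le> 0" "x \<in> Z" | "u x = 0"
          using elim True uZ[of x] by force
        then show ?thesis
        proof cases
          case 1
          then have "ennreal (\<bar>u x\<bar> powr p) / epowr (\<rho> x) p = ennreal (\<bar>u x\<bar> powr p / \<rho> x powr p)"
            by (simp add: epowr_pos divide_ennreal)
          then have "epowr (\<rho> x) \<alpha> * (ennreal (\<bar>u x\<bar> powr p) / epowr (\<rho> x) p) * ennreal (tX x powr p)
             = ennreal (\<rho> x powr \<alpha> * (\<bar>u x\<bar> powr p / \<rho> x powr p) * tX x powr p)"
            using 1 by (simp add: epowr_pos ennreal_mult[symmetric])
          also have "\<rho> x powr \<alpha> * (\<bar>u x\<bar> powr p / \<rho> x powr p) * tX x powr p = L x"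
            using True 1 by (simp add: L_def powr_diff)
          finally show ?thesis using True by simp
        qed (use elim p in \<open>auto simp: epowr_def\<close>)
      qed simp
    qed
  qed
  also have "(\<integral>\<^sup>+x. ennreal (L x) \<partial>vol) = ennreal (\<integral>x. L x \<partial>vol)"
    using Li L0 by (intro nn_integral_eq_integral) auto
  finally have "ennreal (s powr p) * (\<integral>\<^sup>+x\<in>\<Omega>. epowr (\<rho> x) \<alpha> * (ennreal (\<bar>u x\<bar> powr p) / epowr (\<rho> x) p) * ennreal (tX x powr p) \<partial>vol)
     \<le> ennreal (s powr p) * ennreal (\<integral>x. L x \<partial>vol)" by (rule mult_left_mono) simp
  also have "\<dots> \<le> ennreal (\<integral>x. f x \<partial>vol)"
    using fL L0 by (simp add: ennreal_mult[symmetric] ennreal_leI)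
  \<comment> \<open>\<open>f\<close> may be negative; its positive part turns the signed integral
    into a nonnegative one, to which the pointwise bound applies.\<close>
  also have "\<dots> \<le> ennreal (\<integral>x. max 0 (f x) \<partial>vol)"
    using fi by (intro ennreal_leI integral_mono) auto
  also have "\<dots> = (\<integral>\<^sup>+x. ennreal (max 0 (f x)) \<partial>vol)"
    using fi by (intro nn_integral_eq_integral[symmetric]) auto
  also have "\<dots> \<le> (\<integral>\<^sup>+x\<in>\<Omega>. epowr (\<rho> x) \<alpha> * ennreal (tnorm M x (grad M u x) powr p) \<partial>vol)"
    using fR by (intro nn_integral_mono_AE) (auto simp: max_def ennreal_neg)
  finally show ?thesis by (simp add: s_def b_def)
qed

end

theorem theorem3p1:
  fixes M :: "('m::{t2_space, second_countable_topology}, 'n::finite) rmanifold"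
    and vol :: "'m measure"
    and p \<alpha> :: real
    and \<Omega> :: "'m set"
    and \<rho> :: "'m \<Rightarrow> real"
    and D\<rho> :: "'m \<Rightarrow> ('m, 'n) tvec"
  assumes p: "p > 1"
    and M: "complete_riemannian_manifold M"
    and vol: "riemannian_volume M vol"
    and \<Omega>: "open \<Omega>"
    and \<rho>: "W1p_loc M vol p \<Omega> \<rho> D\<rho>"
    and nonneg: "AE x in vol. x \<in> \<Omega> \<longrightarrow> 0 \<le> \<rho> x"
    and i: "weak_p_Laplace_ineq M vol p \<Omega> (p - 1 - \<alpha>) D\<rho>"
    and ii: "L1_loc_nonneg vol \<Omega> (\<lambda>x. ennreal (tnorm M x (D\<rho> x) powr p) / epowr (\<rho> x) (p - \<alpha>))"
            "L1_loc_nonneg vol \<Omega> (\<lambda>x. epowr (\<rho> x) \<alpha>)"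
  shows "\<forall>u\<in>C0inf M \<Omega>.
    ennreal ((\<bar>p - 1 - \<alpha>\<bar> / p) powr p) *
      (\<integral>\<^sup>+x\<in>\<Omega>. epowr (\<rho> x) \<alpha> * (ennreal (\<bar>u x\<bar> powr p) / epowr (\<rho> x) p)
                 * ennreal (tnorm M x (D\<rho> x) powr p) \<partial>vol)
    \<le> (\<integral>\<^sup>+x\<in>\<Omega>. epowr (\<rho> x) \<alpha> * ennreal (tnorm M x (grad M u x) powr p) \<partial>vol)"
proof
  interpret hardy M vol p \<alpha> \<Omega> \<rho> D\<rho>
    using assms by unfold_locales (auto simp: complete_riemannian_manifold_def)
  fix u assume "u \<in> C0inf M \<Omega>"
  then have "u \<in> C0k M 1 \<Omega>" by (simp add: C0inf_def)
  then show "ennreal ((\<bar>p - 1 - \<alpha>\<bar> / p) powr p) *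
      (\<integral>\<^sup>+x\<in>\<Omega>. epowr (\<rho> x) \<alpha> * (ennreal (\<bar>u x\<bar> powr p) / epowr (\<rho> x) p)
                 * ennreal (tnorm M x (D\<rho> x) powr p) \<partial>vol)
    \<le> (\<integral>\<^sup>+x\<in>\<Omega>. epowr (\<rho> x) \<alpha> * ennreal (tnorm M x (grad M u x) powr p) \<partial>vol)"
    by (rule hardy_inequality)
qed

end
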